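(* Let $L$ be a geometric lattice of rank $r+1$ with $n$ atoms, and let $P$ be the rank $r+1$ near pencil on $n$ atoms. Then $h_S(L)\ge h_S(P)$ for all $S\subseteq[r]$.
   Context: A geometric lattice is a finite graded atomic lattice whose rank function $\rho$ satisfies $\rho(x\vee y)+\rho(x\wedge y)\le \rho(x)+\rho(y)$. For $n\ge r+1$, the rank $r+1$ near pencil on $n$ atoms is the lattice of flats of the simple matroid on $n$ elements that is the direct sum of $r-1$ coloops and the uniform matroid $U_{2,n-r+1}$ (geometrically: $n-r+1$ points on a line together with $r-1$ further points in general position). For a graded poset $P$ of rank $r+1$ with $\hat 0,\hat 1$ and $S\subseteq[r]$, $f_S(P)$ is the number of chains in $P$ whose elements have ranks exactly the elements of $S$, and $h_S(P)=\sum_{T\subseteq S}(-1)^{|S|-|T|}f_T(P)$. *)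

theory Defs
  imports Main
begin

definition is_lub :: "'a set \<Rightarrow> ('a \<Rightarrow> 'a \<Rightarrow> bool) \<Rightarrow> 'a set \<Rightarrow> 'a \<Rightarrow> bool" where
  "is_lub L le A x \<longleftrightarrow> x \<in> L \<and> (\<forall>a\<in>A. le a x) \<and> (\<forall>y\<in>L. (\<forall>a\<in>A. le a y) \<longrightarrow> le x y)"

definition is_glb :: "'a set \<Rightarrow> ('a \<Rightarrow> 'a \<Rightarrow> bool) \<Rightarrow> 'a set \<Rightarrow> 'a \<Rightarrow> bool" where
  "is_glb L le A x \<longleftrightarrow> x \<in> L \<and> (\<forall>a\<in>A. le x a) \<and> (\<forall>y\<in>L. (\<forall>a\<in>A. le y a) \<longrightarrow> le y x)"

definition ljoin :: "'a set \<Rightarrow> ('a \<Rightarrow> 'a \<Rightarrow> bool) \<Rightarrow> 'a \<Rightarrow> 'a \<Rightarrow> 'a" where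
  "ljoin L le x y = (THE z. is_lub L le {x, y} z)"

definition lmeet :: "'a set \<Rightarrow> ('a \<Rightarrow> 'a \<Rightarrow> bool) \<Rightarrow> 'a \<Rightarrow> 'a \<Rightarrow> 'a" where
  "lmeet L le x y = (THE z. is_glb L le {x, y} z)"

definition lbot :: "'a set \<Rightarrow> ('a \<Rightarrow> 'a \<Rightarrow> bool) \<Rightarrow> 'a" where
  "lbot L le = (THE x. x \<in> L \<and> (\<forall>y\<in>L. le x y))"

definition ltop :: "'a set \<Rightarrow> ('a \<Rightarrow> 'a \<Rightarrow> bool) \<Rightarrow> 'a" where
  "ltop L le = (THE x. x \<in> L \<and> (\<forall>y\<in>L. le y x))"

definition partial_order_on' :: "'a set \<Rightarrow> ('a \<Rightarrow> 'a \<Rightarrow> bool) \<Rightarrow> bool" where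
  "partial_order_on' L le \<longleftrightarrow>
     (\<forall>x\<in>L. le x x) \<and>
     (\<forall>x\<in>L. \<forall>y\<in>L. le x y \<and> le y x \<longrightarrow> x = y) \<and>
     (\<forall>x\<in>L. \<forall>y\<in>L. \<forall>z\<in>L. le x y \<and> le y z \<longrightarrow> le x z)"

definition finite_lattice_on :: "'a set \<Rightarrow> ('a \<Rightarrow> 'a \<Rightarrow> bool) \<Rightarrow> bool" where
  "finite_lattice_on L le \<longleftrightarrow> finite L \<and> L \<noteq> {} \<and> partial_order_on' L le \<and>
     (\<forall>x\<in>L. \<forall>y\<in>L. (\<exists>z. is_lub L le {x, y} z) \<and> (\<exists>z. is_glb L le {x, y} z))"

definition is_chain :: "'a set \<Rightarrow> ('a \<Rightarrow> 'a \<Rightarrow> bool) \<Rightarrow> 'a set \<Rightarrow> bool" where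
  "is_chain L le C \<longleftrightarrow> C \<subseteq> L \<and> (\<forall>x\<in>C. \<forall>y\<in>C. le x y \<or> le y x)"

text \<open>Rank (height) of an element: the length of the longest chain from the bottom to x,
  i.e. the maximal number of elements of a chain lying strictly below x.
  In a graded poset with bottom this is its rank function.\<close>
definition height :: "'a set \<Rightarrow> ('a \<Rightarrow> 'a \<Rightarrow> bool) \<Rightarrow> 'a \<Rightarrow> nat" where
  "height L le x = Max {card C | C. is_chain L le C \<and> (\<forall>c\<in>C. le c x \<and> c \<noteq> x)}"

definition covers :: "'a set \<Rightarrow> ('a \<Rightarrow> 'a \<Rightarrow> bool) \<Rightarrow> 'a \<Rightarrow> 'a \<Rightarrow> bool" where
  "covers L le x y \<longleftrightarrow> x \<in> L \<and> y \<in> L \<and> le x y \<and> x \<noteq> y \<and>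
     \<not> (\<exists>z\<in>L. le x z \<and> le z y \<and> z \<noteq> x \<and> z \<noteq> y)"

text \<open>Graded: every cover relation raises the rank by one (equivalently, all maximal chains
  between comparable elements have the same length).\<close>
definition graded_on :: "'a set \<Rightarrow> ('a \<Rightarrow> 'a \<Rightarrow> bool) \<Rightarrow> bool" where
  "graded_on L le \<longleftrightarrow> (\<forall>x y. covers L le x y \<longrightarrow> height L le y = height L le x + 1)"

definition atoms :: "'a set \<Rightarrow> ('a \<Rightarrow> 'a \<Rightarrow> bool) \<Rightarrow> 'a set" where
  "atoms L le = {a. covers L le (lbot L le) a}"

definition geometric_lattice :: "'a set \<Rightarrow> ('a \<Rightarrow> 'a \<Rightarrow> bool) \<Rightarrow> bool" where
  "geometric_lattice L le \<longleftrightarrow>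
     finite_lattice_on L le \<and> graded_on L le \<and>
     (\<forall>x\<in>L. is_lub L le {a \<in> atoms L le. le a x} x) \<and>
     (\<forall>x\<in>L. \<forall>y\<in>L. height L le (ljoin L le x y) + height L le (lmeet L le x y)
                     \<le> height L le x + height L le y)"

definition lattice_rank :: "'a set \<Rightarrow> ('a \<Rightarrow> 'a \<Rightarrow> bool) \<Rightarrow> nat" where
  "lattice_rank L le = height L le (ltop L le)"

definition flag_f :: "'a set \<Rightarrow> ('a \<Rightarrow> 'a \<Rightarrow> bool) \<Rightarrow> nat set \<Rightarrow> nat" where
  "flag_f L le S = card {C. is_chain L le C \<and> height L le ` C = S}"

definition flag_h :: "'a set \<Rightarrow> ('a \<Rightarrow> 'a \<Rightarrow> bool) \<Rightarrow> nat set \<Rightarrow> int" where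
  "flag_h L le S = (\<Sum>T\<in>Pow S. (-1) ^ (card S - card T) * int (flag_f L le T))"

definition matroid_flats :: "'e set \<Rightarrow> ('e set \<Rightarrow> nat) \<Rightarrow> 'e set set" where
  "matroid_flats E rk = {F. F \<subseteq> E \<and> (\<forall>e\<in>E - F. rk (insert e F) > rk F)}"

text \<open>Near pencil: on ground set {0..<n}, elements 0..r-2 are the r-1 coloops,
  elements r-1..n-1 (n-r+1 of them) form the uniform matroid U_{2,n-r+1};
  the rank function of the direct sum is the sum of the rank functions.\<close>
definition near_pencil_rank :: "nat \<Rightarrow> nat \<Rightarrow> nat set \<Rightarrow> nat" where
  "near_pencil_rank r n X = card (X \<inter> {0..<r-1}) + min 2 (card (X \<inter> {r-1..<n}))"

definition near_pencil :: "nat \<Rightarrow> nat \<Rightarrow> nat set set" where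
  "near_pencil r n = matroid_flats {0..<n} (near_pencil_rank r n)"

end

theory Submission
  imports Defs Complex_Main "HOL-Library.List_Lexorder" "HOL-Library.FuncSet" "HOL-Combinatorics.Permutations"
begin

text \<open>Label a cover \<open>X < Y\<close> of flats by the smallest atom of \<open>Y - X\<close>. This is an EL-labelling, so \<open>h\<^sub>S\<close> counts the
  maximal chains whose label word has descent set \<open>S\<close>. For the near pencil of rank \<open>d\<close> on \<open>n\<close> atoms this number is
  \<open>\<beta>\<^sub>d(S) + (n - d) c\<^sub>d(S)\<close>, where \<open>\<beta>\<^sub>d(S)\<close> counts the permutations of \<open>d\<close> letters with descent set \<open>S\<close> and \<open>c\<^sub>d(S)\<close>
  those in which \<open>1\<close> stands before \<open>0\<close>. The same expression is a lower bound for every geometric lattice, by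
  induction on the rank: split the words at the smallest atom \<open>a\<close> and compare with the contraction by \<open>a\<close>. The
  step needs, for every flat \<open>y\<close> above \<open>a\<close>, that the sum of \<open>h\<^sub>T[0, z]\<close> over the complements \<open>z\<close> of \<open>a\<close> in
  \<open>[0, y]\<close> is at least \<open>h\<^sub>T[a, y] + D \<beta>(T)\<close>, where \<open>D\<close> is the number of atoms of \<open>[0, y]\<close> other than \<open>a\<close> minus the
  number of lines through \<open>a\<close>.

  That inequality is proved by linear algebra. The cycles of the \<open>T\<close>-selected intervals \<open>[0, z]\<close> map onto those of
  \<open>[a, y]\<close> under the join with \<open>a\<close>. Two complements spanned by bases that differ by moving one point along a line
  through \<open>a\<close> share a Boolean family of \<open>\<beta>(T)\<close> cycles, so every edge of a spanning forest of this adjacency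
  contributes \<open>\<beta>(T)\<close> dimensions to the kernel. The forest has at least \<open>D\<close> edges, because an atom function that
  sums to zero on the lines through \<open>a\<close> and whose sums over the complements are constant on the components
  vanishes.\<close>

section \<open>Linear systems and forests\<close>

text \<open>Contraction alone is too weak: [a, 1] has only as many atoms as there are lines through
  \<open>a\<close>, say m, so induction yields beta_d(S) + (m - (d - 1)) c_d(S). The kernel term D
  beta(T) is there to recover the missing (n - 1 - m) c_d(S); the two coefficients of c_d(S) add up
  to n - d. It suffices because D is the sum, over the lines l through \<open>a\<close>, of the
  number of atoms on l minus 2, and each line pays at least c_d(S): the spans over l of the subsets
  of a basis of [l, 1] correspond to the permutations with 1 before 0, sorted by the other letters
  standing before 0. Inserting a new smallest letter turns "1 before 0" into "2 before 1"; this does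
  no harm because the number of permutations with descent set S in which i + 1 stands before i is
  the same for every i. Coefficients are real because one step concludes from a vanishing sum of
  squares that each square vanishes. All dimension counts take one form: a system with more unknowns
  than equations has a nonzero solution, and that solution is then shown to be zero.\<close>

lemma underdetermined_system:
  fixes A :: "'j \<Rightarrow> 'i \<Rightarrow> real"
  assumes "finite J" "finite I" "card J < card I"
  shows "\<exists>\<alpha>. (\<exists>i\<in>I. \<alpha> i \<noteq> 0) \<and> (\<forall>j\<in>J. (\<Sum>i\<in>I. \<alpha> i * A j i) = 0)"
  using assms
proof (induction J arbitrary: I A rule: finite_induct)
  case empty
  then obtain i where "i \<in> I" by fastforce
  then show ?case by (intro exI[of _ "\<lambda>_. 1"]) auto
next
  case (insert j J)
  show ?case
  proof (cases "\<forall>i\<in>I. A j i = 0")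
    case True
    have "card J < card I" using insert by simp
    from insert.IH[OF insert.prems(1) this] obtain \<alpha> where
      "\<exists>i\<in>I. \<alpha> i \<noteq> 0" "\<forall>j\<in>J. (\<Sum>i\<in>I. \<alpha> i * A j i) = 0" by blast
    then show ?thesis using True by (intro exI[of _ \<alpha>]) auto
  next
    case False
    then obtain p where p: "p \<in> I" "A j p \<noteq> 0" by blast
    define I' where "I' = I - {p}"
    have I: "I = insert p I'" "p \<notin> I'" "finite I'" using p insert.prems by (auto simp: I'_def)
    \<comment> \<open>Gaussian elimination: \<open>A'\<close> is the system after the unknown
      \<open>p\<close> has been eliminated by equation \<open>j\<close>, and \<open>\<gamma>\<close>
      restores \<open>p\<close> by back substitution.\<close>
    define A' where "A' = (\<lambda>k i. A k i - A k p * A j i / A j p)"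
    have "card J < card I'" using insert.prems insert.hyps I by simp
    from insert.IH[OF I(3) this, of A'] obtain \<alpha> where
      \<alpha>: "\<exists>i\<in>I'. \<alpha> i \<noteq> 0" "\<And>k. k \<in> J \<Longrightarrow> (\<Sum>i\<in>I'. \<alpha> i * A' k i) = 0" by blast
    define \<gamma> where "\<gamma> = (\<lambda>i. if i = p then - (\<Sum>i\<in>I'. \<alpha> i * A j i) / A j p else \<alpha> i)"
    have sum: "(\<Sum>i\<in>I. \<gamma> i * A k i) = (\<Sum>i\<in>I'. \<alpha> i * A' k i)" for k
    proof -
      have "(\<Sum>i\<in>I. \<gamma> i * A k i) = \<gamma> p * A k p + (\<Sum>i\<in>I'. \<gamma> i * A k i)"
        using I by simp
      also have "(\<Sum>i\<in>I'. \<gamma> i * A k i) = (\<Sum>i\<in>I'. \<alpha> i * A k i)"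
        by (rule sum.cong) (use I in \<open>auto simp: \<gamma>_def\<close>)
      also have "\<gamma> p * A k p = - (\<Sum>i\<in>I'. \<alpha> i * (A k p * A j i / A j p))"
        by (simp add: \<gamma>_def sum_divide_distrib sum_distrib_left sum_distrib_right algebra_simps)
      also have "\<dots> + (\<Sum>i\<in>I'. \<alpha> i * A k i) = (\<Sum>i\<in>I'. \<alpha> i * A' k i)"
        by (simp add: A'_def sum_subtractf right_diff_distrib)
      finally show ?thesis .
    qed
    have "A' j i = 0" for i using p by (simp add: A'_def)
    then have "(\<Sum>i\<in>I. \<gamma> i * A k i) = 0" if "k \<in> insert j J" for k
      using that \<alpha>(2) by (auto simp: sum)
    moreover have "\<exists>i\<in>I. \<gamma> i \<noteq> 0" using \<alpha>(1) I by (auto simp: \<gamma>_def)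
    ultimately show ?thesis by blast
  qed
qed

text \<open>Breadth-first forest of a symmetric graph: \<open>\<rho>\<close> picks one root in each
  component, \<open>dep\<close> is the distance to it and \<open>p\<close> moves one step closer.
  The drop of \<open>dep\<close> along \<open>p\<close> stands in for acyclicity when the forest is
  dismantled from its leaves.\<close>

lemma spanning_forest:
  fixes R :: "'z \<Rightarrow> 'z \<Rightarrow> bool"
  assumes sym: "\<And>z z'. R z z' \<Longrightarrow> R z' z" and Z: "\<And>z z'. R z z' \<Longrightarrow> z \<in> Z \<and> z' \<in> Z"
  obtains \<rho> p and dep :: "'z \<Rightarrow> nat" where
    "\<And>z z'. R z z' \<Longrightarrow> \<rho> z = \<rho> z'"
    "\<And>z. z \<in> Z \<Longrightarrow> \<rho> z \<in> Z"
    "\<And>z. z \<in> Z \<Longrightarrow> \<rho> (\<rho> z) = \<rho> z"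
    "\<And>z. z \<in> Z \<Longrightarrow> \<rho> z \<noteq> z \<Longrightarrow> R z (p z) \<and> dep (p z) < dep z"
proof -
  define \<rho> where "\<rho> z = (SOME w. R\<^sup>*\<^sup>* z w)" for z
  have \<rho>: "R\<^sup>*\<^sup>* z (\<rho> z)" for z unfolding \<rho>_def by (rule someI[of _ z]) simp
  have symc: "R\<^sup>*\<^sup>* z w \<Longrightarrow> R\<^sup>*\<^sup>* w z" for z w
    by (rule sympD[OF symp_rtranclp[OF sympI]]) (rule sym)
  \<comment> \<open>\<open>SOME\<close> sees only the set of reachable points, so equal reachability
    predicates give the same root.\<close>
  have eq: "\<rho> z = \<rho> w" if "R\<^sup>*\<^sup>* z w" for z w
  proof -
    have "R\<^sup>*\<^sup>* z = R\<^sup>*\<^sup>* w"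
      using rtranclp_trans[OF that] rtranclp_trans[OF symc[OF that]] by (intro ext iffI)
    then show ?thesis by (simp add: \<rho>_def)
  qed
  have inZ: "w \<in> Z" if "R\<^sup>*\<^sup>* z w" "z \<in> Z" for z w
    using that by (induction rule: rtranclp_induct) (use Z in blast)+
  define dep where "dep z = (LEAST n. (R ^^ n) z (\<rho> z))" for z
  have dep: "(R ^^ dep z) z (\<rho> z)" for z
  proof -
    obtain n where "(R ^^ n) z (\<rho> z)" using rtranclp_imp_relpowp[OF \<rho>[of z]] by blast
    then show ?thesis unfolding dep_def by (rule LeastI)
  qed
  define p where "p z = (SOME q. R z q \<and> dep q < dep z)" for z
  have ex: "\<exists>q. R z q \<and> dep q < dep z" if "\<rho> z \<noteq> z" for z
  proof (cases "dep z")
    case 0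
    then show ?thesis using dep[of z] that by simp
  next
    case (Suc n)
    then have "(R ^^ Suc n) z (\<rho> z)" using dep[of z] by simp
    then obtain q where q: "R z q" "(R ^^ n) q (\<rho> z)" by (rule relpowp_Suc_E2)
    have "\<rho> q = \<rho> z" using eq[OF r_into_rtranclp[of R z q]] q by simp
    then have "(R ^^ n) q (\<rho> q)" using q by simp
    then have "dep q \<le> n" unfolding dep_def by (rule Least_le)
    then show ?thesis using q Suc by auto
  qed
  show ?thesis
  proof
    show "R z z' \<Longrightarrow> \<rho> z = \<rho> z'" for z z' by (rule eq) (rule r_into_rtranclp)
    show "z \<in> Z \<Longrightarrow> \<rho> z \<in> Z" for z by (rule inZ[OF \<rho>])
    show "\<rho> (\<rho> z) = \<rho> z" for z by (rule eq[OF \<rho>, symmetric])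
    show "R z (p z) \<and> dep (p z) < dep z" if "\<rho> z \<noteq> z" for z
      unfolding p_def by (rule someI_ex[OF ex[OF that]])
  qed
qed

section \<open>Ranked closure systems\<close>

text \<open>Positions are those of the paper: \<open>i\<close> is a descent if the letter number \<open>i + 1\<close> (at list index \<open>i\<close>) is
  smaller than the letter number \<open>i\<close>.\<close>

definition Des :: "nat list \<Rightarrow> nat set" where
  "Des w = {i. 0 < i \<and> i < length w \<and> w ! i < w ! (i - 1)}"

text \<open>A matroid through its flats. \<open>rk\<close> is constrained on flats only, and
  \<open>rk_insert\<close> carries semimodularity. Intervals are handled by two flats
  \<open>x\<close> and \<open>y\<close> as parameters over the same closure, so contraction by
  \<open>a\<close> is merely the change of the bottom from \<open>x\<close> to
  \<open>cl (insert a x)\<close>. Loops and parallel points are allowed: \<open>cl {}\<close> may be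
  nonempty, and several points may span one atom.\<close>

locale ranked_closure =
  fixes E :: "nat set" and cl :: "nat set \<Rightarrow> nat set" and rk :: "nat set \<Rightarrow> nat"
  assumes finE: "finite E"
    and cl_inc: "X \<subseteq> E \<Longrightarrow> X \<subseteq> cl X"
    and cl_E: "X \<subseteq> E \<Longrightarrow> cl X \<subseteq> E"
    and cl_mono: "X \<subseteq> Y \<Longrightarrow> Y \<subseteq> E \<Longrightarrow> cl X \<subseteq> cl Y"
    and cl_idem: "X \<subseteq> E \<Longrightarrow> cl (cl X) = cl X"
    and rk_insert: "X \<subseteq> E \<Longrightarrow> cl X = X \<Longrightarrow> e \<in> E - X \<Longrightarrow> rk (cl (insert e X)) = rk X + 1"
    and rk_bot: "rk (cl {}) = 0"
begin

definition flat :: "nat set \<Rightarrow> bool" where "flat X \<longleftrightarrow> X \<subseteq> E \<and> cl X = X"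

lemma flat_E: "flat X \<Longrightarrow> X \<subseteq> E" by (simp add: flat_def)
lemma flat_fin: "flat X \<Longrightarrow> finite X" using finE finite_subset flat_E by blast
lemma flat_cl: "X \<subseteq> E \<Longrightarrow> flat (cl X)" by (simp add: flat_def cl_E cl_idem)
lemma flat_eq: "flat X \<Longrightarrow> cl X = X" by (simp add: flat_def)
lemma flat_top: "flat E" using cl_inc[of E] cl_E[of E] by (auto simp: flat_def)
lemma cl_least: "X \<subseteq> Y \<Longrightarrow> flat Y \<Longrightarrow> cl X \<subseteq> Y" using cl_mono[of X Y] by (simp add: flat_def)
lemma finite_flats: "finite {X. flat X}"
  by (rule finite_subset[of _ "Pow E"]) (auto simp: flat_def finE)

lemma cl_un_cl: "X \<subseteq> E \<Longrightarrow> Y \<subseteq> E \<Longrightarrow> cl (cl X \<union> Y) = cl (X \<union> Y)"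
proof (rule antisym)
  assume XY: "X \<subseteq> E" "Y \<subseteq> E"
  have "cl X \<union> Y \<subseteq> cl (X \<union> Y)" using XY cl_mono[of X "X \<union> Y"] cl_inc[of "X \<union> Y"] by auto
  then show "cl (cl X \<union> Y) \<subseteq> cl (X \<union> Y)" by (intro cl_least flat_cl) (use XY in auto)
  show "cl (X \<union> Y) \<subseteq> cl (cl X \<union> Y)" using XY cl_inc[of X] cl_E[of X] by (intro cl_mono) auto
qed

lemma cl_insert_cl: "X \<subseteq> E \<Longrightarrow> e \<in> E \<Longrightarrow> cl (insert e (cl X)) = cl (insert e X)"
  using cl_un_cl[of X "{e}"] by simp

lemma rk_insert_flat: "flat X \<Longrightarrow> e \<in> E \<Longrightarrow> e \<notin> X \<Longrightarrow> rk (cl (insert e X)) = rk X + 1"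
  by (simp add: flat_def rk_insert)

lemma flat_insert: "flat X \<Longrightarrow> e \<in> E \<Longrightarrow> flat (cl (insert e X))"
  by (simp add: flat_cl flat_E)

lemma in_cl_insert: "flat X \<Longrightarrow> e \<in> E \<Longrightarrow> e \<in> cl (insert e X)"
  using cl_inc[of "insert e X"] flat_E by auto

lemma sub_cl_insert: "flat X \<Longrightarrow> e \<in> E \<Longrightarrow> X \<subseteq> cl (insert e X)"
  using cl_inc[of "insert e X"] flat_E by auto

lemma cl_insert_least: "X \<subseteq> Y \<Longrightarrow> e \<in> Y \<Longrightarrow> flat Y \<Longrightarrow> cl (insert e X) \<subseteq> Y"
  by (rule cl_least) auto

lemma rk_mono: "flat X \<Longrightarrow> flat Y \<Longrightarrow> X \<subseteq> Y \<Longrightarrow> rk X \<le> rk Y"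
  and rk_eq: "flat X \<Longrightarrow> flat Y \<Longrightarrow> X \<subseteq> Y \<Longrightarrow> rk X = rk Y \<Longrightarrow> X = Y"
proof -
  have "rk X \<le> rk Y \<and> (rk X = rk Y \<longrightarrow> X = Y)" if "flat X" "flat Y" "X \<subseteq> Y" for X Y
    using that
  proof (induction "card (Y - X)" arbitrary: X rule: less_induct)
    case less
    show ?case
    proof (cases "X = Y")
      case False
      then obtain e where e: "e \<in> Y" "e \<notin> X" using less.prems by blast
      have eE: "e \<in> E" using e less.prems flat_E by blast
      let ?X = "cl (insert e X)"
      have X: "flat ?X" "?X \<subseteq> Y" "rk ?X = rk X + 1" "X \<subseteq> ?X" "e \<in> ?X"
        using less.prems e eE by (auto simp: flat_insert rk_insert_flat sub_cl_insert in_cl_insert intro: cl_insert_least[THEN subsetD])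
      have "card (Y - ?X) < card (Y - X)"
        by (rule psubset_card_mono) (use X e less.prems flat_fin in auto)
      from less.hyps[OF this X(1) less.prems(2) X(2)] show ?thesis using X by auto
    qed auto
  qed
  then show "flat X \<Longrightarrow> flat Y \<Longrightarrow> X \<subseteq> Y \<Longrightarrow> rk X \<le> rk Y"
    "flat X \<Longrightarrow> flat Y \<Longrightarrow> X \<subseteq> Y \<Longrightarrow> rk X = rk Y \<Longrightarrow> X = Y" by blast+
qed

lemma cl_insert_eq_cover:
  assumes "flat X" "flat Y" "X \<subseteq> Y" "rk Y = rk X + 1" "e \<in> Y" "e \<notin> X"
  shows "cl (insert e X) = Y"
proof -
  have "e \<in> E" using assms flat_E by blast
  then show ?thesis
    by (intro rk_eq) (use assms in \<open>auto simp: flat_insert rk_insert_flat intro: cl_insert_least[THEN subsetD]\<close>)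
qed

text \<open>Steinitz exchange comes from rank: both closures have rank \<open>rk X + 1\<close> and
  one contains the other.\<close>

lemma exchange:
  assumes "flat X" "e \<in> E" "f \<in> cl (insert e X)" "f \<notin> X"
  shows "cl (insert f X) = cl (insert e X)"
proof -
  have "e \<notin> X" using assms insert_absorb flat_eq by metis
  then show ?thesis
    by (intro cl_insert_eq_cover) (use assms in \<open>auto simp: flat_insert sub_cl_insert rk_insert_flat\<close>)
qed

section \<open>Joins and independence of words over a flat\<close>

definition word_flat :: "nat set \<Rightarrow> nat list \<Rightarrow> nat set" where "word_flat x w = cl (x \<union> set w)"

lemma word_flat_Nil [simp]: "flat x \<Longrightarrow> word_flat x [] = x" by (simp add: word_flat_def flat_eq)
lemma flat_word_flat: "flat x \<Longrightarrow> set w \<subseteq> E \<Longrightarrow> flat (word_flat x w)" by (simp add: word_flat_def flat_cl flat_E)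
lemma word_flat_append: "flat x \<Longrightarrow> set u \<subseteq> E \<Longrightarrow> set v \<subseteq> E \<Longrightarrow> word_flat x (u @ v) = word_flat (word_flat x u) v"
  using cl_un_cl[of "x \<union> set u" "set v"] by (simp add: word_flat_def flat_E Un_assoc)
lemma word_flat_single: "word_flat x [e] = cl (insert e x)" by (simp add: word_flat_def)
lemma word_flat_sub: "flat x \<Longrightarrow> set w \<subseteq> E \<Longrightarrow> x \<subseteq> word_flat x w"
  using cl_inc[of "x \<union> set w"] flat_E by (auto simp: word_flat_def)
lemma set_sub_word_flat: "flat x \<Longrightarrow> set w \<subseteq> E \<Longrightarrow> set w \<subseteq> word_flat x w"
  using cl_inc[of "x \<union> set w"] flat_E by (auto simp: word_flat_def)
lemma word_flat_least: "x \<subseteq> y \<Longrightarrow> set w \<subseteq> y \<Longrightarrow> flat y \<Longrightarrow> word_flat x w \<subseteq> y"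
  unfolding word_flat_def by (rule cl_least) auto
lemma word_flat_mono: "flat x \<Longrightarrow> set v \<subseteq> E \<Longrightarrow> set u \<subseteq> set v \<Longrightarrow> word_flat x u \<subseteq> word_flat x v"
  unfolding word_flat_def using flat_E by (intro cl_mono) auto
lemma word_flat_cong: "set u = set v \<Longrightarrow> word_flat x u = word_flat x v" by (simp add: word_flat_def)

lemma rk_word_flat_le: "flat x \<Longrightarrow> set w \<subseteq> E \<Longrightarrow> rk (word_flat x w) \<le> rk x + length w"
proof (induction w rule: rev_induct)
  case (snoc e w)
  then have *: "word_flat x (w @ [e]) = cl (insert e (word_flat x w))" by (simp add: word_flat_append word_flat_single)
  show ?case
  proof (cases "e \<in> word_flat x w")
    case True
    then have "word_flat x (w @ [e]) = word_flat x w" using * snoc.prems by (simp add: insert_absorb flat_eq flat_word_flat)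
    then show ?thesis using snoc by simp
  next
    case False
    then have "rk (word_flat x (w @ [e])) = rk (word_flat x w) + 1" using * snoc.prems by (simp add: rk_insert_flat flat_word_flat)
    then show ?thesis using snoc by simp
  qed
qed simp

definition indep :: "nat set \<Rightarrow> nat list \<Rightarrow> bool" where
  "indep x w \<longleftrightarrow> set w \<subseteq> E \<and> rk (word_flat x w) = rk x + length w"

lemma indep_append:
  assumes "flat x" shows "indep x (u @ v) \<longleftrightarrow> indep x u \<and> indep (word_flat x u) v"
proof -
  have "rk (word_flat x u) \<le> rk x + length u" "rk (word_flat (word_flat x u) v) \<le> rk (word_flat x u) + length v" if "set u \<subseteq> E" "set v \<subseteq> E"
    using rk_word_flat_le assms that flat_word_flat by auto
  then show ?thesis using assms unfolding indep_def by (auto simp: word_flat_append)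
qed

lemma indep_take: "flat x \<Longrightarrow> indep x w \<Longrightarrow> indep x (take i w)"
  using indep_append[of x "take i w" "drop i w"] by simp

lemma indep_single: "flat x \<Longrightarrow> indep x [e] \<longleftrightarrow> e \<in> E - x"
  using rk_insert_flat[of x e] flat_E[of x] flat_eq[of x] by (auto simp: indep_def word_flat_single insert_absorb)

lemma indep_nth: "flat x \<Longrightarrow> indep x w \<Longrightarrow> i < length w \<Longrightarrow> w ! i \<notin> word_flat x (take i w)"
proof -
  assume A: "flat x" "indep x w" "i < length w"
  then have "indep x (take i w @ [w ! i])" by (metis indep_take take_Suc_conv_app_nth)
  moreover have "flat (word_flat x (take i w))" using A by (meson flat_word_flat indep_def indep_take)
  ultimately show ?thesis using A indep_append indep_single by blast
qed

lemma indep_distinct: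
  assumes "flat x" "indep x w" shows "distinct w"
  unfolding distinct_conv_nth
proof (intro allI impI)
  have *: "w ! i \<noteq> w ! j" if "i < j" "j < length w" for i j
  proof -
    have "w ! i \<in> set (take j w)" using that by (auto simp: in_set_conv_nth intro!: exI[of _ i])
    then have "w ! i \<in> word_flat x (take j w)"
      using set_sub_word_flat[of x "take j w"] assms indep_take[of x w j] by (auto simp: indep_def)
    moreover have "w ! j \<notin> word_flat x (take j w)" using indep_nth[OF assms] that by simp
    ultimately show ?thesis by auto
  qed
  show "w ! i \<noteq> w ! j" if "i < length w" "j < length w" "i \<noteq> j" for i j
    using *[of i j] *[of j i] that by (cases "i < j") auto
qed

lemma indep_perm: "indep x w \<Longrightarrow> set v = set w \<Longrightarrow> length v = length w \<Longrightarrow> indep x v"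
  using word_flat_cong[of v w x] by (auto simp: indep_def)

lemma indep_exists:
  assumes "flat x" "flat y" "x \<subseteq> y"
  obtains w where "indep x w" "word_flat x w = y" "length w = rk y - rk x"
proof -
  have "\<exists>w. indep x w \<and> word_flat x w = y"
    using assms
  proof (induction "rk y - rk x" arbitrary: x)
    case 0
    then have "x = y" using rk_mono rk_eq by (metis diff_is_0_eq le_antisym)
    then show ?case using 0 by (intro exI[of _ "[]"]) (simp add: indep_def)
  next
    case (Suc n)
    then have "x \<noteq> y" by auto
    then obtain e where e: "e \<in> y" "e \<notin> x" using Suc.prems by blast
    have eE: "e \<in> E" using e Suc.prems flat_E by blast
    let ?x = "cl (insert e x)"
    have x: "flat ?x" "?x \<subseteq> y" "rk ?x = rk x + 1" using Suc.prems e eE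
      by (auto simp: flat_insert rk_insert_flat intro: cl_insert_least[THEN subsetD])
    have "n = rk y - rk ?x" using Suc.hyps(2) x by simp
    then obtain w where w: "indep ?x w" "word_flat ?x w = y"
      using Suc.hyps(1)[OF _ x(1) Suc.prems(2) x(2)] by auto
    have "indep x [e]" using e eE Suc indep_single by simp
    then have "indep x ([e] @ w)" using w Suc.prems indep_append[of x "[e]" w] by (simp add: word_flat_single)
    moreover have "word_flat x ([e] @ w) = y"
      using w eE Suc.prems word_flat_append[of x "[e]" w] by (auto simp: word_flat_single indep_def)
    ultimately show ?case by blast
  qed
  then show ?thesis using that by (auto simp: indep_def)
qed

end

section \<open>Words, maximal chains and ribbon cycles\<close>

lemma list_less_first_diff:
  fixes v w :: "nat list"
  assumes "length v = length w" "i < length w" "take i v = take i w" "v ! i < w ! i"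
  shows "v < w"
  using assms unfolding list_less_def lexord_take_index_conv by auto

lemma list_first_diff:
  assumes "length v = length w" "v \<noteq> w"
  obtains i where "i < length w" "take i v = take i w" "v ! i \<noteq> w ! i"
proof -
  define i where "i = (LEAST i. i < length w \<and> v ! i \<noteq> w ! i)"
  have ex: "\<exists>i. i < length w \<and> v ! i \<noteq> w ! i" using assms by (auto simp: list_eq_iff_nth_eq)
  have i: "i < length w \<and> v ! i \<noteq> w ! i" unfolding i_def by (rule LeastI_ex[OF ex])
  have "v ! j = w ! j" if "j < i" for j using not_less_Least[OF that[unfolded i_def]] that i by auto
  then have "take i v = take i w" using i assms by (intro nth_equalityI) auto
  then show ?thesis using that i by blast
qed

text \<open>List index \<open>i\<close> and \<open>i + 1\<close> are in the same column of the ribbon if \<open>i + 1 \<in> T\<close>.\<close>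

definition column_group :: "nat \<Rightarrow> nat set \<Rightarrow> (nat \<Rightarrow> nat) set" where
  "column_group r T = {\<pi>. \<pi> permutes {..<r} \<and> (\<forall>i<r. {min i (\<pi> i)<..max i (\<pi> i)} \<subseteq> T)}"

lemma finite_column [simp]: "finite (column_group r T)"
  by (rule finite_subset[OF _ finite_permutations[of "{..<r}"]]) (auto simp: column_group_def)

lemma id_column: "id \<in> column_group r T" by (auto simp: column_group_def permutes_id)

lemma column_permutes: "\<pi> \<in> column_group r T \<Longrightarrow> \<pi> permutes {..<r}" by (simp add: column_group_def)

text \<open>Right multiplication by a transposition of two neighbours in one column stays in the
  group, because the interval between a point and its image gains at most the position
  \<open>t\<close>.\<close>

lemma column_transpose:
  assumes "\<pi> \<in> column_group r T" "t \<in> T" "T \<subseteq> {1..<r}"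
  shows "\<pi> \<circ> transpose (t - 1) t \<in> column_group r T"
proof -
  have t: "0 < t" "t < r" using assms by auto
  have \<pi>: "\<pi> permutes {..<r}" "\<And>i. i < r \<Longrightarrow> {min i (\<pi> i)<..max i (\<pi> i)} \<subseteq> T"
    using assms(1) by (auto simp: column_group_def)
  have "{min i ((\<pi> \<circ> transpose (t - 1) t) i)<..max i ((\<pi> \<circ> transpose (t - 1) t) i)} \<subseteq> T" if "i < r" for i
  proof -
    consider "i = t - 1" | "i = t" | "i \<noteq> t - 1" "i \<noteq> t" by blast
    then show ?thesis
    proof cases
      case 1
      have "{min i (\<pi> t)<..max i (\<pi> t)} \<subseteq> insert t {min t (\<pi> t)<..max t (\<pi> t)}"
        using t 1 by (auto simp: min_def max_def split: if_splits)
      then show ?thesis using 1 \<pi>(2)[OF t(2)] assms(2) by auto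
    next
      case 2
      have "{min i (\<pi> (t - 1))<..max i (\<pi> (t - 1))} \<subseteq>
          insert t {min (t - 1) (\<pi> (t - 1))<..max (t - 1) (\<pi> (t - 1))}"
        using t 2 by (auto simp: min_def max_def split: if_splits)
      also have "\<dots> \<subseteq> T" using \<pi>(2)[of "t - 1"] assms(2) t by simp
      finally show ?thesis using 2 by simp
    next
      case 3
      then show ?thesis using \<pi>(2)[OF that] by (simp add: transpose_def)
    qed
  qed
  moreover have "\<pi> \<circ> transpose (t - 1) t permutes {..<r}"
    using t by (intro permutes_compose \<pi>(1) permutes_swap_id) auto
  ultimately show ?thesis by (simp add: column_group_def)
qed

text \<open>Right multiplication by the transposition is a sign-reversing involution of the column
  group, and \<open>g\<close> is constant on its orbits.\<close>

lemma column_sign_cancel: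
  fixes g :: "(nat \<Rightarrow> nat) \<Rightarrow> real"
  assumes t: "t \<in> T" "T \<subseteq> {1..<r}"
    and g: "\<And>\<pi>. \<pi> \<in> column_group r T \<Longrightarrow> g (\<pi> \<circ> transpose (t - 1) t) = g \<pi>"
  shows "(\<Sum>\<pi>\<in>column_group r T. of_int (sign \<pi>) * g \<pi>) = 0"
proof -
  let ?f = "\<lambda>\<pi>. \<pi> \<circ> transpose (t - 1) t"
  have ff: "?f (?f \<pi>) = \<pi>" for \<pi> :: "nat \<Rightarrow> nat" by (simp add: comp_assoc)
  have bij: "bij_betw ?f (column_group r T) (column_group r T)"
    by (rule bij_betwI[of _ _ _ ?f]) (use column_transpose[OF _ t] ff in auto)
  have "(\<Sum>\<pi>\<in>column_group r T. of_int (sign \<pi>) * g \<pi>) = (\<Sum>\<pi>\<in>column_group r T. of_int (sign (?f \<pi>)) * g (?f \<pi>))"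
    by (rule sum.reindex_bij_betw[OF bij, symmetric])
  also have "\<dots> = (\<Sum>\<pi>\<in>column_group r T. - (of_int (sign \<pi>) * g \<pi>))"
  proof (rule sum.cong[OF refl])
    fix \<pi> assume \<pi>: "\<pi> \<in> column_group r T"
    have "permutation \<pi>" using column_permutes[OF \<pi>] permutes_imp_permutation[of "{..<r}"] by simp
    then have "sign (?f \<pi>) = sign \<pi> * sign (transpose (t - 1) t)"
      by (intro sign_compose permutation_swap_id)
    moreover have "t - 1 \<noteq> t" using t by (cases t) auto
    ultimately show "of_int (sign (?f \<pi>)) * g (?f \<pi>) = - (of_int (sign \<pi>) * g \<pi>)"
      using g[OF \<pi>] by (simp add: sign_swap_id)
  qed
  finally show ?thesis by (simp add: sum_negf)
qed

lemma Des_run: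
  assumes "{i<..j} \<subseteq> Des w" "i < j"
  shows "w ! j < w ! i"
  using assms
proof (induction j)
  case (Suc j)
  have "Suc j \<in> Des w" using Suc.prems by auto
  then have *: "w ! Suc j < w ! j" by (simp add: Des_def)
  show ?case
  proof (cases "i = j")
    case False
    have "{i<..j} \<subseteq> Des w" using Suc.prems by auto
    then show ?thesis using Suc False * by auto
  qed (use * in simp)
qed simp

text \<open>A word whose descent set is exactly \<open>T\<close> decreases along every column, so any nontrivial
  column permutation makes it lexicographically smaller.\<close>

lemma permute_column_less:
  assumes "Des w = T" "\<pi> \<in> column_group (length w) T" "\<pi> \<noteq> id"
  shows "permute_list \<pi> w < w"
proof -
  let ?r = "length w"
  have p: "\<pi> permutes {..<?r}" using assms column_permutes by blast
  obtain j where "\<pi> j \<noteq> j" using assms(3) by (auto simp: fun_eq_iff)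
  define i where "i = (LEAST j. \<pi> j \<noteq> j)"
  have i: "\<pi> i \<noteq> i" unfolding i_def by (rule LeastI[of _ j]) fact
  have fx: "\<pi> k = k" if "k < i" for k using not_less_Least[OF that[unfolded i_def]] by simp
  have ir: "i < ?r" using i p by (meson lessThan_iff permutes_not_in)
  \<comment> \<open>Indices below \<open>i\<close> are fixed, so injectivity forces the first moved
    index upwards, hence to a smaller letter of its column.\<close>
  have "\<not> \<pi> i < i" using fx[of "\<pi> i"] i permutes_inj[OF p] by (metis injD)
  then have ipi: "i < \<pi> i" using i by simp
  then have "{i<..\<pi> i} \<subseteq> T" using assms(2) ir by (auto simp: column_group_def min_def max_def dest!: spec[of _ i])
  then have "w ! (\<pi> i) < w ! i" using Des_run ipi assms(1) by blast
  moreover have "take i (permute_list \<pi> w) = take i w"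
    using ir by (intro nth_equalityI) (auto simp: permute_list_nth[OF p] fx)
  ultimately show ?thesis
    using ir by (intro list_less_first_diff[of _ _ i]) (auto simp: permute_list_nth[OF p])
qed

context ranked_closure
begin

text \<open>A cover \<open>X < Y\<close> is labelled \<open>Min (Y - X)\<close>; good words are the label words of maximal chains, from which the
  chain is recovered by taking joins.\<close>

definition good :: "nat set \<Rightarrow> nat list \<Rightarrow> bool" where
  "good x w \<longleftrightarrow> indep x w \<and>
     (\<forall>i<length w. w ! i = Min (word_flat x (take (Suc i) w) - word_flat x (take i w)))"

definition good_words :: "nat set \<Rightarrow> nat set \<Rightarrow> nat set \<Rightarrow> nat list set" where
  "good_words x y T = {w. good x w \<and> word_flat x w = y \<and> Des w = T}"

definition chain_of :: "nat set \<Rightarrow> nat set \<Rightarrow> nat list \<Rightarrow> nat \<Rightarrow> nat set" where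
  "chain_of x T w = (\<lambda>t\<in>T. word_flat x (take t w))"

text \<open>A chain is stored as an extensional function of the rank above \<open>x\<close>, so that
  forgetting its member of rank \<open>t\<close> means comparing functions on
  \<open>T - {t}\<close>; the boundary condition is expressed in this way later.\<close>

definition flag_chains :: "nat set \<Rightarrow> nat set \<Rightarrow> nat set \<Rightarrow> (nat \<Rightarrow> nat set) set" where
  "flag_chains x y T = {u \<in> T \<rightarrow>\<^sub>E {z. flat z \<and> x \<subseteq> z \<and> z \<subseteq> y}.
     (\<forall>t\<in>T. rk (u t) = rk x + t) \<and> (\<forall>s\<in>T. \<forall>t\<in>T. s \<le> t \<longrightarrow> u s \<subseteq> u t)}"

lemma good_indep: "good x w \<Longrightarrow> indep x w" by (simp add: good_def)
lemma indep_E: "indep x w \<Longrightarrow> set w \<subseteq> E" by (simp add: indep_def)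
lemma indep_take_E: "indep x w \<Longrightarrow> set (take i w) \<subseteq> E"
  using indep_E set_take_subset by fast

lemma indep_length: "indep x w \<Longrightarrow> word_flat x w = y \<Longrightarrow> length w = rk y - rk x"
  by (auto simp: indep_def)

lemma rk_take: "flat x \<Longrightarrow> indep x w \<Longrightarrow> t \<le> length w \<Longrightarrow> rk (word_flat x (take t w)) = rk x + t"
  using indep_take[of x w t] by (auto simp: indep_def)

lemma finite_words: "finite {w. set w \<subseteq> E \<and> length w = k}"
  by (rule finite_lists_length_eq[OF finE])

lemma finite_good_to: "finite {w. good x w \<and> word_flat x w = y \<and> P w}"
  by (rule finite_subset[OF _ finite_words[of "rk y - rk x"]])
    (auto simp: good_def indep_length dest: indep_E)

lemma finite_good_words [simp]: "finite (good_words x y T)"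
  unfolding good_words_def by (rule finite_good_to)

lemma chain_of_in_flag_chains:
  assumes "flat x" "indep x w" "word_flat x w = y" "T \<subseteq> {1..<length w}"
  shows "chain_of x T w \<in> flag_chains x y T"
proof -
  have *: "flat (word_flat x (take t w))" "x \<subseteq> word_flat x (take t w)" "word_flat x (take t w) \<subseteq> y" for t
    using assms indep_take_E[OF assms(2), of t] indep_E[OF assms(2)] set_take_subset[of t w]
    by (auto simp: flat_word_flat intro: word_flat_sub[THEN subsetD] word_flat_mono[THEN subsetD])
  have "word_flat x (take s w) \<subseteq> word_flat x (take t w)" if "s \<le> t" for s t
    using assms(1) indep_take_E[OF assms(2)] set_take_subset_set_take[OF that, of w] by (intro word_flat_mono) auto
  then show ?thesis using * rk_take[OF assms(1,2)] assms(4) by (auto simp: flag_chains_def chain_of_def)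
qed

lemma finite_flag_chains: "finite T \<Longrightarrow> finite (flag_chains x y T)"
  unfolding flag_chains_def
  by (rule finite_subset[of _ "T \<rightarrow>\<^sub>E {z. flat z}"]) (auto intro!: finite_PiE finite_flats)

text \<open>The flat that a chain with prescribed members \<open>u t\<close> has to reach next when it is at rank \<open>i\<close>.\<close>

definition target :: "nat set \<Rightarrow> (nat \<Rightarrow> nat set) \<Rightarrow> nat set \<Rightarrow> nat \<Rightarrow> nat set" where
  "target T u y i = (if \<exists>t\<in>T. i < t then u (LEAST t. t \<in> T \<and> i < t) else y)"

lemma target_cases:
  obtains t where "t \<in> T" "i < t" "target T u y i = u t" "\<And>s. s \<in> T \<Longrightarrow> i < s \<Longrightarrow> t \<le> s"
  | "\<forall>t\<in>T. t \<le> i" "target T u y i = y"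
proof (cases "\<exists>t\<in>T. i < t")
  case True
  define t where "t = (LEAST t. t \<in> T \<and> i < t)"
  have "\<exists>t. t \<in> T \<and> i < t" using True by blast
  then have "t \<in> T \<and> i < t" unfolding t_def by (rule LeastI_ex)
  moreover have "t \<le> s" if "s \<in> T" "i < s" for s unfolding t_def using that by (intro Least_le) auto
  moreover have "target T u y i = u t" using True by (simp add: target_def t_def)
  ultimately show ?thesis using that(1) by blast
next
  case False
  then show ?thesis by (intro that(2)) (auto simp: target_def not_less)
qed

text \<open>The word of the lexicographically first maximal chain through all members of
  \<open>u\<close>: each letter is the least atom still missing from the next prescribed
  flat.\<close>

definition greedy :: "nat set \<Rightarrow> nat set \<Rightarrow> nat set \<Rightarrow> (nat \<Rightarrow> nat set) \<Rightarrow> nat list \<Rightarrow> bool" where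
  "greedy x y T u w \<longleftrightarrow> length w = rk y - rk x \<and>
     (\<forall>i<length w. w ! i = Min (target T u y i - word_flat x (take i w)))"

lemma target_props:
  assumes "flat x" "flat y" "x \<subseteq> y" "T \<subseteq> {1..<rk y - rk x}" "u \<in> flag_chains x y T" "i < rk y - rk x"
  shows "flat (target T u y i)" "x \<subseteq> target T u y i" "target T u y i \<subseteq> y" "rk x + i < rk (target T u y i)"
    "j \<le> i \<Longrightarrow> target T u y j \<subseteq> target T u y i"
proof -
  have u: "\<And>t. t \<in> T \<Longrightarrow> flat (u t) \<and> x \<subseteq> u t \<and> u t \<subseteq> y \<and> rk (u t) = rk x + t"
    "\<And>s t. s \<in> T \<Longrightarrow> t \<in> T \<Longrightarrow> s \<le> t \<Longrightarrow> u s \<subseteq> u t"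
    using assms(5) by (auto simp: flag_chains_def)
  show "flat (target T u y i)" "x \<subseteq> target T u y i" "target T u y i \<subseteq> y" "rk x + i < rk (target T u y i)"
    using u assms(2,3,6) by (cases rule: target_cases[of T i u y]; auto)+
  show "target T u y j \<subseteq> target T u y i" if "j \<le> i"
  proof (cases rule: target_cases[of T i u y])
    case (1 t)
    show ?thesis
    proof (cases rule: target_cases[of T j u y])
      case (1 s)
      then show ?thesis using u(2)[of s t] \<open>t \<in> T\<close> \<open>target T u y i = u t\<close> \<open>i < t\<close> that by auto
    next
      case 2
      then show ?thesis using 1 that by fastforce
    qed
  next
    case 2
    then show ?thesis using u(1) assms(3) by (cases rule: target_cases[of T j u y]) auto
  qed
qed

text \<open>Between two consecutive members of \<open>T\<close> the target stays fixed while the set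
  of available letters shrinks, so the letters increase there and descents occur in \<open>T\<close>
  only. Each letter is minimal in a set that contains the whole difference of its cover, hence it is
  the label of that cover.\<close>

lemma greedy_imp:
  assumes "flat x" "flat y" "x \<subseteq> y" "T \<subseteq> {1..<rk y - rk x}" "u \<in> flag_chains x y T" "greedy x y T u w"
  shows "good x w" "word_flat x w = y" "Des w \<subseteq> T" "chain_of x T w = u"
proof -
  let ?d = "rk y - rk x"
  note tp = target_props[OF assms(1-5)]
  have len: "length w = ?d" and g: "\<And>i. i < ?d \<Longrightarrow> w ! i = Min (target T u y i - word_flat x (take i w))"
    using assms(6) by (auto simp: greedy_def)
  \<comment> \<open>One invariant for prefixes: independent, inside all later targets, with a legal
    next letter. The last clause keeps the prefix inside the previous target, which by rank pins
    down the prescribed members of the chain.\<close>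
  have main: "set (take i w) \<subseteq> E \<and> rk (word_flat x (take i w)) = rk x + i \<and> word_flat x (take i w) \<subseteq> y \<and>
      (\<forall>j. i \<le> j \<longrightarrow> j < ?d \<longrightarrow> word_flat x (take i w) \<subseteq> target T u y j) \<and>
      (i < ?d \<longrightarrow> w ! i \<in> target T u y i - word_flat x (take i w)) \<and>
      (0 < i \<longrightarrow> word_flat x (take i w) \<subseteq> target T u y (i - 1))" if "i \<le> ?d" for i
    using that
  proof (induction i)
    case 0
    have "w ! 0 \<in> target T u y 0 - x" if "0 < ?d"
    proof -
      have "target T u y 0 - x \<noteq> {}" using tp(1,2,4)[OF that] rk_eq[of x "target T u y 0"] assms(1) by auto
      then show ?thesis using g[OF that] Min_in[of "target T u y 0 - x"] flat_fin tp(1)[OF that] assms(1) by simp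
    qed
    then show ?case using assms tp(2) by simp
  next
    case (Suc i)
    then have IH: "set (take i w) \<subseteq> E" "rk (word_flat x (take i w)) = rk x + i" "word_flat x (take i w) \<subseteq> y"
      "\<And>j. i \<le> j \<Longrightarrow> j < ?d \<Longrightarrow> word_flat x (take i w) \<subseteq> target T u y j"
      "w ! i \<in> target T u y i - word_flat x (take i w)" and i: "i < ?d" by auto
    have fl: "flat (word_flat x (take i w))" using assms(1) IH(1) flat_word_flat by simp
    have wE: "w ! i \<in> E" using IH(5) tp(1)[OF i] flat_E by blast
    have sE: "set (take (Suc i) w) \<subseteq> E" using IH(1) wE i len by (simp add: take_Suc_conv_app_nth)
    have step: "word_flat x (take (Suc i) w) = cl (insert (w ! i) (word_flat x (take i w)))"
      using word_flat_append[OF assms(1) IH(1), of "[w ! i]"] wE i len by (simp add: take_Suc_conv_app_nth word_flat_single)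
    have rk': "rk (word_flat x (take (Suc i) w)) = rk x + Suc i"
      using step rk_insert_flat[OF fl wE] IH by simp
    have fl': "flat (word_flat x (take (Suc i) w))" using assms(1) sE flat_word_flat by simp
    have sub: "word_flat x (take (Suc i) w) \<subseteq> target T u y j" if "i \<le> j" "j < ?d" for j
      unfolding step using IH(5) tp(5)[OF that(2,1)] IH(4)[OF that] tp(1)[OF that(2)]
      by (intro cl_insert_least) auto
    have suby: "word_flat x (take (Suc i) w) \<subseteq> y" using sub[OF le_refl i] tp(3)[OF i] by blast
    have "w ! Suc i \<in> target T u y (Suc i) - word_flat x (take (Suc i) w)" if "Suc i < ?d"
    proof -
      have "target T u y (Suc i) - word_flat x (take (Suc i) w) \<noteq> {}"
        using tp(1,4)[OF that] rk_eq[OF fl' tp(1)[OF that]] sub[OF _ that] rk' by auto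
      then show ?thesis
        using g[OF that] Min_in[of "target T u y (Suc i) - word_flat x (take (Suc i) w)"] flat_fin tp(1)[OF that] by simp
    qed
    then show ?case using sE rk' suby sub i by auto
  qed
  have E: "set w \<subseteq> E" using main[of ?d] len by simp
  have ind: "indep x w" using main[of ?d] len by (simp add: indep_def)
  show y: "word_flat x w = y"
    using main[of ?d] len rk_eq[of "word_flat x w" y] flat_word_flat[OF assms(1) E] assms(2) rk_mono[OF assms(1,2,3)] by simp
  have "w ! i = Min (word_flat x (take (Suc i) w) - word_flat x (take i w))" if "i < ?d" for i
  proof (rule sym, rule Min_eqI)
    have fl': "flat (word_flat x (take (Suc i) w))" using assms(1) main[of "Suc i"] that flat_word_flat by simp
    show "finite (word_flat x (take (Suc i) w) - word_flat x (take i w))" using flat_fin[OF fl'] by simp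
    have "w ! i \<in> set (take (Suc i) w)" using that len by (simp add: take_Suc_conv_app_nth)
    then show "w ! i \<in> word_flat x (take (Suc i) w) - word_flat x (take i w)"
      using set_sub_word_flat[OF assms(1), of "take (Suc i) w"] main[of "Suc i"] main[of i] that by auto
    fix f assume "f \<in> word_flat x (take (Suc i) w) - word_flat x (take i w)"
    then have "f \<in> target T u y i - word_flat x (take i w)" using main[of "Suc i"] that by auto
    then show "w ! i \<le> f" using g[OF that] flat_fin[OF tp(1)[OF that]] by simp
  qed
  then show "good x w" using ind len by (simp add: good_def)
  show "Des w \<subseteq> T"
  proof (rule subsetI, rule ccontr)
    fix i assume i: "i \<in> Des w" "i \<notin> T"
    then have i': "0 < i" "i < ?d" "w ! i < w ! (i - 1)" using len by (auto simp: Des_def)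
    have eq: "i - 1 < t \<longleftrightarrow> i < t" if "t \<in> T" for t using i(2) that i'(1) by (cases "t = i") auto
    have "(\<exists>t\<in>T. i - 1 < t) = (\<exists>t\<in>T. i < t)" "(\<lambda>t. t \<in> T \<and> i - 1 < t) = (\<lambda>t. t \<in> T \<and> i < t)"
      using eq by auto
    then have tg: "target T u y (i - 1) = target T u y i" by (simp add: target_def)
    have "w ! i \<in> target T u y i - word_flat x (take i w)" using main[of i] i' by simp
    moreover have "word_flat x (take (i - 1) w) \<subseteq> word_flat x (take i w)"
      using main[of i] i' assms(1) set_take_subset_set_take[of "i - 1" i w] by (intro word_flat_mono) auto
    ultimately have "w ! i \<in> target T u y (i - 1) - word_flat x (take (i - 1) w)" using tg by auto
    then have "w ! (i - 1) \<le> w ! i" using g[of "i - 1"] flat_fin[OF tp(1)[of "i - 1"]] i' by simp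
    then show False using i' by simp
  qed
  show "chain_of x T w = u"
  proof
    fix t
    show "chain_of x T w t = u t"
    proof (cases "t \<in> T")
      case True
      then have t: "0 < t" "t < ?d" using assms(4) by auto
      have tg: "target T u y (t - 1) = u t"
      proof (cases rule: target_cases[of T "t - 1" u y])
        case (1 s)
        have "s \<le> t" using 1(4)[OF True] t by simp
        then have "s = t" using 1 by simp
        then show ?thesis using 1 by simp
      next
        case 2
        then show ?thesis using True t by fastforce
      qed
      have "word_flat x (take t w) \<subseteq> u t" using main[of t] t tg by simp
      then have "word_flat x (take t w) = u t"
        using main[of t] t assms(1,5) True by (intro rk_eq) (auto simp: flag_chains_def flat_word_flat)
      then show ?thesis using True by (simp add: chain_of_def)
    next
      case False
      then show ?thesis using assms(5) by (auto simp: chain_of_def flag_chains_def PiE_def extensional_def)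
    qed
  qed
qed

lemma greedy_exists: "\<exists>w. greedy x y T u w"
proof -
  have "\<exists>w. length w = k \<and> (\<forall>i<length w. w ! i = Min (target T u y i - word_flat x (take i w)))" for k
  proof (induction k)
    case (Suc k)
    then obtain w where w: "length w = k" "\<forall>i<length w. w ! i = Min (target T u y i - word_flat x (take i w))" by blast
    then show ?case
      by (intro exI[of _ "w @ [Min (target T u y k - word_flat x w)]"]) (auto simp: nth_append less_Suc_eq)
  qed simp
  then show ?thesis unfolding greedy_def by blast
qed

lemma target_chain_of:
  assumes "flat x" "indep x w" "word_flat x w = y" "T \<subseteq> {1..<length w}" "i < length w"
  obtains t where "i < t" "t \<le> length w" "target T (chain_of x T w) y i = word_flat x (take t w)"
    "\<And>s. i < s \<Longrightarrow> s < t \<Longrightarrow> s \<notin> T"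
proof (cases rule: target_cases[of T i "chain_of x T w" y])
  case (1 t)
  then show ?thesis using assms(4) by (intro that[of t]) (auto simp: chain_of_def leD)
next
  case 2
  then show ?thesis using assms by (intro that[of "length w"]) (auto simp: leD)
qed

text \<open>Converse of \<open>greedy_imp\<close>. An atom of the target enters the chain at some
  step \<open>j \<ge> i\<close>; the label of that step is at most this atom, and in the absence of
  descents before the target the letters increase from \<open>i\<close> to \<open>j\<close>.\<close>

lemma good_imp_greedy:
  assumes "flat x" "good x w" "word_flat x w = y" "T \<subseteq> {1..<length w}" "Des w \<subseteq> T"
  shows "greedy x y T (chain_of x T w) w"
proof -
  have ind: "indep x w" using assms by (simp add: good_def)
  have E: "set (take i w) \<subseteq> E" for i using ind by (rule indep_take_E)
  have mono: "word_flat x (take i w) \<subseteq> word_flat x (take j w)" if "i \<le> j" for i j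
    using assms(1) E set_take_subset_set_take[OF that, of w] by (intro word_flat_mono) auto
  have "w ! i = Min (target T (chain_of x T w) y i - word_flat x (take i w))" if i: "i < length w" for i
  proof -
    obtain t where t: "i < t" "t \<le> length w" "target T (chain_of x T w) y i = word_flat x (take t w)"
      "\<And>s. i < s \<Longrightarrow> s < t \<Longrightarrow> s \<notin> T"
      using target_chain_of[OF assms(1) ind assms(3,4) i] by metis
    have inc: "w ! i \<le> w ! j" if "i \<le> j" "j < t" for j
      using that
    proof (induction j rule: dec_induct)
      case (step j)
      then have "Suc j \<notin> Des w" using t(4)[of "Suc j"] assms(5) by auto
      then have "w ! j \<le> w ! Suc j" using step t(2) by (simp add: Des_def)
      then show ?case using step by simp
    qed simp
    have wi: "w ! i \<in> word_flat x (take t w) - word_flat x (take i w)"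
    proof -
      have "w ! i \<in> set (take t w)" using t i by (auto simp: in_set_conv_nth intro!: exI[of _ i])
      then show ?thesis using set_sub_word_flat[OF assms(1) E] indep_nth[OF assms(1) ind i] by blast
    qed
    have "w ! i \<le> f" if f: "f \<in> word_flat x (take t w) - word_flat x (take i w)" for f
    proof -
      define j where "j = (LEAST j. f \<in> word_flat x (take (Suc j) w))"
      have "f \<in> word_flat x (take (Suc (t - 1)) w)" using f t by simp
      then have j1: "f \<in> word_flat x (take (Suc j) w)" "j \<le> t - 1"
        unfolding j_def by (rule LeastI, rule Least_le)
      have "f \<notin> word_flat x (take j w)"
      proof (cases j)
        case 0
        then show ?thesis using f mono[of 0 i] by auto
      next
        case (Suc k)
        then show ?thesis using not_less_Least[of k "\<lambda>j. f \<in> word_flat x (take (Suc j) w)"] unfolding j_def by simp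
      qed
      moreover have "i \<le> j" using j1 f mono[of "Suc j" i] by (metis Diff_iff Suc_leI not_le subsetD)
      moreover have "j < length w" using j1 t by simp
      ultimately have "w ! j \<le> f"
        using j1 assms(2) flat_fin[OF flat_word_flat[OF assms(1) E]] by (simp add: good_def)
      then show ?thesis using inc[of j] \<open>i \<le> j\<close> j1 t(1) by linarith
    qed
    then show ?thesis unfolding t(3) using wi flat_fin[OF flat_word_flat[OF assms(1) E]]
      by (intro Min_eqI[symmetric]) auto
  qed
  then show ?thesis using indep_length[OF ind assms(3)] by (simp add: greedy_def)
qed

text \<open>At the first difference the greedy letter is the minimum of a set that also contains the
  letter of \<open>w'\<close>. Here \<open>w'\<close> is any independent word, good or not; column
  permutations of good words are of this kind.\<close>

lemma greedy_lex_least: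
  assumes "flat x" "indep x w'" "word_flat x w' = y" "T \<subseteq> {1..<length w'}" "greedy x y T (chain_of x T w') w"
  shows "w \<le> w'"
proof (cases "w = w'")
  case False
  have len: "length w = length w'" using assms(5) indep_length[OF assms(2,3)] by (simp add: greedy_def)
  obtain i where i: "i < length w'" "take i w = take i w'" "w ! i \<noteq> w' ! i"
    using list_first_diff[OF len False] by blast
  obtain t where t: "i < t" "t \<le> length w'" "target T (chain_of x T w') y i = word_flat x (take t w')"
    using target_chain_of[OF assms(1,2,3,4) i(1)] by metis
  have "w' ! i \<in> set (take t w')" using t i by (auto simp: in_set_conv_nth intro!: exI[of _ i])
  then have "w' ! i \<in> word_flat x (take t w') - word_flat x (take i w)"
    using set_sub_word_flat[OF assms(1) indep_take_E[OF assms(2)]] indep_nth[OF assms(1,2) i(1)] i by auto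
  moreover have "finite (word_flat x (take t w'))"
    using flat_fin flat_word_flat assms(1) indep_take_E[OF assms(2)] by blast
  moreover have "w ! i = Min (word_flat x (take t w') - word_flat x (take i w))"
    using assms(5) i len t by (simp add: greedy_def)
  ultimately have "w ! i < w' ! i" using i(3) by (metis Min_le finite_Diff le_neq_implies_less)
  then show ?thesis using list_less_first_diff[OF len i(1,2)] by simp
qed simp

lemma greedy_unique:
  assumes "greedy x y T u w" "greedy x y T u w'" shows "w = w'"
proof (rule ccontr)
  assume ne: "w \<noteq> w'"
  have len: "length w = length w'" using assms by (simp add: greedy_def)
  obtain i where "i < length w'" "take i w = take i w'" "w ! i \<noteq> w' ! i"
    using list_first_diff[OF len ne] by blast
  then show False using assms len by (simp add: greedy_def)
qed

text \<open>The EL property: the number of \<open>T\<close>-chains is the number of label words with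
  descents in \<open>T\<close>, so Moebius inversion turns \<open>h\<close> into a count of good
  words.\<close>

lemma bij_chain_of:
  assumes "flat x" "flat y" "x \<subseteq> y" "T \<subseteq> {1..<rk y - rk x}"
  shows "bij_betw (chain_of x T) {w. good x w \<and> word_flat x w = y \<and> Des w \<subseteq> T} (flag_chains x y T)"
  unfolding bij_betw_def
proof
  have g: "greedy x y T (chain_of x T w) w" if "good x w" "word_flat x w = y" "Des w \<subseteq> T" for w
    using good_imp_greedy[OF assms(1) that(1,2) _ that(3)] indep_length[of x w y] that assms(4) by (simp add: good_def)
  show "inj_on (chain_of x T) {w. good x w \<and> word_flat x w = y \<and> Des w \<subseteq> T}"
    by (rule inj_onI) (metis (mono_tags, lifting) g greedy_unique mem_Collect_eq)
  show "chain_of x T ` {w. good x w \<and> word_flat x w = y \<and> Des w \<subseteq> T} = flag_chains x y T"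
  proof (intro equalityI subsetI)
    fix u assume "u \<in> chain_of x T ` {w. good x w \<and> word_flat x w = y \<and> Des w \<subseteq> T}"
    then obtain w where "u = chain_of x T w" "good x w" "word_flat x w = y" by blast
    then show "u \<in> flag_chains x y T"
      using chain_of_in_flag_chains[OF assms(1), of w y T] indep_length[of x w y] assms(4) by (simp add: good_def)
  next
    fix u assume u: "u \<in> flag_chains x y T"
    obtain w where w: "greedy x y T u w" using greedy_exists by blast
    show "u \<in> chain_of x T ` {w. good x w \<and> word_flat x w = y \<and> Des w \<subseteq> T}"
      using greedy_imp[OF assms u w] by (intro image_eqI[of _ _ w]) auto
  qed
qed

text \<open>If the word of a \<open>T\<close>-chain has an ascent at \<open>t \<in> T\<close>, it is lexicographically smallest among the chains that
  differ from it only at \<open>t\<close>, so the balance condition expresses its coefficient through larger words.\<close>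

lemma cycle_zero:
  fixes c :: "(nat \<Rightarrow> nat set) \<Rightarrow> real"
  assumes x: "flat x" "flat y" "x \<subseteq> y" and T: "T \<subseteq> {1..<rk y - rk x}"
    and bal: "\<And>t u. t \<in> T \<Longrightarrow> u \<in> flag_chains x y T \<Longrightarrow> (\<Sum>u' | u' \<in> flag_chains x y T \<and> (\<forall>s\<in>T - {t}. u' s = u s). c u') = 0"
    and zero: "\<And>w. w \<in> good_words x y T \<Longrightarrow> c (chain_of x T w) = 0"
    and u: "u \<in> flag_chains x y T"
  shows "c u = 0"
proof (rule ccontr)
  assume "c u \<noteq> 0"
  let ?G = "{w. good x w \<and> word_flat x w = y \<and> Des w \<subseteq> T}"
  note bij = bij_chain_of[OF x T]
  have img: "chain_of x T ` ?G = flag_chains x y T" using bij by (simp add: bij_betw_def)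
  define N where "N = {w. good x w \<and> word_flat x w = y \<and> Des w \<subseteq> T \<and> c (chain_of x T w) \<noteq> 0}"
  have "finite N" unfolding N_def by (rule finite_good_to)
  moreover have "N \<noteq> {}"
  proof -
    obtain w where "w \<in> ?G" "u = chain_of x T w" using u img by blast
    then have "w \<in> N" using \<open>c u \<noteq> 0\<close> by (simp add: N_def)
    then show ?thesis by blast
  qed
  ultimately have w: "Max N \<in> N" and mx: "\<And>w'. w' \<in> N \<Longrightarrow> w' \<le> Max N" by auto
  define w where "w = Max N"
  have wN: "good x w" "word_flat x w = y" "Des w \<subseteq> T" "c (chain_of x T w) \<noteq> 0" using w by (auto simp: N_def w_def)
  then have "Des w \<noteq> T" using zero by (auto simp: good_words_def)
  then obtain t where t: "t \<in> T" "t \<notin> Des w" using wN(3) by blast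
  have ind: "indep x w" using wN by (simp add: good_def)
  have len: "length w = rk y - rk x" using indep_length ind wN by blast
  have chw: "chain_of x T w \<in> flag_chains x y T" using chain_of_in_flag_chains[OF x(1) ind wN(2)] T len by simp
  have finT: "finite T" using T finite_subset by blast
  let ?U = "{u'. u' \<in> flag_chains x y T \<and> (\<forall>s\<in>T - {t}. u' s = chain_of x T w s)}"
  have "c u' = 0" if "u' \<in> ?U - {chain_of x T w}" for u'
  proof (rule ccontr)
    assume c': "c u' \<noteq> 0"
    have "u' \<in> chain_of x T ` ?G" unfolding img using that by simp
    then obtain w' where w': "w' \<in> ?G" "u' = chain_of x T w'" by (auto elim!: imageE)
    have "w' \<le> w" using mx c' w' by (simp add: N_def w_def)
    have ind': "indep x w'" and len': "length w' = rk y - rk x"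
      using w'(1) indep_length[of x w' y] by (simp_all add: good_def)
    have same: "chain_of x (T - {t}) w' = chain_of x (T - {t}) w"
    proof
      fix s show "chain_of x (T - {t}) w' s = chain_of x (T - {t}) w s"
        using that w'(2) by (cases "s \<in> T - {t}") (auto simp: chain_of_def)
    qed
    have "greedy x y (T - {t}) (chain_of x (T - {t}) w) w"
      using wN t T len by (intro good_imp_greedy x) auto
    then have "w \<le> w'"
      using w'(1) ind' len' T by (intro greedy_lex_least[OF x(1), of w' y "T - {t}"]) (auto simp: same)
    then have "w = w'" using \<open>w' \<le> w\<close> by simp
    then show False using that w'(2) by simp
  qed
  moreover have "finite ?U" "chain_of x T w \<in> ?U" using chw finite_flag_chains[OF finT] by auto
  ultimately have "(\<Sum>u'\<in>?U. c u') = c (chain_of x T w)"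
    by (subst sum.remove[of ?U "chain_of x T w"]) simp_all
  then show False using bal[OF t(1) chw] wN(4) by simp
qed

text \<open>The column antisymmetrizer of the ribbon tableau \<open>v\<close>, viewed as a chain of the order complex.\<close>

definition ribbon_cycle :: "nat set \<Rightarrow> nat set \<Rightarrow> nat list \<Rightarrow> (nat \<Rightarrow> nat set) \<Rightarrow> real" where
  "ribbon_cycle x T v u = (\<Sum>\<pi>\<in>column_group (length v) T. of_int (sign \<pi>) * of_bool (chain_of x T (permute_list \<pi> v) = u))"

section \<open>Boundary condition and triangularity of ribbon cycles\<close>

lemma indep_permute: "indep x v \<Longrightarrow> \<pi> \<in> column_group (length v) T \<Longrightarrow> indep x (permute_list \<pi> v)"
  using column_permutes[of \<pi> "length v" T] by (elim indep_perm) auto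

lemma word_flat_permute: "\<pi> \<in> column_group (length v) T \<Longrightarrow> word_flat x (permute_list \<pi> v) = word_flat x v"
  using column_permutes[of \<pi> "length v" T] by (intro word_flat_cong) auto

lemma chain_of_permute_flag_chains:
  assumes "flat x" "indep x v" "T \<subseteq> {1..<length v}" "\<pi> \<in> column_group (length v) T"
  shows "chain_of x T (permute_list \<pi> v) \<in> flag_chains x (word_flat x v) T"
  using assms by (intro chain_of_in_flag_chains) (auto simp: word_flat_permute indep_permute)

lemma sum_cycle:
  assumes "finite U"
  shows "(\<Sum>u\<in>U. ribbon_cycle x T v u) =
    (\<Sum>\<pi>\<in>column_group (length v) T. of_int (sign \<pi>) * of_bool (chain_of x T (permute_list \<pi> v) \<in> U))"
proof -
  have "(\<Sum>u\<in>U. of_bool (k = u)) = (of_bool (k \<in> U) :: real)" for k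
    using assms by (simp add: of_bool_def sum.delta)
  then show ?thesis unfolding ribbon_cycle_def
    by (subst sum.swap) (simp add: sum_distrib_left[symmetric])
qed

lemma cycle_outside:
  assumes "flat x" "indep x v" "T \<subseteq> {1..<length v}" "u \<notin> flag_chains x (word_flat x v) T"
  shows "ribbon_cycle x T v u = 0"
  unfolding ribbon_cycle_def using chain_of_permute_flag_chains[OF assms(1-3)] assms(4) by (intro sum.neutral) auto

text \<open>Swapping two neighbouring letters changes the letter set of at most one prefix, hence at
  most one member of the chain.\<close>

lemma set_take_transpose:
  fixes v :: "nat list"
  assumes "0 < t" "t < length v" "s \<noteq> t" "\<pi> permutes {..<length v}"
  shows "set (take s (permute_list (\<pi> \<circ> transpose (t - 1) t) v)) = set (take s (permute_list \<pi> v))"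
proof -
  let ?\<tau> = "transpose (t - 1) t"
  have \<tau>: "?\<tau> permutes {..<length v}" using assms by (intro permutes_swap_id) auto
  have st: "set (take s l) = (\<lambda>i. l ! i) ` {..<min s (length l)}" for l :: "nat list"
    by (auto simp: set_conv_nth image_iff) (metis nth_take)+
  have img: "?\<tau> ` {..<min s (length v)} = {..<min s (length v)}"
  proof -
    have "?\<tau> ` {..<min s (length v)} \<subseteq> {..<min s (length v)}"
      using assms by (auto simp: transpose_def min_def split: if_splits)
    then show ?thesis by (intro endo_inj_surj) auto
  qed
  have "set (take s (permute_list (\<pi> \<circ> ?\<tau>) v)) = (\<lambda>i. permute_list \<pi> v ! ?\<tau> i) ` {..<min s (length v)}"
    unfolding permute_list_compose[OF \<tau>] st using \<tau>
    by (intro image_cong) (auto simp: permute_list_nth)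
  also have "\<dots> = (\<lambda>i. permute_list \<pi> v ! i) ` ?\<tau> ` {..<min s (length v)}" by (simp add: image_image)
  also have "\<dots> = set (take s (permute_list \<pi> v))" by (simp only: img st length_permute_list)
  finally show ?thesis .
qed

text \<open>The permutations \<open>\<pi>\<close> and
  \<open>\<pi> \<circ> transpose (t - 1) t\<close> have opposite signs and give chains that agree
  outside \<open>t\<close>. This is the vanishing of the boundary at rank \<open>t\<close>.\<close>

lemma cycle_balanced:
  assumes "flat x" "indep x v" "T \<subseteq> {1..<length v}" "t \<in> T"
  shows "(\<Sum>u' | u' \<in> flag_chains x (word_flat x v) T \<and> (\<forall>s\<in>T - {t}. u' s = u s). ribbon_cycle x T v u') = 0"
proof -
  have finT: "finite T" using assms(3) finite_subset by blast
  have t: "0 < t" "t < length v" using assms by auto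
  show ?thesis
  proof (subst sum_cycle)
    show "finite {u'. u' \<in> flag_chains x (word_flat x v) T \<and> (\<forall>s\<in>T - {t}. u' s = u s)}"
      using finite_flag_chains[OF finT] by simp
    show "(\<Sum>\<pi>\<in>column_group (length v) T. of_int (sign \<pi>) * of_bool (chain_of x T (permute_list \<pi> v) \<in>
      {u'. u' \<in> flag_chains x (word_flat x v) T \<and> (\<forall>s\<in>T - {t}. u' s = u s)})) = (0::real)"
    proof (rule column_sign_cancel[OF assms(4,3)])
      fix \<pi> assume \<pi>: "\<pi> \<in> column_group (length v) T"
      have "chain_of x T (permute_list (\<pi> \<circ> transpose (t - 1) t) v) s = chain_of x T (permute_list \<pi> v) s" if "s \<noteq> t" for s
        using word_flat_cong[OF set_take_transpose[OF t that column_permutes[OF \<pi>]]] by (simp add: chain_of_def)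
      then show "of_bool (chain_of x T (permute_list (\<pi> \<circ> transpose (t - 1) t) v) \<in>
            {u'. u' \<in> flag_chains x (word_flat x v) T \<and> (\<forall>s\<in>T - {t}. u' s = u s)}) =
          (of_bool (chain_of x T (permute_list \<pi> v) \<in>
            {u'. u' \<in> flag_chains x (word_flat x v) T \<and> (\<forall>s\<in>T - {t}. u' s = u s)}) :: real)"
        using chain_of_permute_flag_chains[OF assms(1-3) \<pi>] chain_of_permute_flag_chains[OF assms(1-3) column_transpose[OF \<pi> assms(4,3)]]
        by simp
    qed
  qed
qed

text \<open>Greedy minimality puts \<open>v\<close> at or below the permuted word, and the decrease
  along columns puts the permuted word at or below \<open>v'\<close>. So the matrix of cycles
  against the chains of good words is unitriangular in the lexicographic order.\<close>

lemma cycle_triangular: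
  assumes "flat x" "T \<subseteq> {1..<rk y - rk x}" "v \<in> good_words x y T" "v' \<in> good_words x y T" "\<pi> \<in> column_group (length v') T"
    "chain_of x T (permute_list \<pi> v') = chain_of x T v"
  shows "v < v' \<or> v = v' \<and> \<pi> = id"
proof -
  have v: "good x v" "word_flat x v = y" "Des v = T" and v': "good x v'" "word_flat x v' = y" "Des v' = T"
    using assms by (auto simp: good_words_def)
  have len: "length v = rk y - rk x" "length v' = rk y - rk x"
    using v v' by (auto simp: good_def intro: indep_length)
  have "greedy x y T (chain_of x T (permute_list \<pi> v')) v"
    unfolding assms(6) using v assms len by (intro good_imp_greedy) auto
  then have le: "v \<le> permute_list \<pi> v'"
    using assms len v' by (intro greedy_lex_least[of x "permute_list \<pi> v'" y T])
      (auto simp: word_flat_permute good_def intro: indep_permute)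
  show ?thesis
  proof (cases "\<pi> = id")
    case True
    then have "v \<le> v'" using le by simp
    then show ?thesis using True by (auto simp: le_less)
  next
    case False
    then have "permute_list \<pi> v' < v'" by (rule permute_column_less[OF v'(3) assms(5)])
    with le have "v < v'" by (rule le_less_trans)
    then show ?thesis ..
  qed
qed

text \<open>Evaluation at the chain of the largest word with nonzero coefficient leaves only the
  identity permutation of that word.\<close>

lemma cycle_independent:
  fixes \<alpha> :: "nat list \<Rightarrow> real"
  assumes "flat x" "T \<subseteq> {1..<rk y - rk x}"
    and z: "\<And>u. (\<Sum>v\<in>good_words x y T. \<alpha> v * ribbon_cycle x T v u) = 0" and v: "v \<in> good_words x y T"
  shows "\<alpha> v = 0"
proof (rule ccontr)
  assume "\<alpha> v \<noteq> 0"
  define N where "N = {v \<in> good_words x y T. \<alpha> v \<noteq> 0}"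
  have "finite N" "N \<noteq> {}" using v \<open>\<alpha> v \<noteq> 0\<close> by (auto simp: N_def)
  then have mN: "Max N \<in> N" and mx: "\<And>v'. v' \<in> N \<Longrightarrow> v' \<le> Max N" by auto
  define m where "m = Max N"
  have m: "m \<in> good_words x y T" "\<alpha> m \<noteq> 0" using mN by (auto simp: N_def m_def)
  have neut: "\<alpha> v' * ribbon_cycle x T v' (chain_of x T m) = 0" if "v' \<in> good_words x y T - {m}" for v'
  proof (cases "\<alpha> v' = 0")
    case False
    then have "v' \<le> m" using mx that by (auto simp: N_def m_def)
    then have "chain_of x T (permute_list \<pi> v') \<noteq> chain_of x T m" if "\<pi> \<in> column_group (length v') T" for \<pi>
      using cycle_triangular[OF assms(1,2) m(1) _ that] \<open>v' \<in> good_words x y T - {m}\<close> by auto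
    then show ?thesis unfolding ribbon_cycle_def by (simp add: sum.neutral)
  qed simp
  have "(\<Sum>v\<in>good_words x y T - {m}. \<alpha> v * ribbon_cycle x T v (chain_of x T m)) = 0"
    by (rule sum.neutral) (rule ballI, rule neut)
  then have "(\<Sum>v\<in>good_words x y T. \<alpha> v * ribbon_cycle x T v (chain_of x T m)) = \<alpha> m * ribbon_cycle x T m (chain_of x T m)"
    using sum.remove[OF finite_good_words m(1), of "\<lambda>v. \<alpha> v * ribbon_cycle x T v (chain_of x T m)"] by simp
  moreover have "ribbon_cycle x T m (chain_of x T m) = 1"
  proof -
    have ne: "chain_of x T (permute_list \<pi> m) \<noteq> chain_of x T m" if "\<pi> \<in> column_group (length m) T - {id}" for \<pi>
      using cycle_triangular[OF assms(1,2) m(1) m(1), of \<pi>] that by auto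
    have "(\<Sum>\<pi>\<in>column_group (length m) T - {id}. of_int (sign \<pi>) *
        of_bool (chain_of x T (permute_list \<pi> m) = chain_of x T m)) = (0::real)"
      by (rule sum.neutral) (simp add: ne)
    then show ?thesis unfolding ribbon_cycle_def
      using sum.remove[OF finite_column id_column[of "length m" T], of "\<lambda>\<pi>. of_int (sign \<pi>) *
        (of_bool (chain_of x T (permute_list \<pi> m) = chain_of x T m) :: real)"] by (simp add: sign_id)
  qed
  ultimately show False using z[of "chain_of x T m"] m by simp
qed


section \<open>Complements of an atom\<close>

definition upper_covers :: "nat set \<Rightarrow> nat set \<Rightarrow> nat set set" where
  "upper_covers x y = {u. flat u \<and> x \<subseteq> u \<and> u \<subseteq> y \<and> rk u = rk x + 1}"

lemma finite_upper_covers [simp]: "finite (upper_covers x y)"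
  by (rule finite_subset[OF _ finite_flats]) (auto simp: upper_covers_def)

lemma upper_coversD: "u \<in> upper_covers x y \<Longrightarrow> flat u" "u \<in> upper_covers x y \<Longrightarrow> x \<subseteq> u" "u \<in> upper_covers x y \<Longrightarrow> u \<subseteq> y"
  "u \<in> upper_covers x y \<Longrightarrow> rk u = rk x + 1"
  by (auto simp: upper_covers_def)

lemma cover_mono: "y \<subseteq> y' \<Longrightarrow> upper_covers x y \<subseteq> upper_covers x y'" by (auto simp: upper_covers_def)

lemma cover_insert:
  assumes "flat x" "flat y" "x \<subseteq> y" "e \<in> y" "e \<notin> x"
  shows "cl (insert e x) \<in> upper_covers x y"
proof -
  have "e \<in> E" using assms flat_E by blast
  then show ?thesis unfolding upper_covers_def mem_Collect_eq
    using assms flat_insert sub_cl_insert cl_insert_least rk_insert_flat by metis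
qed

lemma cover_eq:
  assumes "flat x" "u \<in> upper_covers x y" "e \<in> u" "e \<notin> x" shows "cl (insert e x) = u"
  using cl_insert_eq_cover[of x u e] assms upper_coversD by blast

lemma cover_obtain:
  assumes "flat x" "u \<in> upper_covers x y" obtains e where "e \<in> u" "e \<notin> x" "e \<in> E" "u = cl (insert e x)"
proof -
  have "u \<noteq> x" using upper_coversD(4)[OF assms(2)] by auto
  then obtain e where "e \<in> u" "e \<notin> x" using upper_coversD(2)[OF assms(2)] by blast
  then show ?thesis using that cover_eq[OF assms, of e] upper_coversD(1)[OF assms(2)] flat_E by blast
qed

lemma cover_subD: "flat x \<Longrightarrow> u \<in> upper_covers x y \<Longrightarrow> v \<in> upper_covers x y' \<Longrightarrow> u \<subseteq> v \<Longrightarrow> u = v"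
  using rk_eq[of u v] upper_coversD(1,4) by metis

lemma cover_self: "flat x \<Longrightarrow> u \<in> upper_covers x y \<Longrightarrow> upper_covers x u = {u}"
  using cover_subD[of x _ u u] by (auto simp: upper_covers_def)

lemma cover_refl: "flat x \<Longrightarrow> upper_covers x x = {}"
  using rk_mono[of _ x] by (fastforce simp: upper_covers_def)

lemma cl_cover_un:
  assumes "flat x" "flat w" "x \<subseteq> w" "e \<in> E"
  shows "cl (cl (insert e x) \<union> w) = cl (insert e w)"
proof -
  have "cl (cl (insert e x) \<union> w) = cl (insert e x \<union> w)"
    using cl_un_cl[of "insert e x" w] assms(4) flat_E[OF assms(1)] flat_E[OF assms(2)] by simp
  also have "insert e x \<union> w = insert e w" using assms(3) by blast
  finally show ?thesis .
qed

lemma cover_notin: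
  assumes "flat x" "flat w" "x \<subseteq> w" "t \<in> upper_covers x W" "t \<notin> upper_covers x w"
  obtains e where "e \<in> t" "e \<notin> w" "e \<in> E" "t = cl (insert e x)" "cl (t \<union> w) = cl (insert e w)"
proof -
  have "\<not> t \<subseteq> w" using assms by (auto simp: upper_covers_def)
  then obtain e where e: "e \<in> t" "e \<notin> w" by blast
  have eE: "e \<in> E" using e upper_coversD(1)[OF assms(4)] flat_E by blast
  have t: "t = cl (insert e x)" using cover_eq[OF assms(1,4) e(1)] e assms by blast
  have "cl (t \<union> w) = cl (insert e w)" unfolding t by (rule cl_cover_un[OF assms(1-3) eE])
  then show ?thesis using that e eE t by blast
qed

text \<open>Each atom over \<open>x\<close> that is not below \<open>w\<close> lies below exactly
  one cover of \<open>w\<close>. With constant \<open>f\<close> this counts atoms by the lines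
  through a given atom.\<close>

lemma cover_partition:
  fixes f :: "nat set \<Rightarrow> 'b::comm_monoid_add"
  assumes x: "flat x" "flat w" "flat W" "x \<subseteq> w" "w \<subseteq> W"
  shows "(\<Sum>t\<in>upper_covers x W - upper_covers x w. f t) = (\<Sum>v\<in>upper_covers w W. \<Sum>t\<in>upper_covers x v - upper_covers x w. f t)"
proof -
  have un: "upper_covers x W - upper_covers x w = (\<Union>v\<in>upper_covers w W. upper_covers x v - upper_covers x w)"
  proof (intro equalityI subsetI)
    fix t assume t: "t \<in> upper_covers x W - upper_covers x w"
    obtain e where e: "e \<in> t" "e \<notin> w" "e \<in> E" "t = cl (insert e x)" "cl (t \<union> w) = cl (insert e w)"
      using cover_notin[OF x(1,2,4), of t W] t by blast
    have "e \<in> W" using e t upper_coversD(3) by blast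
    then have v: "cl (insert e w) \<in> upper_covers w W" using cover_insert x e by blast
    have "t \<subseteq> cl (insert e w)" using e(4) cl_mono[of "insert e x" "insert e w"] x e(3) flat_E by auto
    then have "t \<in> upper_covers x (cl (insert e w))" using t by (simp add: upper_covers_def)
    then show "t \<in> (\<Union>v\<in>upper_covers w W. upper_covers x v - upper_covers x w)" using v t by blast
  next
    fix t assume "t \<in> (\<Union>v\<in>upper_covers w W. upper_covers x v - upper_covers x w)"
    then show "t \<in> upper_covers x W - upper_covers x w" using cover_mono upper_coversD(3) by blast
  qed
  have dis: "(upper_covers x v - upper_covers x w) \<inter> (upper_covers x v' - upper_covers x w) = {}" if v: "v \<in> upper_covers w W" "v' \<in> upper_covers w W" "v \<noteq> v'" for v v'
  proof (rule ccontr)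
    assume "(upper_covers x v - upper_covers x w) \<inter> (upper_covers x v' - upper_covers x w) \<noteq> {}"
    then obtain t where t: "t \<in> upper_covers x v" "t \<in> upper_covers x v'" "t \<notin> upper_covers x w" by blast
    obtain e where e: "e \<in> t" "e \<notin> w" using cover_notin[OF x(1,2,4) t(1,3)] by blast
    then show False using cover_eq[OF x(2) v(1), of e] cover_eq[OF x(2) v(2), of e] v(3) t upper_coversD(3) by blast
  qed
  show ?thesis unfolding un by (rule sum.UNION_disjoint) (use dis in auto)
qed

section \<open>Weights on atoms and their sums over the complements of an atom\<close>

definition atom_sum :: "nat set \<Rightarrow> (nat set \<Rightarrow> real) \<Rightarrow> nat set \<Rightarrow> real" where
  "atom_sum x f z = (\<Sum>t\<in>upper_covers x z. f t)"

text \<open>For an atom spanned by \<open>a\<close> in [x, y], the lattice complements are exactly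
  the flats of corank one that avoid \<open>a\<close>.\<close>

definition complements :: "nat set \<Rightarrow> nat set \<Rightarrow> nat \<Rightarrow> nat set set" where
  "complements x y a = {z. flat z \<and> x \<subseteq> z \<and> z \<subseteq> y \<and> a \<notin> z \<and> rk z + 1 = rk y}"

lemma finite_complements [simp]: "finite (complements x y a)"
  by (rule finite_subset[OF _ finite_flats]) (auto simp: complements_def)

definition balanced :: "nat set \<Rightarrow> nat set \<Rightarrow> nat \<Rightarrow> (nat set \<Rightarrow> real) \<Rightarrow> bool" where
  "balanced x y a f \<longleftrightarrow> f (cl (insert a x)) = 0 \<and> (\<forall>l\<in>upper_covers (cl (insert a x)) y. atom_sum x f l = 0)"

lemma atom_sum_diff:
  assumes "flat x" "flat w" "flat W" "x \<subseteq> w" "w \<subseteq> W"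
  shows "atom_sum x f W - atom_sum x f w = (\<Sum>v\<in>upper_covers w W. atom_sum x f v - atom_sum x f w)"
proof -
  have d: "(\<Sum>t\<in>upper_covers x v - upper_covers x w. f t) = atom_sum x f v - atom_sum x f w" if "w \<subseteq> v" for v
    unfolding atom_sum_def using cover_mono[OF that, of x] by (simp add: sum_diff)
  show ?thesis using cover_partition[OF assms, of f] d[OF assms(5)] d upper_coversD(2) by simp
qed

lemma atom_sum_self: "flat x \<Longrightarrow> u \<in> upper_covers x y \<Longrightarrow> atom_sum x f u = f u"
  by (simp add: atom_sum_def cover_self)

text \<open>The lines through \<open>a\<close> inside \<open>W\<close> partition its other atoms,
  and \<open>f\<close> sums to 0 on each line.\<close>

lemma balanced_zero:
  assumes "flat x" "flat y" "balanced x y a f" "flat W" "x \<subseteq> W" "W \<subseteq> y" "a \<in> W" "a \<notin> x"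
  shows "atom_sum x f W = 0"
proof -
  have a: "cl (insert a x) \<in> upper_covers x W" by (rule cover_insert) (use assms in auto)
  have "atom_sum x f W - atom_sum x f (cl (insert a x)) =
      (\<Sum>v\<in>upper_covers (cl (insert a x)) W. atom_sum x f v - atom_sum x f (cl (insert a x)))"
    using a assms by (intro atom_sum_diff) (auto dest: upper_coversD)
  also have "\<dots> = 0"
    using assms(3) cover_mono[OF assms(6)] atom_sum_self[OF assms(1) a, of f]
    by (intro sum.neutral) (auto simp: balanced_def)
  finally show ?thesis using atom_sum_self[OF assms(1) a, of f] assms(3) by (simp add: balanced_def)
qed

text \<open>Induction on the rank by contracting an atom \<open>t\<close> other than
  \<open>a\<close>: the increments of \<open>atom_sum\<close> over the lines through
  \<open>t\<close> again satisfy the hypotheses, so they vanish on lines that avoid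
  \<open>a\<close>, and two atoms joined by such a line have equal values. In rank at least 3, all
  atoms other than \<open>a\<close> on a line through \<open>a\<close> thus share the value of one
  atom off the line, and these equal values sum to 0.\<close>

lemma coline_constant_zero:
  assumes "flat x" "flat y" "x \<subseteq> y" "a \<in> y" "a \<notin> x" "balanced x y a f"
    and "\<And>z w. z \<in> complements x y a \<Longrightarrow> flat w \<Longrightarrow> x \<subseteq> w \<Longrightarrow> w \<subseteq> z \<Longrightarrow> rk w + 1 = rk z \<Longrightarrow> atom_sum x f z = atom_sum x f w"
    and "u \<in> upper_covers x y"
  shows "f u = 0"
  using assms
proof (induction "rk y - rk x" arbitrary: x f u rule: less_induct)
  case less
  note x = less.prems(1) and y = less.prems(2) and xy = less.prems(3) and ay = less.prems(4)
    and ax = less.prems(5) and bal = less.prems(6) and con = less.prems(7)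
  let ?a = "cl (insert a x)"
  have aE: "a \<in> E" using ay y flat_E by blast
  have a': "?a \<in> upper_covers x y" by (rule cover_insert) (use x y xy ay ax in auto)
  have fa: "f ?a = 0" using bal by (simp add: balanced_def)
  have inA: "t = ?a" if "t \<in> upper_covers x y'" "a \<in> t" for t y' using cover_eq[OF x that ax] by simp
  have rky: "rk x + 1 \<le> rk y" using rk_mono[OF upper_coversD(1)[OF a'] y upper_coversD(3)[OF a']] upper_coversD(4)[OF a'] by simp
  show ?case
  proof (cases "a \<in> u")
    case True
    then show ?thesis using inA less.prems(8) fa by simp
  next
    case au: False
    consider "rk y = rk x + 1" | "rk y = rk x + 2" | "rk x + 3 \<le> rk y" using rky by linarith
    then show ?thesis
    proof cases
      case 1
      have "u = y" using rk_eq[of u y] y less.prems(8) 1 upper_coversD by metis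
      then show ?thesis using au ay by simp
    next
      case 2
      \<comment> \<open>In rank 2 the complement is the atom itself and its coline is
        \<open>x\<close>, whose atom sum is empty.\<close>
      have "u \<in> complements x y a" using less.prems(8) au 2 by (auto simp: complements_def upper_covers_def)
      then have "atom_sum x f u = atom_sum x f x" by (rule con) (use x less.prems(8) in \<open>auto simp: upper_covers_def\<close>)
      then show ?thesis using atom_sum_self[OF x less.prems(8), of f] by (simp add: atom_sum_def cover_refl[OF x])
    next
      case 3
      have up: "atom_sum x f v = f t" if t: "t \<in> upper_covers x y" "a \<notin> t" and v: "v \<in> upper_covers t y" "a \<notin> v" for t v
      proof -
        note tD = upper_coversD[OF t(1)]
        define g where "g v = (if a \<in> v then 0 else atom_sum x f v - f t)" for v
        have Ft: "atom_sum x f t = f t" by (rule atom_sum_self[OF x t(1)])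
        have gF: "atom_sum t g z = atom_sum x f z - f t" if z: "flat z" "t \<subseteq> z" "a \<notin> z" for z
        proof -
          have "atom_sum x f z - f t = (\<Sum>v\<in>upper_covers t z. atom_sum x f v - f t)"
            using atom_sum_diff[OF x tD(1) z(1) tD(2) z(2), of f] Ft by simp
          also have "\<dots> = atom_sum t g z" unfolding atom_sum_def[of t]
            using z(3) upper_coversD(3) by (intro sum.cong) (auto simp: g_def)
          finally show ?thesis by simp
        qed
        have ta: "cl (insert a t) \<in> upper_covers t y" using cover_insert[OF tD(1) y tD(3) ay t(2)] .
        have "balanced t y a g" unfolding balanced_def
        proof (intro conjI ballI)
          show "g (cl (insert a t)) = 0" using in_cl_insert[OF tD(1) aE] by (simp add: g_def)
          fix Y assume Y: "Y \<in> upper_covers (cl (insert a t)) y"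
          note YD = upper_coversD[OF Y]
          have aY: "cl (insert a t) \<in> upper_covers t Y" "a \<in> Y"
            using YD ta in_cl_insert[OF tD(1) aE] by (auto simp: upper_covers_def)
          have xY: "x \<subseteq> Y" using aY tD(2) upper_coversD(2,3)[OF aY(1)] by blast
          have F0: "atom_sum x f Y = 0" "atom_sum x f (cl (insert a t)) = 0"
            using balanced_zero[OF x y bal YD(1) xY YD(3) aY(2) ax]
              balanced_zero[OF x y bal upper_coversD(1)[OF ta] _ upper_coversD(3)[OF ta] in_cl_insert[OF tD(1) aE] ax]
              upper_coversD(2)[OF ta] tD(2) by auto
          have tY: "t \<subseteq> Y" using upper_coversD(2,3)[OF aY(1)] by blast
          \<comment> \<open>The total increment over \<open>Y\<close> is \<open>- f t\<close>
            because \<open>Y\<close> contains \<open>a\<close>; the cover through \<open>a\<close>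
            accounts for exactly this amount, so the others cancel.\<close>
          have "- f t = (\<Sum>v\<in>upper_covers t Y. atom_sum x f v - f t)"
            using atom_sum_diff[OF x tD(1) YD(1) tD(2) tY, of f] Ft F0 by simp
          also have "\<dots> = - f t + (\<Sum>v\<in>upper_covers t Y - {cl (insert a t)}. atom_sum x f v - f t)"
            using sum.remove[OF finite_upper_covers aY(1), of "\<lambda>v. atom_sum x f v - f t"] F0 by simp
          also have "(\<Sum>v\<in>upper_covers t Y - {cl (insert a t)}. atom_sum x f v - f t) = (\<Sum>v\<in>upper_covers t Y - {cl (insert a t)}. g v)"
            using cover_eq[OF tD(1) _ _ t(2), of _ Y] by (intro sum.cong) (auto simp: g_def)
          also have "\<dots> = atom_sum t g Y"
            using sum.remove[OF finite_upper_covers aY(1), of g] \<open>g (cl (insert a t)) = 0\<close> by (simp add: atom_sum_def)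
          finally show "atom_sum t g Y = 0" by simp
        qed
        moreover have "atom_sum t g z = atom_sum t g w"
          if "z \<in> complements t y a" "flat w" "t \<subseteq> w" "w \<subseteq> z" "rk w + 1 = rk z" for z w
        proof -
          have "a \<notin> w" "flat z" "t \<subseteq> z" "a \<notin> z" "z \<in> complements x y a" "x \<subseteq> w"
            using that tD by (auto simp: complements_def)
          then show ?thesis using con[of z w] that gF by simp
        qed
        moreover have "rk y - rk t < rk y - rk x" using tD(4) 3 by linarith
        ultimately have "g v = 0" using less.hyps[of t g v] tD y ay t v by blast
        then show ?thesis using v by (simp add: g_def)
      qed
      \<comment> \<open>Both values equal the atom sum of the line spanned by \<open>t\<close> and
        \<open>s\<close>, which avoids \<open>a\<close>.\<close>
      have eq: "f t = f s" if t: "t \<in> upper_covers x y" "a \<notin> t" and s: "s \<in> upper_covers x y" "\<not> s \<subseteq> cl (insert a t)" for t s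
      proof -
        note tD = upper_coversD[OF t(1)] and sD = upper_coversD[OF s(1)]
        have "\<not> s \<subseteq> t" using s sub_cl_insert[OF tD(1) aE] by blast
        obtain e where e: "e \<in> s" "e \<notin> cl (insert a t)" using s by blast
        have eE: "e \<in> E" and ey: "e \<in> y" using e sD flat_E by auto
        have et: "e \<notin> t" using e sub_cl_insert[OF tD(1) aE] by blast
        let ?v = "cl (insert e t)"
        have v: "?v \<in> upper_covers t y" using cover_insert[OF tD(1) y tD(3) ey et] .
        have av: "a \<notin> ?v" using exchange[OF tD(1) eE, of a] t(2) e(2) in_cl_insert[OF tD(1) eE] by auto
        have ex: "e \<notin> x" using et tD(2) by blast
        have s': "s = cl (insert e x)" using cover_eq[OF x s(1) e(1) ex] by simp
        have sv: "s \<subseteq> ?v" unfolding s' using tD(2) eE flat_E[OF tD(1)] by (intro cl_mono) auto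
        have as: "a \<notin> s" using sv av by blast
        have ts: "\<not> t \<subseteq> s" using cover_subD[OF x t(1) s(1)] et e by auto
        have rv: "rk ?v = rk s + 1" using upper_coversD(4)[OF v] tD(4) sD(4) by simp
        have "?v \<in> upper_covers s y" using upper_coversD(1,3)[OF v] sv rv by (simp add: upper_covers_def)
        then show ?thesis using up[OF t v av] up[OF s(1) as _ av] by simp
      qed
      have a'D: "flat ?a" "?a \<subseteq> y" "rk ?a = rk x + 1" "x \<subseteq> ?a" using upper_coversD[OF a'] by auto
      have ain: "a \<in> ?a" by (rule in_cl_insert[OF x aE])
      let ?l = "cl (insert a u)"
      have uD: "flat u" "x \<subseteq> u" "u \<subseteq> y" "rk u = rk x + 1" using upper_coversD[OF less.prems(8)] by auto
      have lD: "flat ?l" "?l \<subseteq> y" "rk ?l = rk x + 2" "u \<subseteq> ?l" "a \<in> ?l"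
        using uD au aE ay y flat_insert rk_insert_flat sub_cl_insert in_cl_insert cl_insert_least by auto
      have al: "?a \<subseteq> ?l" using uD flat_E[OF uD(1)] aE by (intro cl_mono) auto
      have lA: "?l \<in> upper_covers ?a y" using lD al a'D by (simp add: upper_covers_def)
      have "?l \<noteq> y" using lD 3 by auto
      \<comment> \<open>Rank at least 3 leaves a point off the line spanned by \<open>a\<close> and
        \<open>u\<close>.\<close>
      then obtain e where e: "e \<in> y" "e \<notin> ?l" using lD by blast
      have eE: "e \<in> E" using e y flat_E by blast
      have ex: "e \<notin> x" using e uD lD by blast
      define s where "s = cl (insert e x)"
      have s: "s \<in> upper_covers x y" unfolding s_def by (rule cover_insert[OF x y xy e(1) ex])
      have es: "e \<in> s" unfolding s_def by (rule in_cl_insert[OF x eE])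
      have fs: "f t = f s" if t: "t \<in> upper_covers x ?l - {?a}" for t
      proof -
        have tA: "t \<in> upper_covers x y" using t cover_mono[OF lD(2)] by blast
        have at: "a \<notin> t" using inA t by blast
        have "cl (insert a t) \<subseteq> ?l" using t lD by (intro cl_insert_least) (auto dest: upper_coversD)
        then show ?thesis using eq[OF tA at s] es e by blast
      qed
      have "atom_sum x f ?l = 0" using bal lA by (simp add: balanced_def)
      moreover have aAl: "?a \<in> upper_covers x ?l" using a'D al by (simp add: upper_covers_def)
      ultimately have "0 = (\<Sum>t\<in>upper_covers x ?l - {?a}. f t)"
        using sum.remove[OF finite_upper_covers aAl, of f] fa by (simp add: atom_sum_def)
      also have "\<dots> = of_nat (card (upper_covers x ?l - {?a})) * f s" using fs by simp
      finally have "of_nat (card (upper_covers x ?l - {?a})) * f s = 0" by simp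
      moreover have uin: "u \<in> upper_covers x ?l - {?a}" using uD lD au ain by (auto simp: upper_covers_def)
      then have "card (upper_covers x ?l - {?a}) \<noteq> 0" using finite_upper_covers[of x ?l] by (metis card_eq_0_iff empty_iff finite_Diff)
      ultimately have "f s = 0" by simp
      then show ?thesis using fs[OF uin] by simp
    qed
  qed
qed

text \<open>Neighbours have bases that differ in one element, which moves along a line through \<open>a\<close>; joining with \<open>a\<close>
  therefore identifies the Boolean cycles of the two bases.\<close>

definition edge :: "nat set \<Rightarrow> nat set \<Rightarrow> nat \<Rightarrow> nat set \<Rightarrow> nat set \<Rightarrow> bool" where
  "edge x y a z z' \<longleftrightarrow> (\<exists>w e e'. flat w \<and> x \<subseteq> w \<and> w \<subseteq> y \<and> a \<notin> w \<and> rk w + 2 = rk y \<and>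
     e \<in> y \<and> e' \<in> y \<and> e \<notin> cl (insert a w) \<and> e' \<notin> cl (insert a w) \<and>
     cl (insert e (cl (insert a x))) = cl (insert e' (cl (insert a x))) \<and>
     z = cl (insert e w) \<and> z' = cl (insert e' w))"

lemma edge_sym: "edge x y a z z' \<Longrightarrow> edge x y a z' z"
  unfolding edge_def by metis

lemma cl_insert_avoids:
  assumes "flat w" "flat y" "w \<subseteq> y" "a \<notin> w" "a \<in> E" "e \<in> y" "e \<notin> cl (insert a w)"
  shows "a \<notin> cl (insert e w)" "flat (cl (insert e w))" "cl (insert e w) \<subseteq> y"
    "rk (cl (insert e w)) = rk w + 1" "e \<notin> w"
proof -
  have eE: "e \<in> E" using assms flat_E by blast
  show ew: "e \<notin> w" using assms sub_cl_insert[of w a] by blast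
  show "a \<notin> cl (insert e w)" using exchange[OF assms(1) eE, of a] assms in_cl_insert[OF assms(1) eE] by auto
  show "flat (cl (insert e w))" "rk (cl (insert e w)) = rk w + 1" "cl (insert e w) \<subseteq> y"
    using flat_insert[OF assms(1) eE] rk_insert_flat[OF assms(1) eE ew] cl_insert_least[OF assms(3,6,2)] by auto
qed

lemma edge_complements:
  assumes "flat y" "a \<in> y" "edge x y a z z'" shows "z \<in> complements x y a"
proof -
  obtain w e where w: "flat w" "x \<subseteq> w" "w \<subseteq> y" "a \<notin> w" "rk w + 2 = rk y"
    "e \<in> y" "e \<notin> cl (insert a w)" "z = cl (insert e w)"
    using assms(3) by (auto simp: edge_def)
  have "a \<in> E" "e \<in> E" using assms(1,2) w flat_E by auto
  then show ?thesis using cl_insert_avoids[of w y a e] w assms(1) sub_cl_insert[OF w(1), of e] by (auto simp: complements_def)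
qed

text \<open>For edge-constant \<open>F\<close>, summing \<open>f t * (F (t \<union> w) - F w)\<close> over the atoms \<open>t\<close> line by line gives \<open>0\<close>, while
  summing it over the complements above \<open>w\<close> gives \<open>\<Sum>(F z - F w)\<^sup>2\<close>.\<close>

lemma edge_constant_coline:
  assumes x: "flat x" "flat y" "x \<subseteq> y" "a \<in> y" "a \<notin> x" and bal: "balanced x y a f"
    and con: "\<And>z z'. edge x y a z z' \<Longrightarrow> atom_sum x f z = atom_sum x f z'"
    and z: "z \<in> complements x y a" and w: "flat w" "x \<subseteq> w" "w \<subseteq> z" "rk w + 1 = rk z"
  shows "atom_sum x f z = atom_sum x f w"
proof -
  let ?a = "cl (insert a x)" and ?b = "cl (insert a w)"
  have aE: "a \<in> E" using x flat_E by blast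
  have zD: "flat z" "z \<subseteq> y" "a \<notin> z" "rk z + 1 = rk y" using z by (auto simp: complements_def)
  have wy: "w \<subseteq> y" "a \<notin> w" "rk w + 2 = rk y" using w zD by auto
  have a': "?a \<in> upper_covers x y" using cover_insert[OF x] .
  have a'D: "flat ?a" "x \<subseteq> ?a" "?a \<subseteq> y" using upper_coversD[OF a'] by auto
  have b: "flat ?b" "w \<subseteq> ?b" "a \<in> ?b" using w(1) aE flat_insert sub_cl_insert in_cl_insert by auto
  have ab: "?a \<subseteq> ?b" using w(2) aE flat_E[OF w(1)] by (intro cl_mono) auto
  \<comment> \<open>Atoms below the join of \<open>a\<close> and \<open>w\<close> are cut off:
    joined with \<open>w\<close> they give no complement of \<open>a\<close>.\<close>
  define g where "g t = (if t \<subseteq> ?b then 0 else f t * (atom_sum x f (cl (t \<union> w)) - atom_sum x f w))" for t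
  \<comment> \<open>Atoms of one line through \<open>a\<close> give neighbouring complements over
    \<open>w\<close>, so the second factor is constant on the line while the weights sum to
    0.\<close>
  have inner0: "(\<Sum>t\<in>upper_covers x l - {?a}. g t) = 0" if l: "l \<in> upper_covers ?a y" for l
  proof (cases "l \<subseteq> ?b \<or> upper_covers x l - {?a} = {}")
    case True
    then show ?thesis by (intro sum.neutral) (auto simp: g_def upper_covers_def)
  next
    case False
    have pt: "\<exists>e. e \<in> t \<and> e \<in> y \<and> e \<notin> ?b \<and> cl (insert e ?a) = l \<and> cl (t \<union> w) = cl (insert e w) \<and> \<not> t \<subseteq> ?b"
      if t: "t \<in> upper_covers x l - {?a}" for t
    proof -
      have ta: "t \<notin> upper_covers x ?a" using cover_self[OF x(1) a'] t by auto
      have tl: "t \<in> upper_covers x l" using t by simp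
      obtain e where e: "e \<in> t" "e \<notin> ?a" "e \<in> E" "t = cl (insert e x)"
        using cover_notin[OF x(1) a'D(1,2) tl ta] by blast
      have el: "e \<in> l" using e(1) upper_coversD(3)[OF tl] by blast
      have l': "cl (insert e ?a) = l" using cover_eq[OF a'D(1) l el e(2)] .
      have eb: "e \<notin> ?b" using False l' cl_insert_least[OF ab _ b(1), of e] by auto
      have "cl (t \<union> w) = cl (insert e w)" unfolding e(4) using cl_cover_un x(1) w(1,2) e(3) by blast
      moreover have "\<not> t \<subseteq> ?b" "e \<in> y" using e(1) eb el upper_coversD(3)[OF l] by auto
      ultimately show ?thesis using e(1) l' eb by blast
    qed
    obtain t0 where t0: "t0 \<in> upper_covers x l - {?a}" using False by blast
    have same: "atom_sum x f (cl (t \<union> w)) = atom_sum x f (cl (t0 \<union> w))" if t: "t \<in> upper_covers x l - {?a}" for t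
    proof -
      obtain e where e: "e \<in> y" "e \<notin> ?b" "cl (insert e ?a) = l" "cl (t \<union> w) = cl (insert e w)" using pt[OF t] by blast
      obtain e0 where e0: "e0 \<in> y" "e0 \<notin> ?b" "cl (insert e0 ?a) = l" "cl (t0 \<union> w) = cl (insert e0 w)" using pt[OF t0] by blast
      have "edge x y a (cl (insert e w)) (cl (insert e0 w))"
        unfolding edge_def
        by (intro exI[of _ w] exI[of _ e] exI[of _ e0] conjI) (use e e0 w wy in simp_all)
      then show ?thesis using con e e0 by simp
    qed
    have "(\<Sum>t\<in>upper_covers x l - {?a}. g t) = (\<Sum>t\<in>upper_covers x l - {?a}. f t * (atom_sum x f (cl (t0 \<union> w)) - atom_sum x f w))"
    proof (rule sum.cong[OF refl])
      fix t assume t: "t \<in> upper_covers x l - {?a}"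
      show "g t = f t * (atom_sum x f (cl (t0 \<union> w)) - atom_sum x f w)"
        using pt[OF t] same[OF t] by (auto simp: g_def)
    qed
    also have "\<dots> = (\<Sum>t\<in>upper_covers x l - {?a}. f t) * (atom_sum x f (cl (t0 \<union> w)) - atom_sum x f w)"
      by (simp add: sum_distrib_right)
    also have "(\<Sum>t\<in>upper_covers x l - {?a}. f t) = 0"
    proof -
      have "?a \<in> upper_covers x l" using a' upper_coversD(2)[OF l] by (simp add: upper_covers_def)
      then show ?thesis
        using sum.remove[OF finite_upper_covers, of ?a x l f] bal l by (simp add: balanced_def atom_sum_def)
    qed
    finally show ?thesis by simp
  qed
  have "(\<Sum>t\<in>upper_covers x y. g t) = (\<Sum>t\<in>upper_covers x y - upper_covers x ?a. g t)"
    by (rule sum.mono_neutral_right) (use cover_self[OF x(1) a'] ab in \<open>auto simp: g_def\<close>)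
  also have "\<dots> = 0"
    using cover_partition[OF x(1) a'D(1) x(2) a'D(2,3), of g] inner0 cover_self[OF x(1) a'] by simp
  finally have g0: "(\<Sum>t\<in>upper_covers x y. g t) = 0" .
  have "(\<Sum>t\<in>upper_covers x y. g t) = (\<Sum>t\<in>upper_covers x y - upper_covers x w. g t)"
    by (rule sum.mono_neutral_right) (use b(2) in \<open>auto simp: g_def dest: upper_coversD(3)\<close>)
  also have "\<dots> = (\<Sum>v\<in>upper_covers w y. \<Sum>t\<in>upper_covers x v - upper_covers x w. g t)"
    by (rule cover_partition[OF x(1) w(1) x(2) w(2) wy(1)])
  finally have g1: "(\<Sum>v\<in>upper_covers w y. \<Sum>t\<in>upper_covers x v - upper_covers x w. g t) = 0" using g0 by simp
  \<comment> \<open>For a cover of \<open>w\<close> avoiding \<open>a\<close> the increment occurs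
    twice, as the common factor and as the sum of the new weights.\<close>
  have sq: "(\<Sum>t\<in>upper_covers x v - upper_covers x w. g t) = (if a \<in> v then 0 else (atom_sum x f v - atom_sum x f w)\<^sup>2)" if v: "v \<in> upper_covers w y" for v
  proof (cases "a \<in> v")
    case True
    then have "v = ?b" using cover_eq[OF w(1) v] wy by simp
    then show ?thesis using True by (auto simp: g_def upper_covers_def intro!: sum.neutral)
  next
    case False
    have "g t = f t * (atom_sum x f v - atom_sum x f w)" if t: "t \<in> upper_covers x v - upper_covers x w" for t
    proof -
      have t': "t \<in> upper_covers x v" "t \<notin> upper_covers x w" using t by auto
      obtain e where e: "e \<in> t" "e \<notin> w" "cl (t \<union> w) = cl (insert e w)"
        using cover_notin[OF x(1) w(1,2) t'] by metis
      have "cl (insert e w) = v" using cover_eq[OF w(1) v _ e(2)] e(1) upper_coversD(3)[OF t'(1)] by blast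
      moreover have "\<not> t \<subseteq> ?b"
      proof
        assume "t \<subseteq> ?b"
        then have "e \<in> ?b" using e by blast
        then have "cl (insert e w) = ?b" using exchange[OF w(1) aE _ e(2)] by blast
        then show False using False \<open>cl (insert e w) = v\<close> b(3) by simp
      qed
      ultimately show ?thesis using e(3) by (simp add: g_def)
    qed
    then have "(\<Sum>t\<in>upper_covers x v - upper_covers x w. g t) = (\<Sum>t\<in>upper_covers x v - upper_covers x w. f t) * (atom_sum x f v - atom_sum x f w)"
      by (simp add: sum_distrib_right)
    also have "(\<Sum>t\<in>upper_covers x v - upper_covers x w. f t) = atom_sum x f v - atom_sum x f w"
      unfolding atom_sum_def using cover_mono[OF upper_coversD(2)[OF v], of x] by (simp add: sum_diff)
    finally show ?thesis using False by (simp add: power2_eq_square)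
  qed
  have "(\<Sum>v\<in>upper_covers w y. if a \<in> v then 0 else (atom_sum x f v - atom_sum x f w)\<^sup>2) = 0" using g1 sq by simp
  moreover have zA: "z \<in> upper_covers w y" using zD w by (simp add: upper_covers_def)
  ultimately have "(if a \<in> z then 0 else (atom_sum x f z - atom_sum x f w)\<^sup>2) = 0"
    by (subst (asm) sum_nonneg_eq_0_iff) auto
  then show ?thesis using zD by simp
qed

text \<open>Unknowns: one weight for each atom other than \<open>a\<close> and one constant for each
  component. Equations: one for each line through \<open>a\<close> and, for each complement, that
  its weight sum is the constant of its component. For a solution,
  \<open>edge_constant_coline\<close> and \<open>coline_constant_zero\<close> make the weights
  vanish, and then the constants vanish because every component contains a complement.\<close>

lemma component_bound:
  assumes x: "flat x" "flat y" "x \<subseteq> y" "a \<in> y" "a \<notin> x"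
    and \<rho>: "\<And>z z'. edge x y a z z' \<Longrightarrow> \<rho> z = \<rho> z'"
  shows "card (upper_covers x y) + card (\<rho> ` complements x y a) \<le> 1 + card (upper_covers (cl (insert a x)) y) + card (complements x y a)"
proof (rule ccontr)
  let ?a = "cl (insert a x)" and ?Z = "complements x y a"
  assume contr: "\<not> ?thesis"
  have a': "?a \<in> upper_covers x y" using cover_insert[OF x] .
  define I where "I = (upper_covers x y - {?a}) <+> (\<rho> ` ?Z)"
  define J where "J = upper_covers ?a y <+> ?Z"
  have fin: "finite I" "finite J" by (auto simp: I_def J_def)
  have "card J < card I"
    using contr a' by (simp add: I_def J_def card_Plus card_Diff_singleton)
  define A :: "(nat set + nat set) \<Rightarrow> (nat set + 'a) \<Rightarrow> real" where
    "A j i = (case j of Inl l \<Rightarrow> (case i of Inl t \<Rightarrow> of_bool (t \<subseteq> l) | Inr q \<Rightarrow> 0)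
       | Inr z \<Rightarrow> (case i of Inl t \<Rightarrow> of_bool (t \<subseteq> z) | Inr q \<Rightarrow> - of_bool (q = \<rho> z)))" for j i
  obtain \<alpha> where \<alpha>: "\<exists>i\<in>I. \<alpha> i \<noteq> 0" "\<And>j. j \<in> J \<Longrightarrow> (\<Sum>i\<in>I. \<alpha> i * A j i) = 0"
    using underdetermined_system[OF fin(2,1) \<open>card J < card I\<close>, of A] by blast
  define f where "f t = (if t = ?a then 0 else \<alpha> (Inl t))" for t
  have FFsum: "(\<Sum>t\<in>upper_covers x y - {?a}. \<alpha> (Inl t) * of_bool (t \<subseteq> l)) = atom_sum x f l" if "l \<subseteq> y" for l
  proof -
    have "atom_sum x f l = (\<Sum>t\<in>upper_covers x l - {?a}. f t)"
      unfolding atom_sum_def by (rule sum.mono_neutral_right) (auto simp: f_def)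
    also have "\<dots> = (\<Sum>t\<in>upper_covers x l - {?a}. \<alpha> (Inl t) * of_bool (t \<subseteq> l))"
      by (rule sum.cong) (auto simp: f_def upper_covers_def)
    also have "\<dots> = (\<Sum>t\<in>upper_covers x y - {?a}. \<alpha> (Inl t) * of_bool (t \<subseteq> l))"
      by (rule sum.mono_neutral_left) (use that finite_upper_covers[of x y] in \<open>auto simp: upper_covers_def\<close>)
    finally show ?thesis by simp
  qed
  have l0: "atom_sum x f l = 0" if l: "l \<in> upper_covers ?a y" for l
  proof -
    have "Inl l \<in> J" using l by (auto simp: J_def)
    then show ?thesis using \<alpha>(2)[of "Inl l"] FFsum[of l] upper_coversD(3)[OF l] by (simp add: I_def sum.Plus A_def)
  qed
  have z0: "atom_sum x f z = \<alpha> (Inr (\<rho> z))" if z: "z \<in> ?Z" for z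
  proof -
    have "(\<Sum>q\<in>\<rho> ` ?Z. \<alpha> (Inr q) * - of_bool (q = \<rho> z)) = - \<alpha> (Inr (\<rho> z))"
    proof -
      have "(\<Sum>q\<in>\<rho> ` ?Z. \<alpha> (Inr q) * - of_bool (q = \<rho> z)) = (\<Sum>q\<in>\<rho> ` ?Z. if q = \<rho> z then - \<alpha> (Inr q) else 0)"
        by (rule sum.cong) auto
      then show ?thesis using z by simp
    qed
    moreover have "Inr z \<in> J" using z by (auto simp: J_def)
    moreover have "z \<subseteq> y" using z by (simp add: complements_def)
    moreover have "(\<Sum>i\<in>I. \<alpha> i * A (Inr z) i) = (\<Sum>t\<in>upper_covers x y - {?a}. \<alpha> (Inl t) * of_bool (t \<subseteq> z)) +
        (\<Sum>q\<in>\<rho> ` ?Z. \<alpha> (Inr q) * - of_bool (q = \<rho> z))"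
      unfolding I_def A_def by (subst sum.Plus) auto
    ultimately show ?thesis using \<alpha>(2)[of "Inr z"] FFsum[of z] by linarith
  qed
  have bal: "balanced x y a f" using l0 by (simp add: balanced_def f_def)
  have con: "atom_sum x f z = atom_sum x f z'" if "edge x y a z z'" for z z'
    using z0 edge_complements[OF x(2,4) that] edge_complements[OF x(2,4) edge_sym[OF that]] \<rho>[OF that] by simp
  have f0: "f u = 0" if "u \<in> upper_covers x y" for u
    using coline_constant_zero[OF x bal _ that] edge_constant_coline[OF x bal con] by blast
  have "\<alpha> i = 0" if "i \<in> I" for i
  proof (cases i)
    case (Inl t)
    then have "t \<in> upper_covers x y" "t \<noteq> ?a" using that by (auto simp: I_def)
    then show ?thesis using f0[of t] Inl by (simp add: f_def)
  next
    case (Inr q)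
    then have "q \<in> \<rho> ` ?Z" using that by (auto simp: I_def)
    then obtain z where "z \<in> ?Z" "q = \<rho> z" by blast
    moreover have "atom_sum x f z = 0" if "z \<in> ?Z" for z
      unfolding atom_sum_def by (rule sum.neutral) (use f0 that in \<open>auto simp: upper_covers_def complements_def\<close>)
    ultimately show ?thesis using z0 Inr by simp
  qed
  then show False using \<alpha>(1) by blast
qed

end

section \<open>Independent cycles\<close>

definition perm_words :: "nat set \<Rightarrow> nat set \<Rightarrow> nat list set" where
  "perm_words A T = {w. distinct w \<and> set w = A \<and> Des w = T}"

definition beta :: "nat \<Rightarrow> nat set \<Rightarrow> nat" where
  "beta d T = card (perm_words {..<d} T)"

lemma finite_perm_words [simp]: "finite A \<Longrightarrow> finite (perm_words A T)"
  by (rule finite_subset[OF _ finite_lists_length_eq[of A "card A"]])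
    (auto simp: perm_words_def distinct_card)

lemma perm_words_length: "w \<in> perm_words {..<d} T \<Longrightarrow> length w = d"
  using distinct_card by (fastforce simp: perm_words_def)

lemma free_matroid: "ranked_closure {..<r} (\<lambda>X. X) card"
  by unfold_locales (auto simp: card_insert_if finite_subset[OF _ finite_lessThan])

text \<open>In the Boolean lattice every label is forced, so \<open>cycle_independent\<close> yields
  \<open>beta r T\<close> independent cycles there; these are carried into other lattices along a
  basis.\<close>

lemma free_matroid_good_words: "ranked_closure.good_words {..<r} (\<lambda>X. X) card {} {..<r} T = perm_words {..<r} T"
proof -
  interpret B: ranked_closure "{..<r}" "\<lambda>X. X" card by (rule free_matroid)
  have "B.good {} w \<longleftrightarrow> distinct w \<and> set w \<subseteq> {..<r}" for w
  proof
    assume "B.good {} w"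
    then show "distinct w \<and> set w \<subseteq> {..<r}"
      by (simp add: B.good_def B.indep_def B.word_flat_def card_distinct)
  next
    assume w: "distinct w \<and> set w \<subseteq> {..<r}"
    have "set (take (Suc i) w) - set (take i w) = {w ! i}" if "i < length w" for i
    proof -
      have "w ! i \<notin> set (take i w)" using w that by (auto simp: in_set_conv_nth nth_eq_iff_index_eq)
      then show ?thesis using that by (auto simp: take_Suc_conv_app_nth)
    qed
    then show "B.good {} w"
      using w by (simp add: B.good_def B.indep_def B.word_flat_def distinct_card)
  qed
  then show ?thesis by (auto simp: B.good_words_def perm_words_def B.word_flat_def)
qed

context ranked_closure
begin

text \<open>\<open>v\<close> is completed to a rearrangement of \<open>b\<close>, and prefixes of
  independent words are independent.\<close>

lemma indep_subset:
  assumes "indep x b" "flat x" "distinct v" "set v \<subseteq> set b"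
  shows "indep x v"
proof -
  obtain c where c: "set c = set b - set v" "distinct c" using finite_distinct_list[of "set b - set v"] by auto
  have "length (v @ c) = card (set b)"
    using c assms distinct_card[of "v @ c"] by (metis Diff_disjoint Diff_partition distinct_append set_append)
  then have "length (v @ c) = length b" using distinct_card[OF indep_distinct[OF assms(2,1)]] by simp
  moreover have "set (v @ c) = set b" using c assms by auto
  ultimately have "indep x (v @ c)" by (intro indep_perm[OF assms(1)])
  then show ?thesis using indep_append[OF assms(2)] by blast
qed

text \<open>The span map reflects inclusion, so the spans of subsets of an independent word form a
  copy of the Boolean lattice.\<close>

lemma indep_cl_subset:
  assumes "indep x b" "flat x" "I \<subseteq> {..<length b}" "J \<subseteq> {..<length b}"
    "cl (x \<union> (!) b ` I) \<subseteq> cl (x \<union> (!) b ` J)"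
  shows "I \<subseteq> J"
proof (rule subsetI, rule ccontr)
  fix i assume i: "i \<in> I" "i \<notin> J"
  have "finite J" using assms(4) finite_subset by blast
  then obtain js where js: "set js = J" "distinct js" using finite_distinct_list by blast
  let ?v = "map ((!) b) js @ [b ! i]"
  have d: "distinct b" by (rule indep_distinct[OF assms(2,1)])
  have inj: "inj_on ((!) b) {..<length b}" using d by (auto simp: inj_on_def nth_eq_iff_index_eq)
  have il: "i < length b" using i assms(3) by auto
  have bi: "b ! i \<notin> (!) b ` J" using inj i il assms(4) by (auto simp: inj_on_def)
  have "distinct ?v"
    using js bi inj_on_subset[OF inj assms(4)] by (simp add: distinct_map)
  moreover have "set ?v \<subseteq> set b" using js assms(4) il by auto
  ultimately have "indep x ?v" using indep_subset[OF assms(1,2)] by blast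
  then have "indep x (map ((!) b) js)" "indep (word_flat x (map ((!) b) js)) [b ! i]"
    using indep_append[OF assms(2)] by blast+
  then have "b ! i \<notin> word_flat x (map ((!) b) js)"
    using indep_single[OF flat_word_flat[OF assms(2) indep_E]] by blast
  then have "b ! i \<notin> cl (x \<union> (!) b ` J)" using js by (simp add: word_flat_def)
  moreover have "(!) b ` I \<subseteq> E" using assms(3) indep_E[OF assms(1)] nth_mem by blast
  then have "x \<union> (!) b ` I \<subseteq> cl (x \<union> (!) b ` I)" using flat_E[OF assms(2)] by (intro cl_inc) simp
  then have "b ! i \<in> cl (x \<union> (!) b ` I)" using i by blast
  ultimately show False using assms(5) by blast
qed

text \<open>The span map of \<open>b\<close> is injective on chains of subsets and carries the
  Boolean ribbon cycles to those of the words \<open>map ((!) b) \<sigma>\<close>, so a linear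
  relation pulls back.\<close>

lemma boolean_independent:
  fixes \<gamma> :: "nat list \<Rightarrow> real"
  assumes x: "flat x" and b: "indep x b" "length b = r" and T: "T \<subseteq> {1..<r}"
    and z: "\<And>u. (\<Sum>\<sigma>\<in>perm_words {..<r} T. \<gamma> \<sigma> * ribbon_cycle x T (map ((!) b) \<sigma>) u) = 0"
    and \<sigma>: "\<sigma> \<in> perm_words {..<r} T"
  shows "\<gamma> \<sigma> = 0"
proof -
  interpret B: ranked_closure "{..<r}" "\<lambda>X. X" card by (rule free_matroid)
  have B0: "B.flat {}" by (simp add: B.flat_def)
  define \<phi> where "\<phi> u = (\<lambda>t\<in>T. cl (x \<union> (!) b ` u t))" for u
  have "(\<Sum>\<sigma>\<in>perm_words {..<r} T. \<gamma> \<sigma> * B.ribbon_cycle {} T \<sigma> u) = 0" for u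
  proof (cases "u \<in> B.flag_chains {} {..<r} T")
    case False
    have "B.ribbon_cycle {} T \<sigma> u = 0" if "\<sigma> \<in> perm_words {..<r} T" for \<sigma>
    proof -
      have "\<sigma> \<in> B.good_words {} {..<r} T" using that free_matroid_good_words by simp
      then show ?thesis
        using B.cycle_outside[OF B0, of \<sigma> T u] T False perm_words_length[OF that] by (simp add: B.good_words_def B.good_def)
    qed
    then show ?thesis by simp
  next
    case True
    have "B.ribbon_cycle {} T \<sigma> u = ribbon_cycle x T (map ((!) b) \<sigma>) (\<phi> u)" if s: "\<sigma> \<in> perm_words {..<r} T" for \<sigma>
      unfolding B.ribbon_cycle_def ribbon_cycle_def length_map
    proof (rule sum.cong[OF refl])
      fix \<pi> assume \<pi>: "\<pi> \<in> column_group (length \<sigma>) T"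
      have p: "\<pi> permutes {..<length \<sigma>}" using column_permutes[OF \<pi>] .
      have pl: "permute_list \<pi> (map ((!) b) \<sigma>) = map ((!) b) (permute_list \<pi> \<sigma>)"
        by (rule permute_list_map[OF p])
      let ?s = "permute_list \<pi> \<sigma>"
      have ss: "set ?s = {..<r}" using s p by (simp add: perm_words_def)
      have bch: "B.chain_of {} T ?s t = set (take t ?s)" if "t \<in> T" for t
        using that by (simp add: B.chain_of_def B.word_flat_def)
      have chain_of: "chain_of x T (map ((!) b) ?s) t = cl (x \<union> (!) b ` set (take t ?s))" if "t \<in> T" for t
        using that by (simp add: chain_of_def word_flat_def take_map)
      have "B.chain_of {} T ?s = u \<longleftrightarrow> chain_of x T (map ((!) b) ?s) = \<phi> u"
      proof
        assume "B.chain_of {} T ?s = u"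
        then have "u t = set (take t ?s)" if "t \<in> T" for t using bch[OF that] by auto
        then show "chain_of x T (map ((!) b) ?s) = \<phi> u"
          unfolding \<phi>_def chain_of_def by (intro restrict_ext) (simp add: word_flat_def take_map)
      next
        assume eq: "chain_of x T (map ((!) b) ?s) = \<phi> u"
        show "B.chain_of {} T ?s = u"
        proof
          fix t
          show "B.chain_of {} T ?s t = u t"
          proof (cases "t \<in> T")
            case t: True
            have e: "cl (x \<union> (!) b ` set (take t ?s)) = cl (x \<union> (!) b ` u t)"
              using chain_of[OF t] eq t by (simp add: \<phi>_def)
            have sub: "set (take t ?s) \<subseteq> {..<length b}" "u t \<subseteq> {..<length b}"
              using ss set_take_subset[of t ?s] b(2) True t by (auto simp: B.flag_chains_def PiE_def Pi_def)
            have "set (take t ?s) = u t"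
              using indep_cl_subset[OF b(1) x sub] indep_cl_subset[OF b(1) x sub(2,1)] e by blast
            then show ?thesis using bch[OF t] by simp
          next
            case False
            then show ?thesis using \<open>u \<in> B.flag_chains {} {..<r} T\<close>
              by (auto simp: B.chain_of_def B.flag_chains_def PiE_def extensional_def)
          qed
        qed
      qed
      then show "of_int (sign \<pi>) * of_bool (B.chain_of {} T ?s = u) =
        (of_int (sign \<pi>) * of_bool (chain_of x T (permute_list \<pi> (map ((!) b) \<sigma>)) = \<phi> u) :: real)"
        unfolding pl by simp
    qed
    then show ?thesis using z[of "\<phi> u"] by simp
  qed
  then show ?thesis
    using B.cycle_independent[OF B0, of T "{..<r}" \<gamma> \<sigma>] T \<sigma> free_matroid_good_words by simp
qed

lemma indep_map_perm:
  assumes "indep x b" "\<sigma> \<in> perm_words {..<length b} T"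
  shows "indep x (map ((!) b) \<sigma>)" "word_flat x (map ((!) b) \<sigma>) = word_flat x b" "length (map ((!) b) \<sigma>) = length b"
proof -
  have "set (map ((!) b) \<sigma>) = (!) b ` {..<length b}" using assms(2) by (simp add: perm_words_def)
  also have "\<dots> = set b" by (auto simp: set_conv_nth)
  finally have "set (map ((!) b) \<sigma>) = set b" .
  moreover show "length (map ((!) b) \<sigma>) = length b" using perm_words_length[OF assms(2)] by simp
  ultimately show "indep x (map ((!) b) \<sigma>)" "word_flat x (map ((!) b) \<sigma>) = word_flat x b"
    using indep_perm[OF assms(1)] word_flat_cong by blast+
qed

text \<open>Linear combinations inherit the boundary condition, so \<open>cycle_zero\<close>
  applies. The words \<open>q k\<close> are constrained only where the coefficient is nonzero, which
  lets one index set serve all complements.\<close>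

lemma lincomb_zero:
  fixes \<gamma> :: "'k \<Rightarrow> real"
  assumes x: "flat x" "flat z" "x \<subseteq> z" and T: "T \<subseteq> {1..<rk z - rk x}"
    and K: "\<And>k. k \<in> K \<Longrightarrow> \<gamma> k \<noteq> 0 \<Longrightarrow> indep x (q k) \<and> word_flat x (q k) = z"
    and zero: "\<And>w. w \<in> good_words x z T \<Longrightarrow> (\<Sum>k\<in>K. \<gamma> k * ribbon_cycle x T (q k) (chain_of x T w)) = 0"
  shows "(\<Sum>k\<in>K. \<gamma> k * ribbon_cycle x T (q k) u) = 0"
proof (cases "u \<in> flag_chains x z T")
  case True
  show ?thesis
  proof (rule cycle_zero[OF x T, where c = "\<lambda>u. \<Sum>k\<in>K. \<gamma> k * ribbon_cycle x T (q k) u"])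
    show "u \<in> flag_chains x z T" by (rule True)
    show "(\<Sum>k\<in>K. \<gamma> k * ribbon_cycle x T (q k) (chain_of x T w)) = 0" if "w \<in> good_words x z T" for w by (rule zero[OF that])
    fix t u assume t: "t \<in> T"
    let ?U = "{u'. u' \<in> flag_chains x z T \<and> (\<forall>s\<in>T - {t}. u' s = u s)}"
    have "(\<Sum>u'\<in>?U. \<Sum>k\<in>K. \<gamma> k * ribbon_cycle x T (q k) u') = (\<Sum>k\<in>K. \<gamma> k * (\<Sum>u'\<in>?U. ribbon_cycle x T (q k) u'))"
      by (subst sum.swap) (simp add: sum_distrib_left)
    also have "\<dots> = 0"
    proof (rule sum.neutral, rule ballI)
      fix k assume k: "k \<in> K"
      show "\<gamma> k * (\<Sum>u'\<in>?U. ribbon_cycle x T (q k) u') = 0"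
      proof (cases "\<gamma> k = 0")
        case False
        then have q: "indep x (q k)" "word_flat x (q k) = z" using K[OF k] by auto
        have "T \<subseteq> {1..<length (q k)}" using indep_length[OF q] T by simp
        then show ?thesis using cycle_balanced[OF x(1) q(1) _ t, of u] q(2) by simp
      qed simp
    qed
    finally show "(\<Sum>u'\<in>?U. \<Sum>k\<in>K. \<gamma> k * ribbon_cycle x T (q k) u') = 0" .
  qed
next
  case False
  show ?thesis
  proof (rule sum.neutral, rule ballI)
    fix k assume k: "k \<in> K"
    show "\<gamma> k * ribbon_cycle x T (q k) u = 0"
    proof (cases "\<gamma> k = 0")
      case F: False
      then have q: "indep x (q k)" "word_flat x (q k) = z" using K[OF k] by auto
      have "T \<subseteq> {1..<length (q k)}" using indep_length[OF q] T by simp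
      then show ?thesis using cycle_outside[OF x(1) q(1)] q(2) False by simp
    qed simp
  qed
qed

section \<open>Transport of cycles along the join with an atom\<close>

definition push :: "nat \<Rightarrow> nat set \<Rightarrow> (nat \<Rightarrow> nat set) \<Rightarrow> nat \<Rightarrow> nat set" where
  "push a T u = (\<lambda>t\<in>T. cl (insert a (u t)))"

lemma push_chain_of:
  assumes "flat x" "a \<in> E" "set v \<subseteq> E"
  shows "push a T (chain_of x T v) = chain_of (cl (insert a x)) T v"
proof -
  have "cl (insert a (word_flat x (take t v))) = word_flat (cl (insert a x)) (take t v)" for t
  proof -
    have E: "set (take t v) \<subseteq> E" using assms(3) set_take_subset[of t v] by blast
    have "cl (insert a (word_flat x (take t v))) = cl (insert a (x \<union> set (take t v)))"
      unfolding word_flat_def using E assms flat_E[OF assms(1)] by (intro cl_insert_cl) auto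
    also have "\<dots> = cl (cl (insert a x) \<union> set (take t v))"
      using cl_un_cl[of "insert a x" "set (take t v)"] E assms flat_E[OF assms(1)] by simp
    finally show ?thesis by (simp add: word_flat_def)
  qed
  then show ?thesis unfolding push_def chain_of_def by (intro restrict_ext) simp
qed

text \<open>Summing over the fibres of the join with \<open>a\<close> is the induced map on chains
  of the order complex; the word stays and only the bottom moves. \<open>U\<close> may be larger
  than the support, so that several complements can share it.\<close>

lemma push_cycle:
  assumes "flat x" "a \<in> E" "indep x v" "T \<subseteq> {1..<length v}" "finite U" "flag_chains x (word_flat x v) T \<subseteq> U"
  shows "(\<Sum>u | u \<in> U \<and> push a T u = u'. ribbon_cycle x T v u) = ribbon_cycle (cl (insert a x)) T v u'"
proof (subst sum_cycle)
  show "finite {u \<in> U. push a T u = u'}" using assms(5) by simp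
  show "(\<Sum>\<pi>\<in>column_group (length v) T. of_int (sign \<pi>) * of_bool (chain_of x T (permute_list \<pi> v) \<in> {u \<in> U. push a T u = u'}))
    = ribbon_cycle (cl (insert a x)) T v u'"
    unfolding ribbon_cycle_def
  proof (rule sum.cong[OF refl])
    fix \<pi> assume \<pi>: "\<pi> \<in> column_group (length v) T"
    have "set (permute_list \<pi> v) \<subseteq> E" using indep_E[OF indep_permute[OF assms(3) \<pi>]] .
    then show "of_int (sign \<pi>) * of_bool (chain_of x T (permute_list \<pi> v) \<in> {u \<in> U. push a T u = u'}) =
      of_int (sign \<pi>) * (of_bool (chain_of (cl (insert a x)) T (permute_list \<pi> v) = u') :: real)"
      using chain_of_permute_flag_chains[OF assms(1,3,4) \<pi>] assms(6) push_chain_of[OF assms(1,2)] by auto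
  qed
qed

text \<open>Over the bottom \<open>c\<close> only the spans \<open>cl (insert e c)\<close> matter,
  so letters spanning the same atom there are interchangeable.\<close>

lemma cl_parallel:
  assumes "flat c" "set b \<subseteq> E" "set b' \<subseteq> E" "length b = length b'"
    "\<And>i. i < length b \<Longrightarrow> cl (insert (b ! i) c) = cl (insert (b' ! i) c)" "I \<subseteq> {..<length b}"
  shows "cl (c \<union> (!) b ` I) = cl (c \<union> (!) b' ` I)"
proof -
  have half: "cl (c \<union> (!) b ` I) \<subseteq> cl (c \<union> (!) b' ` I)"
    if A: "set b \<subseteq> E" "set b' \<subseteq> E" "length b = length b'"
      "\<And>i. i < length b \<Longrightarrow> cl (insert (b ! i) c) = cl (insert (b' ! i) c)" "I \<subseteq> {..<length b}" for b b'
  proof (rule cl_least)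
    have bE: "(!) b' ` I \<subseteq> E" using A by (auto simp: subset_iff)
    have cE: "c \<subseteq> E" using assms(1) flat_E by blast
    show "flat (cl (c \<union> (!) b' ` I))" by (rule flat_cl) (use bE cE in auto)
    have "b ! i \<in> cl (c \<union> (!) b' ` I)" if i: "i \<in> I" for i
    proof -
      have il: "i < length b" using A i by auto
      then have "b ! i \<in> E" using A by auto
      then have "b ! i \<in> cl (insert (b' ! i) c)" using in_cl_insert[OF assms(1)] A(4)[OF il] by metis
      moreover have "cl (insert (b' ! i) c) \<subseteq> cl (c \<union> (!) b' ` I)"
        using i bE cE by (intro cl_mono) auto
      ultimately show ?thesis by blast
    qed
    then show "c \<union> (!) b ` I \<subseteq> cl (c \<union> (!) b' ` I)"
      using cl_inc[of "c \<union> (!) b' ` I"] bE cE by auto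
  qed
  show ?thesis using half[of b b'] half[of b' b] assms by (metis subset_antisym)
qed

lemma cycle_parallel:
  assumes "flat c" "set b \<subseteq> E" "set b' \<subseteq> E" "length b = length b'"
    "\<And>i. i < length b \<Longrightarrow> cl (insert (b ! i) c) = cl (insert (b' ! i) c)" "set \<sigma> = {..<length b}"
  shows "ribbon_cycle c T (map ((!) b) \<sigma>) u = ribbon_cycle c T (map ((!) b') \<sigma>) u"
  unfolding ribbon_cycle_def length_map
proof (rule sum.cong[OF refl])
  fix \<pi> assume "\<pi> \<in> column_group (length \<sigma>) T"
  then have p: "\<pi> permutes {..<length \<sigma>}" by (rule column_permutes)
  have "set (take t (permute_list \<pi> \<sigma>)) \<subseteq> {..<length b}" for t
    using set_take_subset[of t "permute_list \<pi> \<sigma>"] p assms(6) by simp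
  then have "chain_of c T (permute_list \<pi> (map ((!) b) \<sigma>)) = chain_of c T (permute_list \<pi> (map ((!) b') \<sigma>))"
    unfolding permute_list_map[OF p] chain_of_def word_flat_def
    using cl_parallel[OF assms(1-5)] by (intro restrict_ext) (simp add: take_map)
  then show "of_int (sign \<pi>) * of_bool (chain_of c T (permute_list \<pi> (map ((!) b) \<sigma>)) = u) =
      (of_int (sign \<pi>) * of_bool (chain_of c T (permute_list \<pi> (map ((!) b') \<sigma>)) = u) :: real)" by simp
qed

text \<open>Both bases extend one basis of the common coline \<open>w\<close>, by \<open>e\<close>
  and by \<open>e'\<close>.\<close>

lemma edge_bases:
  assumes x: "flat x" "flat y" "a \<in> y" "edge x y a z z'"
  obtains b b' where "indep x b" "word_flat x b = z" "indep x b'" "word_flat x b' = z'" "length b = length b'"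
    "\<And>i. i < length b \<Longrightarrow> cl (insert (b ! i) (cl (insert a x))) = cl (insert (b' ! i) (cl (insert a x)))"
proof -
  obtain w e e' where w: "flat w" "x \<subseteq> w" "w \<subseteq> y" "a \<notin> w"
     "e \<in> y" "e' \<in> y" "e \<notin> cl (insert a w)" "e' \<notin> cl (insert a w)"
     "cl (insert e (cl (insert a x))) = cl (insert e' (cl (insert a x)))"
     "z = cl (insert e w)" "z' = cl (insert e' w)"
    using x(4) unfolding edge_def by blast
  have E: "e \<in> E" "e' \<in> E" "a \<in> E" using x(3) w(5,6) flat_E[OF x(2)] by auto
  have ew: "e \<notin> w" "e' \<notin> w" using w sub_cl_insert[OF w(1) E(3)] by auto
  obtain c where c: "indep x c" "word_flat x c = w" using indep_exists[OF x(1) w(1,2)] by blast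
  have *: "indep x (c @ [f])" "word_flat x (c @ [f]) = cl (insert f w)" if "f \<in> E" "f \<notin> w" for f
    using that c w(1) indep_append[OF x(1)] indep_single[OF w(1)] word_flat_append[OF x(1) indep_E[OF c(1)], of "[f]"]
    by (auto simp: word_flat_single)
  show ?thesis
    by (rule that[of "c @ [e]" "c @ [e']"]) (use * E ew w in \<open>auto simp: nth_append\<close>)
qed

text \<open>The unknowns are coefficients of the cycles of \<open>[a, y]\<close>, each lifted to one complement, and of the differences
  of Boolean cycles along the edges of the forest; the equations say that the combination vanishes at all words
  with descent set \<open>T\<close> below every complement. Joining with \<open>a\<close> kills the edge terms, and then the forest
  is dismantled from its leaves.\<close>

lemma cycle_inequality:
  fixes dep :: "nat set \<Rightarrow> nat"
  assumes x: "flat x" "flat y" "x \<subseteq> y" "a \<in> y" "a \<notin> x"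
    and T: "T \<subseteq> {1..<r}" and r: "rk y = rk x + r + 1"
    and forest: "\<And>z. z \<in> Zn \<Longrightarrow> z \<in> complements x y a \<and> edge x y a z (p z) \<and> dep (p z) < dep z"
  shows "card (good_words (cl (insert a x)) y T) + card Zn * beta r T \<le> (\<Sum>z\<in>complements x y a. card (good_words x z T))"
proof (rule ccontr)
  assume contr: "\<not> ?thesis"
  let ?a = "cl (insert a x)" and ?Z = "complements x y a" and ?P = "perm_words {..<r} T"
  have aE: "a \<in> E" using x flat_E by blast
  have a': "?a \<in> upper_covers x y" using cover_insert[OF x] .
  have a'D: "flat ?a" "?a \<subseteq> y" "rk ?a = rk x + 1" "x \<subseteq> ?a" using upper_coversD[OF a'] by auto
  have Zn: "Zn \<subseteq> ?Z" using forest by blast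
  have finZn: "finite Zn" using Zn finite_subset by fastforce
  have "\<forall>z\<in>Zn. \<exists>bb. indep x (fst bb) \<and> word_flat x (fst bb) = z \<and> indep x (snd bb) \<and> word_flat x (snd bb) = p z \<and>
      length (fst bb) = length (snd bb) \<and> (\<forall>i<length (fst bb). cl (insert (fst bb ! i) ?a) = cl (insert (snd bb ! i) ?a))"
  proof
    fix z assume "z \<in> Zn"
    then have "edge x y a z (p z)" using forest by blast
    then obtain b b' where "indep x b" "word_flat x b = z" "indep x b'" "word_flat x b' = p z" "length b = length b'"
      "\<And>i. i < length b \<Longrightarrow> cl (insert (b ! i) ?a) = cl (insert (b' ! i) ?a)"
      using edge_bases[OF x(1,2,4)] by metis
    then show "\<exists>bb. indep x (fst bb) \<and> word_flat x (fst bb) = z \<and> indep x (snd bb) \<and> word_flat x (snd bb) = p z \<and>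
      length (fst bb) = length (snd bb) \<and> (\<forall>i<length (fst bb). cl (insert (fst bb ! i) ?a) = cl (insert (snd bb ! i) ?a))"
      by (intro exI[of _ "(b, b')"]) simp
  qed
  then obtain bb where bb: "\<And>z. z \<in> Zn \<Longrightarrow> indep x (fst (bb z)) \<and> word_flat x (fst (bb z)) = z \<and> indep x (snd (bb z)) \<and>
      word_flat x (snd (bb z)) = p z \<and> length (fst (bb z)) = length (snd (bb z)) \<and>
      (\<forall>i<length (fst (bb z)). cl (insert (fst (bb z) ! i) ?a) = cl (insert (snd (bb z) ! i) ?a))"
    using bchoice[of Zn] by metis
  define q1 where "q1 = (\<lambda>(z, \<sigma>). map ((!) (fst (bb z))) \<sigma>)"
  define q2 where "q2 = (\<lambda>(z, \<sigma>). map ((!) (snd (bb z))) \<sigma>)"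
  have ZD: "flat z" "x \<subseteq> z" "rk z = rk x + r" if "z \<in> ?Z" for z using that r by (auto simp: complements_def)
  have lenb: "length (fst (bb z)) = r" "length (snd (bb z)) = r" if "z \<in> Zn" for z
    using bb[OF that] indep_length[of x "fst (bb z)" z] ZD[of z] Zn that by auto
  have pZ: "p z \<in> ?Z" if "z \<in> Zn" for z
    using edge_complements[OF x(2,4) edge_sym] forest[OF that] by blast
  have q1: "indep x (q1 k)" "word_flat x (q1 k) = fst k" "length (q1 k) = r" if "k \<in> Zn \<times> ?P" for k
    using that indep_map_perm[of x "fst (bb (fst k))" "snd k" T] bb[of "fst k"] lenb[of "fst k"]
    by (auto simp: q1_def)
  have q2: "indep x (q2 k)" "word_flat x (q2 k) = p (fst k)" "length (q2 k) = r" if "k \<in> Zn \<times> ?P" for k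
    using that indep_map_perm[of x "snd (bb (fst k))" "snd k" T] bb[of "fst k"] lenb[of "fst k"]
    by (auto simp: q2_def)
  have gwD: "indep ?a v" "word_flat ?a v = y" "length v = r" if "v \<in> good_words ?a y T" for v
    using that indep_length[of ?a v y] r a'D by (auto simp: good_words_def good_def)
  \<comment> \<open>Prepending \<open>a\<close> to a good word of the upper interval gives a basis
    over \<open>x\<close>; moving \<open>a\<close> to the end shows that the word itself is
    independent over \<open>x\<close> and spans a complement. This is the lift.\<close>
  have v: "indep x v" "word_flat x v \<in> ?Z" if "v \<in> good_words ?a y T" for v
  proof -
    note g = gwD[OF that]
    have vE: "set v \<subseteq> E" using indep_E[OF g(1)] .
    have ia: "indep x [a]" using indep_single[OF x(1)] aE x(5) by simp
    have "indep x ([a] @ v)" using indep_append[OF x(1), of "[a]" v] ia g(1) by (simp add: word_flat_single)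
    then have iva: "indep x (v @ [a])" by (rule indep_perm) auto
    then show iv: "indep x v" using indep_append[OF x(1)] by blast
    have fl: "flat (word_flat x v)" using flat_word_flat[OF x(1) vE] .
    have "a \<notin> word_flat x v" using iva indep_append[OF x(1)] indep_single[OF fl] by blast
    moreover have "word_flat x v \<subseteq> y"
      using set_sub_word_flat[OF a'D(1) vE] g(2) x by (intro word_flat_least) auto
    ultimately show "word_flat x v \<in> ?Z"
      using fl word_flat_sub[OF x(1) vE] iv g(3) r by (simp add: complements_def indep_def)
  qed
  define I where "I = good_words ?a y T <+> (Zn \<times> ?P)"
  define J where "J = (SIGMA z:?Z. good_words x z T)"
  have fin: "finite I" "finite J" using finZn by (auto simp: I_def J_def)
  have "card J < card I"
    using contr finZn by (simp add: I_def J_def card_Plus card_SigmaI card_cartesian_product beta_def)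
  \<comment> \<open>The part of the unknown \<open>i\<close> that lives below the complement
    \<open>z\<close>: an edge carries a cycle at its vertex and the negative of the matching cycle
    at its parent.\<close>
  define trm where "trm z u i = (case i of Inl v \<Rightarrow> of_bool (word_flat x v = z) * ribbon_cycle x T v u
     | Inr k \<Rightarrow> of_bool (fst k = z) * ribbon_cycle x T (q1 k) u - of_bool (p (fst k) = z) * ribbon_cycle x T (q2 k) u)"
    for z u and i :: "nat list + nat set \<times> nat list"
  obtain \<alpha> where \<alpha>: "\<exists>i\<in>I. \<alpha> i \<noteq> 0" "\<And>j. j \<in> J \<Longrightarrow> (\<Sum>i\<in>I. \<alpha> i * trm (fst j) (chain_of x T (snd j)) i) = 0"
    using underdetermined_system[OF fin(2,1) \<open>card J < card I\<close>, of "\<lambda>j i. trm (fst j) (chain_of x T (snd j)) i"] by blast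
  have split: "(\<Sum>i\<in>I. \<alpha> i * trm z u i) = (\<Sum>v\<in>good_words ?a y T. \<alpha> (Inl v) * (of_bool (word_flat x v = z) * ribbon_cycle x T v u)) +
     (\<Sum>k\<in>Zn \<times> ?P. \<alpha> (Inr k) * (of_bool (fst k = z) * ribbon_cycle x T (q1 k) u - of_bool (p (fst k) = z) * ribbon_cycle x T (q2 k) u))"
    for z u unfolding I_def trm_def using finZn by (subst sum.Plus) auto
  have comp0: "(\<Sum>i\<in>I. \<alpha> i * trm z u i) = 0" if z: "z \<in> ?Z" for z u
  proof -
    \<comment> \<open>Every edge appears twice, once for each of its bases, and its coefficient is
      set to 0 unless that basis spans \<open>z\<close>.\<close>
    define K where "K = good_words ?a y T <+> ((Zn \<times> ?P) <+> (Zn \<times> ?P))"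
    define q where "q k = (case k of Inl v \<Rightarrow> v | Inr k' \<Rightarrow> (case k' of Inl k1 \<Rightarrow> q1 k1 | Inr k2 \<Rightarrow> q2 k2))" for k
    define \<gamma> where "\<gamma> k = (case k of Inl v \<Rightarrow> \<alpha> (Inl v) * of_bool (word_flat x v = z)
       | Inr k' \<Rightarrow> (case k' of Inl k1 \<Rightarrow> \<alpha> (Inr k1) * of_bool (fst k1 = z)
          | Inr k2 \<Rightarrow> - \<alpha> (Inr k2) * of_bool (p (fst k2) = z)))" for k
    have eq: "(\<Sum>i\<in>I. \<alpha> i * trm z u i) = (\<Sum>k\<in>K. \<gamma> k * ribbon_cycle x T (q k) u)" for u
    proof -
      have "(\<Sum>k\<in>K. \<gamma> k * ribbon_cycle x T (q k) u) = (\<Sum>v\<in>good_words ?a y T. \<alpha> (Inl v) * of_bool (word_flat x v = z) * ribbon_cycle x T v u) +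
        ((\<Sum>k\<in>Zn \<times> ?P. \<alpha> (Inr k) * of_bool (fst k = z) * ribbon_cycle x T (q1 k) u) +
         (\<Sum>k\<in>Zn \<times> ?P. - \<alpha> (Inr k) * of_bool (p (fst k) = z) * ribbon_cycle x T (q2 k) u))"
        unfolding K_def \<gamma>_def q_def using finZn by (subst sum.Plus, simp, simp, subst sum.Plus) auto
      also have "\<dots> = (\<Sum>i\<in>I. \<alpha> i * trm z u i)" unfolding split
        by (simp add: right_diff_distrib sum_subtractf sum_negf mult.assoc)
      finally show ?thesis by simp
    qed
    show ?thesis unfolding eq
    proof (rule lincomb_zero[OF x(1) ZD(1,2)[OF z]])
      show "T \<subseteq> {1..<rk z - rk x}" using T ZD(3)[OF z] by simp
      show "indep x (q k) \<and> word_flat x (q k) = z" if k: "k \<in> K" "\<gamma> k \<noteq> 0" for k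
      proof -
        consider (1) w where "k = Inl w" "w \<in> good_words ?a y T" | (2) k1 where "k = Inr (Inl k1)" "k1 \<in> Zn \<times> ?P"
          | (3) k2 where "k = Inr (Inr k2)" "k2 \<in> Zn \<times> ?P"
          using k(1) unfolding K_def Plus_def by blast
        then show ?thesis
        proof cases
          case 1
          then show ?thesis using k(2) v(1) by (simp add: \<gamma>_def q_def)
        next
          case 2
          then show ?thesis using k(2) q1[of k1] by (simp add: \<gamma>_def q_def)
        next
          case 3
          then show ?thesis using k(2) q2[of k2] by (simp add: \<gamma>_def q_def)
        qed
      qed
      show "(\<Sum>k\<in>K. \<gamma> k * ribbon_cycle x T (q k) (chain_of x T w)) = 0" if "w \<in> good_words x z T" for w
        using \<alpha>(2)[of "(z, w)"] that z eq[of "chain_of x T w"] by (simp add: J_def)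
    qed
  qed
  have one: "(\<Sum>z\<in>?Z. of_bool (c = z)) = (1::real)" if "c \<in> ?Z" for c
    using that by (simp add: of_bool_def)
  have total: "(\<Sum>v\<in>good_words ?a y T. \<alpha> (Inl v) * ribbon_cycle x T v u) +
     (\<Sum>k\<in>Zn \<times> ?P. \<alpha> (Inr k) * (ribbon_cycle x T (q1 k) u - ribbon_cycle x T (q2 k) u)) = 0" for u
  proof -
    have "0 = (\<Sum>z\<in>?Z. \<Sum>i\<in>I. \<alpha> i * trm z u i)" using comp0 by simp
    also have "\<dots> = (\<Sum>i\<in>I. \<alpha> i * (\<Sum>z\<in>?Z. trm z u i))"
      by (subst sum.swap) (simp add: sum_distrib_left)
    also have "\<dots> = (\<Sum>v\<in>good_words ?a y T. \<alpha> (Inl v) * (\<Sum>z\<in>?Z. trm z u (Inl v))) +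
       (\<Sum>k\<in>Zn \<times> ?P. \<alpha> (Inr k) * (\<Sum>z\<in>?Z. trm z u (Inr k)))"
      unfolding I_def using finZn by (subst sum.Plus) auto
    also have "(\<Sum>v\<in>good_words ?a y T. \<alpha> (Inl v) * (\<Sum>z\<in>?Z. trm z u (Inl v))) = (\<Sum>v\<in>good_words ?a y T. \<alpha> (Inl v) * ribbon_cycle x T v u)"
    proof (rule sum.cong[OF refl])
      fix w assume "w \<in> good_words ?a y T"
      then show "\<alpha> (Inl w) * (\<Sum>z\<in>?Z. trm z u (Inl w)) = \<alpha> (Inl w) * ribbon_cycle x T w u"
        using one[OF v(2), of w] by (simp only: trm_def sum.case sum_distrib_right[symmetric] mult_1)
    qed
    also have "(\<Sum>k\<in>Zn \<times> ?P. \<alpha> (Inr k) * (\<Sum>z\<in>?Z. trm z u (Inr k))) =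
        (\<Sum>k\<in>Zn \<times> ?P. \<alpha> (Inr k) * (ribbon_cycle x T (q1 k) u - ribbon_cycle x T (q2 k) u))"
    proof (rule sum.cong[OF refl])
      fix k assume "k \<in> Zn \<times> ?P"
      then have "fst k \<in> ?Z" "p (fst k) \<in> ?Z" using Zn pZ by auto
      then show "\<alpha> (Inr k) * (\<Sum>z\<in>?Z. trm z u (Inr k)) = \<alpha> (Inr k) * (ribbon_cycle x T (q1 k) u - ribbon_cycle x T (q2 k) u)"
        using one[of "fst k"] one[of "p (fst k)"]
        by (simp only: trm_def sum.case sum_subtractf sum_distrib_right[symmetric] mult_1)
    qed
    finally show ?thesis by simp
  qed
  define U where "U = (\<Union>z\<in>?Z. flag_chains x z T)"
  have finT: "finite T" using T finite_subset by blast
  have finU: "finite U" unfolding U_def using finite_flag_chains[OF finT] by auto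
  \<comment> \<open>Joining with \<open>a\<close> sends the lifts back to the cycles of the upper
    interval and makes the two cycles of each edge equal.\<close>
  have Inl0: "\<alpha> (Inl w) = 0" if "w \<in> good_words ?a y T" for w
  proof (rule cycle_independent[OF a'D(1) _ _ that])
    show "T \<subseteq> {1..<rk y - rk ?a}" using T r a'D by simp
    fix u'
    let ?U = "{u. u \<in> U \<and> push a T u = u'}"
    have pe: "(\<Sum>u\<in>?U. ribbon_cycle x T w u) = ribbon_cycle ?a T w u'" if "indep x w" "word_flat x w \<in> ?Z" "length w = r" for w
      using that T finU by (intro push_cycle[OF x(1) aE]) (auto simp: U_def)
    have "0 = (\<Sum>u\<in>?U. (\<Sum>v\<in>good_words ?a y T. \<alpha> (Inl v) * ribbon_cycle x T v u) +
       (\<Sum>k\<in>Zn \<times> ?P. \<alpha> (Inr k) * (ribbon_cycle x T (q1 k) u - ribbon_cycle x T (q2 k) u)))"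
      using total by simp
    also have "\<dots> = (\<Sum>v\<in>good_words ?a y T. \<alpha> (Inl v) * (\<Sum>u\<in>?U. ribbon_cycle x T v u)) +
       (\<Sum>k\<in>Zn \<times> ?P. \<alpha> (Inr k) * ((\<Sum>u\<in>?U. ribbon_cycle x T (q1 k) u) - (\<Sum>u\<in>?U. ribbon_cycle x T (q2 k) u)))"
      unfolding sum.distrib
      by (subst (1) sum.swap, subst (2) sum.swap) (simp add: sum_subtractf flip: sum_distrib_left)
    also have "(\<Sum>v\<in>good_words ?a y T. \<alpha> (Inl v) * (\<Sum>u\<in>?U. ribbon_cycle x T v u)) = (\<Sum>v\<in>good_words ?a y T. \<alpha> (Inl v) * ribbon_cycle ?a T v u')"
      using pe v gwD(3) by (intro sum.cong) auto
    also have "(\<Sum>k\<in>Zn \<times> ?P. \<alpha> (Inr k) * ((\<Sum>u\<in>?U. ribbon_cycle x T (q1 k) u) - (\<Sum>u\<in>?U. ribbon_cycle x T (q2 k) u))) = 0"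
    proof (rule sum.neutral, rule ballI)
      fix k assume k: "k \<in> Zn \<times> ?P"
      then have kz: "fst k \<in> Zn" "snd k \<in> ?P" by auto
      have "(\<Sum>u\<in>?U. ribbon_cycle x T (q1 k) u) = ribbon_cycle ?a T (q1 k) u'"
        using pe[OF q1(1)[OF k] _ q1(3)[OF k]] q1(2)[OF k] kz Zn by auto
      moreover have "(\<Sum>u\<in>?U. ribbon_cycle x T (q2 k) u) = ribbon_cycle ?a T (q2 k) u'"
        using pe[OF q2(1)[OF k] _ q2(3)[OF k]] q2(2)[OF k] kz pZ by auto
      moreover have "ribbon_cycle ?a T (q1 k) u' = ribbon_cycle ?a T (q2 k) u'"
        using cycle_parallel[OF a'D(1), of "fst (bb (fst k))" "snd (bb (fst k))" "snd k" T u'] bb[OF kz(1)] lenb[OF kz(1)] kz(2)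
          indep_E[of x "fst (bb (fst k))"] indep_E[of x "snd (bb (fst k))"] by (simp add: q1_def q2_def perm_words_def case_prod_beta)
      ultimately show "\<alpha> (Inr k) * ((\<Sum>u\<in>?U. ribbon_cycle x T (q1 k) u) - (\<Sum>u\<in>?U. ribbon_cycle x T (q2 k) u)) = 0" by simp
    qed
    finally show "(\<Sum>v\<in>good_words ?a y T. \<alpha> (Inl v) * ribbon_cycle ?a T v u') = 0" by simp
  qed
  \<comment> \<open>Deepest vertices come first: edges whose parent is \<open>z\<close> already have
    coefficient 0, so below \<open>z\<close> only the Boolean cycles of the edge from
    \<open>z\<close> to its parent remain, and these are independent.\<close>
  have Inr0: "\<alpha> (Inr (z, \<sigma>)) = 0" if "z \<in> Zn" "\<sigma> \<in> ?P" for z \<sigma>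
    using that
  proof (induction "Max (dep ` Zn) - dep z" arbitrary: z \<sigma> rule: less_induct)
    case less
    have zZ: "z \<in> ?Z" using less.prems Zn by blast
    show ?case
    proof (rule boolean_independent[OF x(1) _ lenb(1)[OF less.prems(1)] T _ less.prems(2), where \<gamma> = "\<lambda>\<sigma>. \<alpha> (Inr (z, \<sigma>))"])
      show "indep x (fst (bb z))" using bb[OF less.prems(1)] by blast
      fix u
      have late: "\<alpha> (Inr k) = 0" if k: "k \<in> Zn \<times> ?P" "p (fst k) = z" for k
      proof -
        have kz: "fst k \<in> Zn" "snd k \<in> ?P" using k by auto
        have "dep z < dep (fst k)" using forest[OF kz(1)] k by simp
        moreover have "dep (fst k) \<le> Max (dep ` Zn)" using kz finZn by simp
        ultimately have "Max (dep ` Zn) - dep (fst k) < Max (dep ` Zn) - dep z" by linarith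
        from less.hyps[OF this kz] show ?thesis by simp
      qed
      have "0 = (\<Sum>v\<in>good_words ?a y T. \<alpha> (Inl v) * (of_bool (word_flat x v = z) * ribbon_cycle x T v u)) +
       (\<Sum>k\<in>Zn \<times> ?P. \<alpha> (Inr k) * (of_bool (fst k = z) * ribbon_cycle x T (q1 k) u - of_bool (p (fst k) = z) * ribbon_cycle x T (q2 k) u))"
        using comp0[OF zZ, of u] split[of z u] by simp
      also have "\<dots> = (\<Sum>k\<in>Zn \<times> ?P. \<alpha> (Inr k) * (of_bool (fst k = z) * ribbon_cycle x T (q1 k) u))"
      proof -
        have "(\<Sum>v\<in>good_words ?a y T. \<alpha> (Inl v) * (of_bool (word_flat x v = z) * ribbon_cycle x T v u)) = 0"
          using Inl0 by (intro sum.neutral) simp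
        moreover have "(\<Sum>k\<in>Zn \<times> ?P. \<alpha> (Inr k) * (of_bool (fst k = z) * ribbon_cycle x T (q1 k) u - of_bool (p (fst k) = z) * ribbon_cycle x T (q2 k) u))
          = (\<Sum>k\<in>Zn \<times> ?P. \<alpha> (Inr k) * (of_bool (fst k = z) * ribbon_cycle x T (q1 k) u))"
          by (rule sum.cong[OF refl]) (use late in \<open>auto simp: of_bool_def\<close>)
        ultimately show ?thesis by simp
      qed
      also have "\<dots> = (\<Sum>k\<in>{z} \<times> ?P. \<alpha> (Inr k) * (of_bool (fst k = z) * ribbon_cycle x T (q1 k) u))"
        by (rule sum.mono_neutral_right) (use less.prems finZn in auto)
      also have "\<dots> = (\<Sum>\<sigma>\<in>?P. \<alpha> (Inr (z, \<sigma>)) * ribbon_cycle x T (map ((!) (fst (bb z))) \<sigma>) u)"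
        using sum.cartesian_product[of "\<lambda>z' \<sigma>. \<alpha> (Inr (z', \<sigma>)) * (of_bool (z' = z) * ribbon_cycle x T (q1 (z', \<sigma>)) u)" ?P "{z}"]
        by (simp add: q1_def case_prod_beta)
      finally show "(\<Sum>\<sigma>\<in>?P. \<alpha> (Inr (z, \<sigma>)) * ribbon_cycle x T (map ((!) (fst (bb z))) \<sigma>) u) = 0" by simp
    qed
  qed
  have "\<alpha> i = 0" if "i \<in> I" for i
    using that Inl0 Inr0 unfolding I_def by (elim PlusE SigmaE) auto
  then show False using \<alpha>(1) by blast
qed

text \<open>The vertices other than roots are the edges of the forest, and by
  \<open>component_bound\<close> there are at least D of them. If \<open>T\<close> is not a set of
  inner positions, both terms on the left are 0.\<close>

lemma complement_inequality:
  assumes x: "flat x" "flat y" "x \<subseteq> y" "a \<in> y" "a \<notin> x" and r: "rk y = rk x + r + 1"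
  shows "int (card (good_words (cl (insert a x)) y T)) +
      (int (card (upper_covers x y)) - 1 - int (card (upper_covers (cl (insert a x)) y))) * int (beta r T)
    \<le> (\<Sum>z\<in>complements x y a. int (card (good_words x z T)))"
proof (cases "T \<subseteq> {1..<r}")
  case True
  have p1: "edge x y a z' z" if "edge x y a z z'" for z z' using edge_sym[OF that] .
  have p2: "z \<in> complements x y a \<and> z' \<in> complements x y a" if "edge x y a z z'" for z z'
    using edge_complements[OF x(2,4) that] edge_complements[OF x(2,4) p1[OF that]] by simp
  obtain \<rho> p and dep :: "nat set \<Rightarrow> nat" where f:
    "\<And>z z'. edge x y a z z' \<Longrightarrow> \<rho> z = \<rho> z'"
    "\<And>z. z \<in> complements x y a \<Longrightarrow> \<rho> z \<in> complements x y a"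
    "\<And>z. z \<in> complements x y a \<Longrightarrow> \<rho> (\<rho> z) = \<rho> z"
    "\<And>z. z \<in> complements x y a \<Longrightarrow> \<rho> z \<noteq> z \<Longrightarrow> edge x y a z (p z) \<and> dep (p z) < dep z"
  proof (rule spanning_forest[of "edge x y a" "complements x y a", OF p1 p2])
    fix \<rho> p and dep :: "nat set \<Rightarrow> nat"
    assume "\<And>z z'. edge x y a z z' \<Longrightarrow> \<rho> z = \<rho> z'"
      "\<And>z. z \<in> complements x y a \<Longrightarrow> \<rho> z \<in> complements x y a"
      "\<And>z. z \<in> complements x y a \<Longrightarrow> \<rho> (\<rho> z) = \<rho> z"
      "\<And>z. z \<in> complements x y a \<Longrightarrow> \<rho> z \<noteq> z \<Longrightarrow> edge x y a z (p z) \<and> dep (p z) < dep z"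
    then show thesis by (rule that)
  qed
  let ?Zn = "{z \<in> complements x y a. \<rho> z \<noteq> z}"
  have "\<rho> ` complements x y a = {z \<in> complements x y a. \<rho> z = z}" using f(2,3) by force
  then have "card (\<rho> ` complements x y a) + card ?Zn = card ({z \<in> complements x y a. \<rho> z = z} \<union> ?Zn)"
    by (subst card_Un_disjoint) auto
  also have "{z \<in> complements x y a. \<rho> z = z} \<union> ?Zn = complements x y a" by blast
  finally have "card (complements x y a) = card (\<rho> ` complements x y a) + card ?Zn" by simp
  moreover have "card (upper_covers x y) + card (\<rho> ` complements x y a) \<le> 1 + card (upper_covers (cl (insert a x)) y) + card (complements x y a)"
    by (rule component_bound[OF x]) (rule f(1))
  ultimately have "int (card (upper_covers x y)) - 1 - int (card (upper_covers (cl (insert a x)) y)) \<le> int (card ?Zn)"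
    by linarith
  then have "(int (card (upper_covers x y)) - 1 - int (card (upper_covers (cl (insert a x)) y))) * int (beta r T)
      \<le> int (card ?Zn) * int (beta r T)" by (rule mult_right_mono) simp
  moreover have cyc: "card (good_words (cl (insert a x)) y T) + card ?Zn * beta r T \<le> (\<Sum>z\<in>complements x y a. card (good_words x z T))"
    using f(4) by (intro cycle_inequality[OF x True r, of _ p dep]) auto
  moreover have "int (card (good_words (cl (insert a x)) y T)) + int (card ?Zn) * int (beta r T)
      \<le> (\<Sum>z\<in>complements x y a. int (card (good_words x z T)))"
    using cyc by (simp only: of_nat_mult[symmetric] of_nat_add[symmetric] of_nat_sum[symmetric] of_nat_le_iff)
  ultimately show ?thesis by linarith
next
  case False
  have "perm_words {..<r} T = {}" using False perm_words_length by (fastforce simp: perm_words_def Des_def)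
  moreover have "good_words (cl (insert a x)) y T = {}"
  proof (rule ccontr)
    assume "good_words (cl (insert a x)) y T \<noteq> {}"
    then obtain w where w: "indep (cl (insert a x)) w" "word_flat (cl (insert a x)) w = y" "Des w = T"
      by (auto simp: good_words_def good_def)
    have "length w = r" using indep_length[OF w(1,2)] r upper_coversD(4)[OF cover_insert[OF x]] by simp
    then show False using w(3) False by (auto simp: Des_def)
  qed
  ultimately show ?thesis by (simp add: beta_def sum_nonneg)
qed

end

section \<open>Descents of permutations\<close>

text \<open>The descent data of \<open>u\<close> and \<open>v\<close> in a word \<open>u @ a # v\<close> with descent set \<open>S\<close> and minimal letter \<open>a\<close> at index \<open>k\<close>.\<close>

definition des_pre :: "nat set \<Rightarrow> nat \<Rightarrow> nat set" where "des_pre S k = {s \<in> S. s < k}"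
definition des_suf :: "nat set \<Rightarrow> nat \<Rightarrow> nat set" where "des_suf S k = {s. 0 < s \<and> s + k + 1 \<in> S}"
definition des_split :: "nat set \<Rightarrow> nat \<Rightarrow> bool" where "des_split S k \<longleftrightarrow> 0 \<notin> S \<and> (k = 0 \<or> k \<in> S) \<and> k + 1 \<notin> S"

lemma Des_map_strict:
  assumes "\<And>i j. i \<in> set w \<Longrightarrow> j \<in> set w \<Longrightarrow> f i < f j \<longleftrightarrow> i < j"
  shows "Des (map f w) = Des w"
  using assms by (auto simp: Des_def)

lemma Des_take: "Des (take k w) = {s \<in> Des w. s < k}"
  by (auto simp: Des_def)

lemma Des_drop: "Des (drop k w) = {s. 0 < s \<and> s + k \<in> Des w}"
  by (auto simp: Des_def add.commute)

lemma Des_insert_min: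
  assumes "\<And>e. e \<in> set u \<union> set v \<Longrightarrow> a < e"
  shows "Des (u @ a # v) = Des u \<union> (if u = [] then {} else {length u}) \<union> {s + length u + 1 | s. s \<in> Des v}"
proof (intro set_eqI)
  fix i
  let ?k = "length u"
  consider "i < ?k" | "i = ?k" | "i = ?k + 1" | "?k + 1 < i" by linarith
  then show "i \<in> Des (u @ a # v) \<longleftrightarrow>
      i \<in> Des u \<union> (if u = [] then {} else {length u}) \<union> {s + length u + 1 | s. s \<in> Des v}"
  proof cases
    case 1
    then show ?thesis by (auto simp: Des_def nth_append)
  next
    case 2
    show ?thesis
    proof (cases "u = []")
      case False
      then have "u ! (?k - 1) \<in> set u" by (intro nth_mem) simp
      then have "a < u ! (?k - 1)" using assms by blast
      then show ?thesis using 2 False by (auto simp: Des_def nth_append)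
    qed (use 2 in \<open>auto simp: Des_def\<close>)
  next
    case 3
    have "\<not> v ! 0 < a" if "v \<noteq> []" using assms[of "v ! 0"] that by (auto simp: not_less)
    then show ?thesis using 3 by (auto simp: Des_def nth_append)
  next
    case 4
    then obtain j where j: "i = j + ?k + 1" "0 < j" by (metis add.commute add.left_commute less_imp_add_positive)
    have "(u @ a # v) ! i = v ! j" "(u @ a # v) ! (i - 1) = v ! (j - 1)"
      using j by (auto simp: nth_append nth_Cons')
    then show ?thesis using j by (auto simp: Des_def)
  qed
qed

text \<open>A minimal letter makes a descent at its own index, unless it comes first, and an ascent
  right after it; \<open>des_split\<close> collects these forced positions. The descents of
  \<open>v\<close> reappear shifted by \<open>length u + 1\<close>.\<close>

lemma Des_insert_iff:
  assumes "\<And>e. e \<in> set u \<union> set v \<Longrightarrow> a < e"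
  shows "Des (u @ a # v) = S \<longleftrightarrow> des_split S (length u) \<and> Des u = des_pre S (length u) \<and> Des v = des_suf S (length u)"
proof -
  let ?k = "length u"
  let ?D = "Des u \<union> (if u = [] then {} else {length u}) \<union> {s + length u + 1 | s. s \<in> Des v}"
  have u: "\<And>s. s \<in> Des u \<Longrightarrow> 0 < s \<and> s < ?k" and v: "\<And>s. s \<in> Des v \<Longrightarrow> 0 < s" by (auto simp: Des_def)
  have "?D = S \<longleftrightarrow> des_split S ?k \<and> Des u = des_pre S ?k \<and> Des v = des_suf S ?k"
  proof
    assume D: "?D = S"
    have n: "0 \<notin> Des u" "0 \<notin> Des v" "Suc ?k \<notin> Des u" "?k \<notin> Des u" "\<And>s. Suc (s + ?k) \<notin> Des u"
      by (auto simp: Des_def)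
    have "des_split S ?k" unfolding des_split_def D[symmetric] using n by (auto split: if_splits)
    moreover have "Des u = des_pre S ?k" unfolding des_pre_def D[symmetric] using u by (auto split: if_splits)
    moreover have "Des v = des_suf S ?k" unfolding des_suf_def D[symmetric] using n v by (auto split: if_splits)
    ultimately show "des_split S ?k \<and> Des u = des_pre S ?k \<and> Des v = des_suf S ?k" by blast
  next
    assume A: "des_split S ?k \<and> Des u = des_pre S ?k \<and> Des v = des_suf S ?k"
    show "?D = S"
    proof (intro set_eqI)
      fix i
      consider "i < ?k" | "i = ?k" | "i = ?k + 1" | "?k + 1 < i" by linarith
      then show "i \<in> ?D \<longleftrightarrow> i \<in> S"
      proof cases
        case 4
        then obtain j where j: "i = j + ?k + 1" "0 < j" by (metis add.commute add.left_commute less_imp_add_positive)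
        then show ?thesis using A by (auto simp: des_pre_def des_suf_def)
      qed (use A in \<open>auto simp: des_pre_def des_suf_def des_split_def\<close>)
    qed
  qed
  moreover have "Des (u @ a # v) = ?D" by (rule Des_insert_min) (rule assms)
  ultimately show ?thesis by simp
qed

lemma card_perm_words:
  assumes "finite A" shows "card (perm_words A T) = beta (card A) T"
proof -
  define l where "l = sorted_list_of_set A"
  let ?f = "\<lambda>i. l ! i" and ?n = "card A"
  have l: "distinct l" "set l = A" "length l = ?n" "sorted l" using assms by (auto simp: l_def)
  have mono: "?f i < ?f j \<longleftrightarrow> i < j" if "i < ?n" "j < ?n" for i j
    using l that strict_sorted_iff[of l] sorted_wrt_nth_less[of "(<)" l] by (metis less_imp_not_less not_less_iff_gr_or_eq)
  have bij: "bij_betw ?f {..<?n} A" using l by (metis bij_betw_nth)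
  have "bij_betw (map ?f) (perm_words {..<?n} T) (perm_words A T)"
  proof (rule bij_betwI[of _ _ _ "map (inv_into {..<?n} ?f)"])
    have inv: "inv_into {..<?n} ?f e < ?n" "?f (inv_into {..<?n} ?f e) = e" if "e \<in> A" for e
      using that bij by (auto simp: bij_betw_def inv_into_into f_inv_into_f intro: inv_into_into[of e ?f "{..<?n}", simplified])
    show "map ?f \<in> perm_words {..<?n} T \<rightarrow> perm_words A T"
    proof
      fix w assume w: "w \<in> perm_words {..<?n} T"
      have "Des (map ?f w) = Des w" by (rule Des_map_strict) (use w mono in \<open>auto simp: perm_words_def\<close>)
      then show "map ?f w \<in> perm_words A T"
        using w bij by (auto simp: perm_words_def distinct_map bij_betw_def)
    qed
    show "map (inv_into {..<?n} ?f) \<in> perm_words A T \<rightarrow> perm_words {..<?n} T"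
    proof
      fix w assume w: "w \<in> perm_words A T"
      have "Des (map (inv_into {..<?n} ?f) w) = Des w"
        by (rule Des_map_strict) (use w mono inv in \<open>metis (mono_tags, lifting) mem_Collect_eq perm_words_def\<close>)
      moreover have "inj_on (inv_into {..<?n} ?f) A" by (rule inj_on_inverseI[of _ ?f]) (use inv in auto)
      moreover have "inv_into {..<?n} ?f ` A = {..<?n}"
        using bij bij_betw_inv_into[OF bij] by (simp add: bij_betw_def)
      ultimately show "map (inv_into {..<?n} ?f) w \<in> perm_words {..<?n} T"
        using w by (auto simp: perm_words_def distinct_map)
    qed
    show "map (inv_into {..<?n} ?f) (map ?f w) = w" if "w \<in> perm_words {..<?n} T" for w
      using that bij by (auto simp: perm_words_def bij_betw_def intro!: map_idI)
    show "map ?f (map (inv_into {..<?n} ?f) w) = w" if "w \<in> perm_words A T" for w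
      using that inv by (auto simp: perm_words_def intro!: map_idI)
  qed
  then show ?thesis unfolding beta_def using bij_betw_same_card by metis
qed

section \<open>Relative position of two neighbouring values in permutations with given
  descents\<close>

definition before :: "nat \<Rightarrow> nat \<Rightarrow> nat list \<Rightarrow> bool" where
  "before i j w \<longleftrightarrow> (\<exists>p q. p < q \<and> q < length w \<and> w ! p = i \<and> w ! q = j)"

text \<open>\<open>beta_inv 1 0 d S\<close> is the number c_d(S) of the overview. General values are
  kept because inserting a new smallest letter leads to the pair 2, 1, and the near pencil produces
  the pair \<open>r\<close>, \<open>r - 1\<close>.\<close>

definition beta_inv :: "nat \<Rightarrow> nat \<Rightarrow> nat \<Rightarrow> nat set \<Rightarrow> nat" where
  "beta_inv i j d S = card {w \<in> perm_words {..<d} S. before i j w}"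

lemma before_append: "before i j (u @ v) \<longleftrightarrow> before i j u \<or> before i j v \<or> i \<in> set u \<and> j \<in> set v"
proof
  assume "before i j (u @ v)"
  then obtain p q where pq: "p < q" "q < length u + length v" "(u @ v) ! p = i" "(u @ v) ! q = j"
    by (auto simp: before_def)
  consider "q < length u" | "length u \<le> p" | "p < length u" "length u \<le> q" using pq by linarith
  then show "before i j u \<or> before i j v \<or> i \<in> set u \<and> j \<in> set v"
  proof cases
    case 1
    then have "before i j u" unfolding before_def using pq by (intro exI[of _ p] exI[of _ q]) (simp add: nth_append)
    then show ?thesis by simp
  next
    case 2
    then have "before i j v" unfolding before_def using pq
      by (intro exI[of _ "p - length u"] exI[of _ "q - length u"]) (auto simp: nth_append)
    then show ?thesis by simp
  next
    case 3
    then show ?thesis using pq by (auto simp: nth_append)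
  qed
next
  assume "before i j u \<or> before i j v \<or> i \<in> set u \<and> j \<in> set v"
  then show "before i j (u @ v)"
  proof (elim disjE)
    assume "before i j u"
    then obtain p q where "p < q" "q < length u" "u ! p = i" "u ! q = j" by (auto simp: before_def)
    then show ?thesis unfolding before_def by (intro exI[of _ p] exI[of _ q]) (simp add: nth_append)
  next
    assume "before i j v"
    then obtain p q where "p < q" "q < length v" "v ! p = i" "v ! q = j" by (auto simp: before_def)
    then show ?thesis unfolding before_def
      by (intro exI[of _ "p + length u"] exI[of _ "q + length u"]) (simp add: nth_append)
  next
    assume "i \<in> set u \<and> j \<in> set v"
    then obtain p q where "p < length u" "u ! p = i" "q < length v" "v ! q = j" by (auto simp: in_set_conv_nth)
    then show ?thesis unfolding before_def
      by (intro exI[of _ p] exI[of _ "q + length u"]) (simp add: nth_append)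
  qed
qed

lemma before_Cons: "before i j (e # v) \<longleftrightarrow> before i j v \<or> i = e \<and> j \<in> set v"
  using before_append[of i j "[e]" v] by (auto simp: before_def)

lemma before_set: "before i j w \<Longrightarrow> i \<in> set w \<and> j \<in> set w"
  by (auto simp: before_def)

lemma before_map: "before (f i) (f j) (map f w) \<longleftrightarrow> before i j w" if "inj f"
proof -
  have "p < q \<and> q < length w \<and> map f w ! p = f i \<and> map f w ! q = f j \<longleftrightarrow>
      p < q \<and> q < length w \<and> w ! p = i \<and> w ! q = j" for p q
    using that by (auto simp: inj_eq)
  then show ?thesis by (simp add: before_def)
qed

text \<open>Exchanging the values \<open>i\<close> and \<open>i + 1\<close> does not affect descents unless they are neighbours.\<close>

definition adj :: "nat \<Rightarrow> nat list \<Rightarrow> bool" where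
  "adj i w \<longleftrightarrow> (\<exists>j. Suc j < length w \<and> {w ! j, w ! Suc j} = {i, Suc i})"

definition vswap :: "nat \<Rightarrow> nat list \<Rightarrow> nat list" where
  "vswap i w = (if adj i w then w else map (transpose i (Suc i)) w)"

lemma adj_map: "adj i (map (transpose i (Suc i)) w) \<longleftrightarrow> adj i w"
proof -
  have "{transpose i (Suc i) a, transpose i (Suc i) b} = {i, Suc i} \<longleftrightarrow> {a, b} = {i, Suc i}" for a b
    by (auto simp: transpose_def doubleton_eq_iff split: if_splits)
  then have "Suc j < length w \<and> {map (transpose i (Suc i)) w ! j, map (transpose i (Suc i)) w ! Suc j} = {i, Suc i} \<longleftrightarrow>
      Suc j < length w \<and> {w ! j, w ! Suc j} = {i, Suc i}" for j
    by (cases "Suc j < length w") simp_all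
  then show ?thesis unfolding adj_def length_map by blast
qed

lemma vswap_vswap: "vswap i (vswap i w) = w"
  by (simp add: vswap_def adj_map)

lemma Des_vswap: "distinct w \<Longrightarrow> Des (vswap i w) = Des w"
proof -
  assume d: "distinct w"
  have "transpose i (Suc i) (w ! j) < transpose i (Suc i) (w ! (j - 1)) \<longleftrightarrow> w ! j < w ! (j - 1)"
    if "\<not> adj i w" "0 < j" "j < length w" for j
  proof -
    have "{w ! (j - 1), w ! j} \<noteq> {i, Suc i}"
    proof
      assume "{w ! (j - 1), w ! j} = {i, Suc i}"
      then have "adj i w" unfolding adj_def using that by (intro exI[of _ "j - 1"]) simp
      then show False using that by simp
    qed
    moreover have "w ! j \<noteq> w ! (j - 1)" using d that by (simp add: nth_eq_iff_index_eq)
    ultimately show ?thesis by (auto simp: transpose_def doubleton_eq_iff)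
  qed
  then show ?thesis by (auto simp: vswap_def Des_def)
qed

lemma vswap_perm_words:
  assumes "Suc i < d" "w \<in> perm_words {..<d} S" shows "vswap i w \<in> perm_words {..<d} S"
proof -
  have "transpose i (Suc i) permutes {..<d}" using assms by (intro permutes_swap_id) auto
  then have "transpose i (Suc i) ` {..<d} = {..<d}" by (rule permutes_image)
  then show ?thesis using assms Des_vswap[of w i]
    by (auto simp: perm_words_def vswap_def distinct_map intro: inj_on_subset[OF inj_transpose])
qed

text \<open>Nothing stands between the two letters, so \<open>c\<close> is on the same side of both;
  hence \<open>vswap\<close> may leave such words unchanged.\<close>

lemma before_adj:
  assumes "distinct w" "adj i w" "c \<noteq> i" "c \<noteq> Suc i"
  shows "before i c w \<longleftrightarrow> before (Suc i) c w" "before c i w \<longleftrightarrow> before c (Suc i) w"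
proof -
  obtain j where j: "Suc j < length w" "{w ! j, w ! Suc j} = {i, Suc i}" using assms(2) by (auto simp: adj_def)
  have w: "w = take j w @ w ! j # w ! Suc j # drop (Suc (Suc j)) w"
    using j by (metis Cons_nth_drop_Suc Suc_lessD append_take_drop_id)
  obtain p q where pq: "w ! j = p" "w ! Suc j = q" by blast
  then have "(p = i \<and> q = Suc i) \<or> (p = Suc i \<and> q = i)" using j(2) by (auto simp: doubleton_eq_iff)
  moreover obtain u v where uv: "w = u @ p # q # v" using w pq by metis
  moreover have "p \<notin> set u" "q \<notin> set u" "p \<notin> set v" "q \<notin> set v" "p \<noteq> q" using assms(1) uv by auto
  ultimately show "before i c w \<longleftrightarrow> before (Suc i) c w" "before c i w \<longleftrightarrow> before c (Suc i) w"
    using assms(3,4) before_set[of _ _ u] before_set[of _ _ v]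
    by (auto simp: before_append before_Cons)
qed

lemma before_vswap:
  assumes "distinct w" "c \<noteq> i" "c \<noteq> Suc i"
  shows "before i c w \<longleftrightarrow> before (Suc i) c (vswap i w)" "before c i w \<longleftrightarrow> before c (Suc i) (vswap i w)"
  using before_adj[OF assms(1) _ assms(2,3)] before_map[OF inj_transpose[of i "Suc i"], of i c w]
    before_map[OF inj_transpose[of i "Suc i"], of c i w] assms
  by (auto simp: vswap_def transpose_apply_other)

lemma beta_inv_swap:
  assumes "Suc i < d" "c \<noteq> i" "c \<noteq> Suc i"
  shows "beta_inv i c d S = beta_inv (Suc i) c d S" "beta_inv c i d S = beta_inv c (Suc i) d S"
proof -
  have *: "card {w \<in> perm_words {..<d} S. P w} = card {w \<in> perm_words {..<d} S. Q w}"
    if "\<And>w. w \<in> perm_words {..<d} S \<Longrightarrow> P w \<longleftrightarrow> Q (vswap i w)" for P Q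
  proof -
    have "bij_betw (vswap i) {w \<in> perm_words {..<d} S. P w} {w \<in> perm_words {..<d} S. Q w}"
      by (rule bij_betwI[of _ _ _ "vswap i"])
        (use that vswap_perm_words[OF assms(1)] vswap_vswap in auto)
    then show ?thesis by (rule bij_betw_same_card)
  qed
  show "beta_inv i c d S = beta_inv (Suc i) c d S" "beta_inv c i d S = beta_inv c (Suc i) d S"
    unfolding beta_inv_def using before_vswap[OF _ assms(2,3)] by (intro *; simp add: perm_words_def)+
qed

text \<open>Two swaps of neighbouring values lead from the pair (i + 1, i) to (i + 2, i) and on to
  (i + 2, i + 1).\<close>

lemma beta_inv_shift: "Suc i < d \<Longrightarrow> beta_inv (Suc i) i d S = beta_inv 1 0 d S"
proof (induction i)
  case (Suc i)
  have "beta_inv (Suc i) i d S = beta_inv (Suc (Suc i)) i d S" using Suc by (intro beta_inv_swap(1)) auto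
  also have "\<dots> = beta_inv (Suc (Suc i)) (Suc i) d S" using Suc by (intro beta_inv_swap(2)) auto
  finally show ?case using Suc by simp
qed simp

text \<open>Permutations are sorted by the index \<open>k\<close> of the letter 0. Deleting 0 leaves
  a permutation of \<open>d\<close> letters whose two pieces have prescribed descents, while the
  seam at \<open>k\<close> is free.\<close>

lemma card_insert_zero:
  assumes "\<And>w k. k \<le> d \<Longrightarrow> length w = d \<Longrightarrow> P' (take k (map Suc w) @ 0 # drop k (map Suc w)) \<longleftrightarrow> P w"
  shows "card {p \<in> perm_words {..<Suc d} S. P' p} = (\<Sum>k | k \<le> d \<and> des_split S k. card {w. distinct w \<and> set w = {..<d} \<and>
      P w \<and> Des (take k w) = des_pre S k \<and> Des (drop k w) = des_suf S k})"
proof -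
  let ?K = "{k. k \<le> d \<and> des_split S k}"
  let ?W = "\<lambda>k. {w. distinct w \<and> set w = {..<d} \<and> P w \<and> Des (take k w) = des_pre S k \<and> Des (drop k w) = des_suf S k}"
  let ?f = "\<lambda>(k, w). take k (map Suc w) @ 0 # drop k (map Suc w)"
  have fin: "finite (?W k)" for k
    by (rule finite_subset[OF _ finite_lists_length_eq[of "{..<d}" d]]) (use distinct_card in fastforce)+
  have len: "length w = d" if "w \<in> ?W k" for w k using that distinct_card[of w] by simp
  have key: "?f (k, w) \<in> {p \<in> perm_words {..<Suc d} S. P' p} \<longleftrightarrow> des_split S k \<and> w \<in> ?W k" if k: "k \<le> d" "length w = d" for k w
  proof -
    let ?u = "take k (map Suc w)" and ?v = "drop k (map Suc w)"
    have uv: "set ?u \<union> set ?v = Suc ` set w" by (metis append_take_drop_id set_append set_map)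
    have D: "Des (?u @ 0 # ?v) = S \<longleftrightarrow> des_split S k \<and> Des ?u = des_pre S k \<and> Des ?v = des_suf S k"
      using Des_insert_iff[of ?u ?v 0 S] uv k by auto
    have m: "Des (map Suc z) = Des z" for z by (rule Des_map_strict) simp
    have "distinct (?u @ 0 # ?v) \<longleftrightarrow> distinct w"
    proof -
      have "distinct (?u @ 0 # ?v) \<longleftrightarrow> distinct (0 # map Suc w)"
        by (metis (no_types, lifting) append_take_drop_id distinct.simps(2) distinct_append distinct_union
            mset_eq_imp_distinct_iff mset_append mset.simps(2) union_mset_add_mset_right)
      then show ?thesis by (simp add: distinct_map)
    qed
    moreover have "set (?u @ 0 # ?v) = {..<Suc d} \<longleftrightarrow> set w = {..<d}"
    proof -
      have "set (?u @ 0 # ?v) = insert 0 (Suc ` set w)" using uv by auto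
      moreover have "{..<Suc d} = insert 0 (Suc ` {..<d})" by (rule lessThan_Suc_eq_insert_0)
      moreover have "insert 0 (Suc ` A) = insert 0 (Suc ` B) \<longleftrightarrow> A = B" for A B by auto
      ultimately show ?thesis by simp
    qed
    ultimately show ?thesis using D assms[OF k] m
      by (auto simp: perm_words_def take_map drop_map)
  qed
  have "bij_betw ?f (SIGMA k:?K. ?W k) {p \<in> perm_words {..<Suc d} S. P' p}"
    unfolding bij_betw_def
  proof
    show "inj_on ?f (SIGMA k:?K. ?W k)"
    proof (rule inj_onI, clarify)
      fix k w k' w'
      assume A: "k \<le> d" "k' \<le> d" "distinct w" "set w = {..<d}" "distinct w'" "set w' = {..<d}"
        "take k (map Suc w) @ 0 # drop k (map Suc w) = take k' (map Suc w') @ 0 # drop k' (map Suc w')"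
      have l: "length w = d" "length w' = d" using A distinct_card by fastforce+
      have n: "0 \<notin> set (take j (map Suc z))" for j z using in_set_takeD[of 0 j "map Suc z"] by auto
      have "take k (map Suc w) = take k' (map Suc w') \<and> drop k (map Suc w) = drop k' (map Suc w')"
        using A(7) n by (metis append_Cons_eq_iff in_set_dropD list.set_map imageE nat.distinct(1))
      then have e: "take k (map Suc w) = take k' (map Suc w')" "drop k (map Suc w) = drop k' (map Suc w')" by auto
      have "map Suc w = map Suc w'"
        using append_take_drop_id[of k "map Suc w"] append_take_drop_id[of k' "map Suc w'"] unfolding e by simp
      moreover have "k = k'" using arg_cong[OF e(1), of length] l A(1,2) by simp
      ultimately show "k = k' \<and> w = w'" by (simp add: inj_map_eq_map)
    qed
    show "?f ` (SIGMA k:?K. ?W k) = {p \<in> perm_words {..<Suc d} S. P' p}"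
    proof (intro equalityI subsetI)
      fix p assume "p \<in> ?f ` (SIGMA k:?K. ?W k)"
      then obtain k w where kw: "k \<in> ?K" "w \<in> ?W k" "p = ?f (k, w)" by blast
      then show "p \<in> {p \<in> perm_words {..<Suc d} S. P' p}" using key[of k w] len[OF kw(2)] by blast
    next
      fix p assume p: "p \<in> {p \<in> perm_words {..<Suc d} S. P' p}"
      then have ps: "distinct p" "set p = {..<Suc d}" by (auto simp: perm_words_def)
      then obtain u v where uv: "p = u @ 0 # v" using split_list[of 0 p] by auto
      have n0: "0 \<notin> set u" "0 \<notin> set v" using ps uv by auto
      let ?w = "map (\<lambda>i. i - 1) (u @ v)"
      have S: "map Suc ?w = u @ v" using n0 by (auto intro!: map_idI simp: comp_def) (metis Suc_pred not_gr_zero)+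
      have lp: "length p = Suc d" using ps distinct_card by fastforce
      have "p = ?f (length u, ?w)" using S uv by simp
      moreover have "length u \<le> d" "length ?w = d" using lp uv by auto
      ultimately show "p \<in> ?f ` (SIGMA k:?K. ?W k)"
        using key[of "length u" ?w] p by (intro image_eqI[of _ _ "(length u, ?w)"]) auto
    qed
  qed
  then have "card {p \<in> perm_words {..<Suc d} S. P' p} = card (SIGMA k:?K. ?W k)" by (simp add: bij_betw_same_card)
  also have "\<dots> = (\<Sum>k\<in>?K. card (?W k))" using fin by (intro card_SigmaI) auto
  finally show ?thesis .
qed

text \<open>\<open>I\<close> is the set of letters before 0 other than 1, so 0 has index
  \<open>card I + 1\<close>. Sorting by the set \<open>I\<close> rather than by its size prepares
  the comparison with the flats spanned by subsets of a basis.\<close>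

lemma beta_inv_le:
  "beta_inv 1 0 d S \<le> (\<Sum>I | I \<subseteq> {2..<d} \<and> des_split S (card I + 1).
     beta (card I + 1) (des_pre S (card I + 1)) * beta (d - 2 - card I) (des_suf S (card I + 1)))"
proof -
  let ?\<I> = "{I. I \<subseteq> {2..<d} \<and> des_split S (card I + 1)}"
  let ?B = "\<lambda>I. perm_words (insert 1 I) (des_pre S (card I + 1)) \<times> perm_words ({2..<d} - I) (des_suf S (card I + 1))"
  let ?g = "\<lambda>p. (set (takeWhile ((\<noteq>) 0) p) - {1}, takeWhile ((\<noteq>) 0) p, tl (dropWhile ((\<noteq>) 0) p))"
  have tw: "takeWhile ((\<noteq>) 0) (u @ 0 # v) = u" "dropWhile ((\<noteq>) 0) (u @ 0 # v) = 0 # v" if "0 \<notin> set u" for u v :: "nat list"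
    using that by (auto simp: takeWhile_append dropWhile_append)
  have "card {w \<in> perm_words {..<d} S. before 1 0 w} \<le> card (Sigma ?\<I> ?B)"
  proof (rule card_inj_on_le[of ?g])
    have split: "\<exists>u v. p = u @ 0 # v \<and> 0 \<notin> set u \<and> 0 \<notin> set v \<and> 1 \<in> set u"
      if p: "p \<in> perm_words {..<d} S" "before 1 0 p" for p
    proof -
      have "0 \<in> set p" using before_set[OF p(2)] by simp
      then obtain u v where uv: "p = u @ 0 # v" using split_list by metis
      have "distinct p" using p by (simp add: perm_words_def)
      then have n: "0 \<notin> set u" "0 \<notin> set v" using uv by auto
      then have "1 \<in> set u" using p(2) before_set[of 1 0 u] before_set[of 1 0 v]
        by (auto simp: uv before_append before_Cons)
      then show ?thesis using uv n by blast
    qed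
    show "inj_on ?g {w \<in> perm_words {..<d} S. before 1 0 w}"
    proof (rule inj_onI)
      fix p p' assume A: "p \<in> {w \<in> perm_words {..<d} S. before 1 0 w}" "p' \<in> {w \<in> perm_words {..<d} S. before 1 0 w}" "?g p = ?g p'"
      obtain u v u' v' where "p = u @ 0 # v" "0 \<notin> set u" "p' = u' @ 0 # v'" "0 \<notin> set u'"
        using split[of p] split[of p'] A by blast
      then show "p = p'" using A(3) tw by auto
    qed
    show "?g ` {w \<in> perm_words {..<d} S. before 1 0 w} \<subseteq> Sigma ?\<I> ?B"
    proof (rule image_subsetI)
      fix p assume p: "p \<in> {w \<in> perm_words {..<d} S. before 1 0 w}"
      obtain u v where uv: "p = u @ 0 # v" "0 \<notin> set u" "0 \<notin> set v" "1 \<in> set u" using split[of p] p by blast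
      have ps: "distinct p" "set p = {..<d}" "Des p = S" using p by (auto simp: perm_words_def)
      define I where "I = set u - {1}"
      have "card I + 1 = card (set u)" using card.remove[OF finite_set uv(4)] by (simp add: I_def)
      moreover have "card (set u) = length u" using ps(1) uv by (simp add: distinct_card)
      ultimately have cI: "card I + 1 = length u" by simp
      have D: "des_split S (length u) \<and> Des u = des_pre S (length u) \<and> Des v = des_suf S (length u)"
      proof -
        have pos: "0 < e" if "e \<in> set u \<union> set v" for e using that uv(2,3) by (cases e) auto
        show ?thesis using Des_insert_iff[OF pos, of u v S] ps(3) uv(1) by simp
      qed
      have su: "set u = insert 1 I" using uv(4) by (auto simp: I_def)
      have dj: "set u \<inter> set v = {}" "distinct u" "distinct v" using ps(1) uv by auto
      have all: "insert 0 (set u \<union> set v) = {..<d}" using ps(2) uv by auto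
      have I2: "I \<subseteq> {2..<d}"
      proof
        fix i assume i: "i \<in> I"
        then have "i \<in> insert 0 (set u \<union> set v)" "i \<noteq> 1" by (auto simp: I_def)
        moreover have "i \<noteq> 0" using i uv(2) unfolding I_def by (metis DiffD1)
        ultimately have "i < d" "i \<noteq> 0" "i \<noteq> 1" unfolding all by simp_all
        then show "i \<in> {2..<d}" by auto
      qed
      have sv: "set v = {2..<d} - I"
      proof (intro equalityI subsetI)
        fix i assume i: "i \<in> set v"
        then have "i \<in> insert 0 (set u \<union> set v)" "i \<noteq> 1" "i \<notin> set u" using uv(4) dj(1) by auto
        moreover have "i \<noteq> 0" using i uv(3) by metis
        ultimately have "i < d" "i \<noteq> 0" "i \<noteq> 1" "i \<notin> set u" unfolding all by simp_all
        then show "i \<in> {2..<d} - I" by (auto simp: I_def)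
      next
        fix i assume i: "i \<in> {2..<d} - I"
        then have "i \<in> insert 0 (set u \<union> set v)" unfolding all by simp
        then show "i \<in> set v" using i su by auto
      qed
      have gp: "?g p = (I, u, v)" using tw[OF uv(2)] uv(1) by (simp add: I_def)
      have "(I, u, v) \<in> Sigma ?\<I> ?B" using D cI I2 su sv dj by (simp add: perm_words_def)
      then show "?g p \<in> Sigma ?\<I> ?B" unfolding gp .
    qed
    show "finite (Sigma ?\<I> ?B)"
      by (intro finite_SigmaI finite_cartesian_product finite_perm_words) (auto intro: finite_subset)
  qed
  also have "card (Sigma ?\<I> ?B) = (\<Sum>I\<in>?\<I>. card (?B I))"
    by (intro card_SigmaI ballI finite_cartesian_product finite_perm_words) (auto intro: finite_subset)
  also have "\<dots> = (\<Sum>I\<in>?\<I>. beta (card I + 1) (des_pre S (card I + 1)) * beta (d - 2 - card I) (des_suf S (card I + 1)))"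
  proof (rule sum.cong[OF refl])
    fix I assume I: "I \<in> ?\<I>"
    then have fI: "finite I" "1 \<notin> I" by (auto intro: finite_subset)
    have "card ({2..<d} - I) = d - 2 - card I" using I fI by (subst card_Diff_subset) auto
    then show "card (?B I) = beta (card I + 1) (des_pre S (card I + 1)) * beta (d - 2 - card I) (des_suf S (card I + 1))"
      using fI by (simp add: card_cartesian_product card_perm_words)
  qed
  finally show ?thesis by (simp add: beta_inv_def)
qed

section \<open>The lower bound\<close>

text \<open>Prescribing the descents on both sides of the cut leaves open whether \<open>k\<close>
  itself is a descent, so at most two sets \<open>D\<close> occur. The same sums over
  \<open>D\<close> arise for good words and for permutations, which allows a comparison term by
  term.\<close>

lemma card_by_Des:
  assumes "finite W" "\<And>w. w \<in> W \<Longrightarrow> Des w \<subseteq> {1..<d}"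
  shows "card {w \<in> W. Des (take k w) = A \<and> Des (drop k w) = B} =
    (\<Sum>D | D \<subseteq> {1..<d} \<and> {s \<in> D. s < k} = A \<and> {s. 0 < s \<and> s + k \<in> D} = B. card {w \<in> W. Des w = D})"
proof -
  let ?\<D> = "{D. D \<subseteq> {1..<d} \<and> {s \<in> D. s < k} = A \<and> {s. 0 < s \<and> s + k \<in> D} = B}"
  have "{w \<in> W. Des (take k w) = A \<and> Des (drop k w) = B} = (\<Union>D\<in>?\<D>. {w \<in> W. Des w = D})"
    unfolding Des_take Des_drop using assms(2) by blast
  moreover have "finite ?\<D>" by (rule finite_subset[of _ "Pow {1..<d}"]) auto
  ultimately show ?thesis using assms(1) by (simp only:) (subst card_UN_disjoint, auto)
qed

context ranked_closure
begin

section \<open>Cutting and joining label words\<close>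

lemma word_flat_take_append:
  assumes "flat x" "set u \<subseteq> E" "set v \<subseteq> E"
  shows "word_flat x (take (length u + i) (u @ v)) = word_flat (word_flat x u) (take i v)"
proof -
  have "set (take i v) \<subseteq> E" using assms(3) set_take_subset[of i v] by blast
  then show ?thesis using word_flat_append[OF assms(1,2)] by simp
qed

lemma good_append:
  assumes x: "flat x" shows "good x (u @ v) \<longleftrightarrow> good x u \<and> good (word_flat x u) v"
proof (cases "indep x (u @ v)")
  case False
  then show ?thesis using indep_append[OF x] by (auto simp: good_def)
next
  case True
  then have E: "set u \<subseteq> E" "set v \<subseteq> E" using indep_E by fastforce+
  have ind: "indep x u" "indep (word_flat x u) v" using True indep_append[OF x] by auto
  let ?P = "\<lambda>i. (u @ v) ! i = Min (word_flat x (take (Suc i) (u @ v)) - word_flat x (take i (u @ v)))"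
  have 1: "?P i \<longleftrightarrow> u ! i = Min (word_flat x (take (Suc i) u) - word_flat x (take i u))" if "i < length u" for i
    using that by (simp add: nth_append)
  have 2: "?P (length u + i) \<longleftrightarrow> v ! i = Min (word_flat (word_flat x u) (take (Suc i) v) - word_flat (word_flat x u) (take i v))" for i
    using word_flat_take_append[OF x E, of i] word_flat_take_append[OF x E, of "Suc i"] by (simp add: nth_append)
  have "(\<forall>i<length (u @ v). ?P i) \<longleftrightarrow> (\<forall>i<length u. ?P i) \<and> (\<forall>i<length v. ?P (length u + i))"
  proof (intro iffI conjI allI impI)
    fix i assume A: "(\<forall>i<length u. ?P i) \<and> (\<forall>i<length v. ?P (length u + i))" and i: "i < length (u @ v)"
    show "?P i"
    proof (cases "i < length u")
      case False
      then obtain j where "i = length u + j" by (metis le_add_diff_inverse not_less)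
      then show ?thesis using A i by (metis length_append nat_add_left_cancel_less)
    qed (use A in blast)
  next
    fix i assume A: "\<forall>i<length (u @ v). ?P i" and i: "i < length v"
    show "?P (length u + i)" using A i by (metis length_append nat_add_left_cancel_less)
  next
    fix i assume A: "\<forall>i<length (u @ v). ?P i" and i: "i < length u"
    show "?P i" using A i by (metis length_append trans_less_add1)
  qed
  then show ?thesis unfolding good_def using True ind 1 2 by simp
qed

lemma good_notin: "flat x \<Longrightarrow> good x w \<Longrightarrow> set w \<inter> x = {}"
proof -
  assume x: "flat x" and g: "good x w"
  have "w ! i \<notin> x" if "i < length w" for i
    using indep_nth[OF x good_indep[OF g] that] word_flat_sub[OF x indep_take_E[OF good_indep[OF g]]] by blast
  then show ?thesis by (auto simp: in_set_conv_nth)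
qed

lemma good_single:
  assumes "flat z" "a \<in> E - z" "\<And>e. e \<in> E - z \<Longrightarrow> a \<le> e"
  shows "good z [a]"
proof -
  have aE: "a \<in> E" "a \<notin> z" using assms by auto
  have "Min (cl (insert a z) - z) = a"
  proof (rule Min_eqI)
    show "finite (cl (insert a z) - z)" using flat_fin[OF flat_insert[OF assms(1) aE(1)]] by simp
    show "a \<in> cl (insert a z) - z" using in_cl_insert[OF assms(1) aE(1)] aE by simp
    show "a \<le> e" if "e \<in> cl (insert a z) - z" for e
      using that assms(3) flat_E[OF flat_insert[OF assms(1) aE(1)]] by blast
  qed
  then show ?thesis using assms indep_single[OF assms(1)] by (simp add: good_def word_flat_single)
qed

text \<open>Words cut at \<open>a\<close>: \<open>u\<close> climbs from \<open>x\<close> to a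
  complement \<open>z\<close> of \<open>a\<close> in [x, y], the letter \<open>a\<close> leads from
  \<open>z\<close> to \<open>y\<close>, and \<open>v\<close> climbs on to \<open>E\<close>.
  Minimality of \<open>a\<close> makes it the label of its step. The word determines all data:
  \<open>a\<close> occurs once, \<open>z\<close> is the flat of \<open>u\<close>, and
  \<open>y\<close> is the join of \<open>z\<close> with \<open>a\<close>.\<close>

lemma insert_words_le:
  assumes x: "flat x" and a: "a \<in> E - x" "\<And>e. e \<in> E - x \<Longrightarrow> a \<le> e"
  shows "(\<Sum>y | flat y \<and> cl (insert a x) \<subseteq> y \<and> des_split S (rk y - rk x - 1).
      (\<Sum>z\<in>complements x y a. card (good_words x z (des_pre S (rk y - rk x - 1)))) * card (good_words y E (des_suf S (rk y - rk x - 1))))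
    \<le> card (good_words x E S)"
proof -
  let ?k = "\<lambda>y. rk y - rk x - 1"
  let ?FL = "{y. flat y \<and> cl (insert a x) \<subseteq> y \<and> des_split S (?k y)}"
  let ?O = "SIGMA y:?FL. (SIGMA z:complements x y a. good_words x z (des_pre S (?k y))) \<times> good_words y E (des_suf S (?k y))"
  let ?f = "\<lambda>(y, (z, u), v). u @ a # v"
  have aE: "a \<in> E" "a \<notin> x" using a by auto
  have fin: "finite ?FL" by (rule finite_subset[OF _ finite_flats]) auto
  have key: "word_flat x u = z \<and> y = cl (insert a z) \<and> a \<notin> set u \<and> a \<notin> set v \<and> u @ a # v \<in> good_words x E S"
    if A: "y \<in> ?FL" "z \<in> complements x y a" "u \<in> good_words x z (des_pre S (?k y))" "v \<in> good_words y E (des_suf S (?k y))" for y z u v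
  proof -
    have z: "flat z" "x \<subseteq> z" "z \<subseteq> y" "a \<notin> z" "rk z + 1 = rk y" and u: "good x u" "word_flat x u = z" "Des u = des_pre S (?k y)"
      and v: "good y v" "word_flat y v = E" "Des v = des_suf S (?k y)" and y: "flat y" "cl (insert a x) \<subseteq> y" "des_split S (?k y)"
      using A by (auto simp: complements_def good_words_def)
    have ay: "a \<in> y" using y(2) in_cl_insert[OF x aE(1)] by blast
    have yz: "y = cl (insert a z)" using cl_insert_eq_cover[OF z(1) y(1) z(3) _ ay z(4)] z(5) by simp
    have uE: "set u \<subseteq> E" "set v \<subseteq> E" using good_indep[OF u(1)] good_indep[OF v(1)] indep_E by auto
    have su: "set u \<subseteq> z" using set_sub_word_flat[OF x uE(1)] u(2) by simp
    have au: "a \<notin> set u" using su z(4) by blast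
    have av: "a \<notin> set v" using good_notin[OF y(1) v(1)] ay by blast
    have ga: "good z [a]" using z(2,4) aE a(2) by (intro good_single[OF z(1)]) auto
    have gav: "good z ([a] @ v)" using good_append[OF z(1), of "[a]" v] ga v(1) yz by (simp add: word_flat_single)
    then have g: "good x (u @ a # v)" using good_append[OF x, of u "a # v"] u by simp
    have "word_flat x (u @ a # v) = word_flat z ([a] @ v)" using word_flat_append[OF x uE(1), of "a # v"] u(2) uE aE by simp
    also have "\<dots> = E" using word_flat_append[OF z(1), of "[a]" v] uE aE yz v(2) by (simp add: word_flat_single)
    finally have jE: "word_flat x (u @ a # v) = E" .
    have lu: "length u = ?k y" using indep_length[OF good_indep[OF u(1)] u(2)] z(5) by simp
    have "a < e" if "e \<in> set u \<union> set v" for e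
    proof -
      have "e \<in> E - x" using that uE good_notin[OF x u(1)] good_notin[OF y(1) v(1)] z(2,3) by blast
      then show ?thesis using a(2)[of e] that au av by (cases "a = e") auto
    qed
    then have "Des (u @ a # v) = S" using Des_insert_iff[of u v a S] u v y lu by simp
    then show ?thesis using u yz au av g jE by (simp add: good_words_def)
  qed
  have "card ?O \<le> card (good_words x E S)"
  proof (rule card_inj_on_le[of ?f])
    show "finite (good_words x E S)" by simp
    show "?f ` ?O \<subseteq> good_words x E S" using key by fast
    show "inj_on ?f ?O"
    proof (rule inj_onI)
      fix o1 o2 assume oo: "o1 \<in> ?O" "o2 \<in> ?O" "?f o1 = ?f o2"
      obtain y z u v where 1: "o1 = (y, (z, u), v)" by (metis prod.exhaust)
      obtain y' z' u' v' where 2: "o2 = (y', (z', u'), v')" by (metis prod.exhaust)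
      have p1: "word_flat x u = z \<and> y = cl (insert a z) \<and> a \<notin> set u \<and> a \<notin> set v"
        using key[of y z u v] oo(1) unfolding 1 by blast
      have p2: "word_flat x u' = z' \<and> y' = cl (insert a z') \<and> a \<notin> set u' \<and> a \<notin> set v'"
        using key[of y' z' u' v'] oo(2) unfolding 2 by blast
      have "u @ a # v = u' @ a # v'" using oo(3) 1 2 by simp
      then have "u = u' \<and> v = v'" using append_Cons_eq_iff[of a u v u' v'] p1 p2 by blast
      then show "o1 = o2" using 1 2 p1 p2 by simp
    qed
  qed
  moreover have "card ?O = (\<Sum>y\<in>?FL. (\<Sum>z\<in>complements x y a. card (good_words x z (des_pre S (?k y)))) * card (good_words y E (des_suf S (?k y))))"
    using fin by (simp add: card_SigmaI card_cartesian_product)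
  ultimately show ?thesis by simp
qed

lemma split_words_le:
  assumes "flat c" "k \<le> rk E - rk c"
  shows "card {w. good c w \<and> word_flat c w = E \<and> Des (take k w) = A \<and> Des (drop k w) = B}
    \<le> (\<Sum>y | flat y \<and> c \<subseteq> y \<and> rk y = rk c + k. card (good_words c y A) * card (good_words y E B))"
proof -
  let ?Y = "{y. flat y \<and> c \<subseteq> y \<and> rk y = rk c + k}"
  let ?W = "{w. good c w \<and> word_flat c w = E \<and> Des (take k w) = A \<and> Des (drop k w) = B}"
  have fin: "finite ?Y" by (rule finite_subset[OF _ finite_flats]) auto
  have "card ?W \<le> card (SIGMA y:?Y. good_words c y A \<times> good_words y E B)"
  proof (rule card_inj_on_le[of "\<lambda>w. (word_flat c (take k w), take k w, drop k w)"])
    show "inj_on (\<lambda>w. (word_flat c (take k w), take k w, drop k w)) ?W"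
      by (rule inj_onI) (metis Pair_inject append_take_drop_id)
    show "finite (SIGMA y:?Y. good_words c y A \<times> good_words y E B)" using fin by auto
    show "(\<lambda>w. (word_flat c (take k w), take k w, drop k w)) ` ?W \<subseteq> (SIGMA y:?Y. good_words c y A \<times> good_words y E B)"
    proof (rule image_subsetI)
      fix w assume w: "w \<in> ?W"
      then have g: "good c w" "word_flat c w = E" by auto
      have i: "indep c w" using g good_indep by blast
      have len: "k \<le> length w" using indep_length[OF i g(2)] assms(2) by simp
      have tE: "set (take k w) \<subseteq> E" "set (drop k w) \<subseteq> E"
        using indep_E[OF i] set_take_subset[of k w] set_drop_subset[of k w] by auto
      have "good c (take k w)" "good (word_flat c (take k w)) (drop k w)"
        using good_append[OF assms(1), of "take k w" "drop k w"] g by auto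
      moreover have "word_flat (word_flat c (take k w)) (drop k w) = E" using word_flat_append[OF assms(1) tE] g by simp
      moreover have "flat (word_flat c (take k w))" "c \<subseteq> word_flat c (take k w)" "rk (word_flat c (take k w)) = rk c + k"
        using flat_word_flat[OF assms(1) tE(1)] word_flat_sub[OF assms(1) tE(1)] rk_take[OF assms(1) i len] by auto
      ultimately show "(word_flat c (take k w), take k w, drop k w) \<in> (SIGMA y:?Y. good_words c y A \<times> good_words y E B)"
        using w by (simp add: good_words_def)
    qed
  qed
  also have "\<dots> = (\<Sum>y\<in>?Y. card (good_words c y A) * card (good_words y E B))"
    using fin by (simp add: card_SigmaI card_cartesian_product)
  finally show ?thesis .
qed

text \<open>A basis contributes pairwise different atoms. Thus the coefficient of
  \<open>beta_inv\<close> in the lower bound is nonnegative, and that term may be dropped.\<close>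

lemma cover_card_ge:
  assumes "flat x" shows "rk E - rk x \<le> card (upper_covers x E)"
proof -
  obtain b where b: "indep x b" "word_flat x b = E" "length b = rk E - rk x"
    using indep_exists[OF assms flat_top flat_E[OF assms]] by blast
  have "inj_on (\<lambda>i. cl (x \<union> (!) b ` {i})) {..<length b}"
  proof (rule inj_onI)
    fix i j assume "i \<in> {..<length b}" "j \<in> {..<length b}" "cl (x \<union> (!) b ` {i}) = cl (x \<union> (!) b ` {j})"
    then show "i = j" using indep_cl_subset[OF b(1) assms, of "{i}" "{j}"] by auto
  qed
  moreover have "(\<lambda>i. cl (x \<union> (!) b ` {i})) ` {..<length b} \<subseteq> upper_covers x E"
  proof (rule image_subsetI)
    fix i assume i: "i \<in> {..<length b}"
    have "b ! i \<notin> word_flat x (take i b)" using indep_nth[OF assms b(1)] i by simp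
    then have "b ! i \<notin> x" using word_flat_sub[OF assms indep_take_E[OF b(1)]] by blast
    moreover have "b ! i \<in> E" using i indep_E[OF b(1)] by auto
    ultimately show "cl (x \<union> (!) b ` {i}) \<in> upper_covers x E"
      using cover_insert[OF assms flat_top flat_E[OF assms], of "b ! i"] by simp
  qed
  ultimately have "card {..<length b} \<le> card (upper_covers x E)" by (rule card_inj_on_le) simp
  then show ?thesis using b by simp
qed

lemma rk_cl_indep:
  assumes "flat l" "indep l b" "I \<subseteq> {..<length b}"
  shows "rk (cl (l \<union> (!) b ` I)) = rk l + card I" "flat (cl (l \<union> (!) b ` I))" "l \<subseteq> cl (l \<union> (!) b ` I)"
proof -
  have "finite I" using assms(3) finite_subset by blast
  then obtain js where js: "set js = I" "distinct js" using finite_distinct_list by blast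
  let ?v = "map ((!) b) js"
  have d: "distinct b" by (rule indep_distinct[OF assms(1,2)])
  have "inj_on ((!) b) I" using d assms(3) by (auto simp: inj_on_def nth_eq_iff_index_eq subset_iff)
  then have "distinct ?v" using js by (simp add: distinct_map)
  moreover have "set ?v \<subseteq> set b" using js assms(3) by auto
  ultimately have i: "indep l ?v" using indep_subset[OF assms(2,1)] by blast
  have j: "word_flat l ?v = cl (l \<union> (!) b ` I)" using js by (simp add: word_flat_def)
  have "length ?v = card I" using js distinct_card[of js] by simp
  then show "rk (cl (l \<union> (!) b ` I)) = rk l + card I" using i j by (simp add: indep_def)
  show "flat (cl (l \<union> (!) b ` I))" "l \<subseteq> cl (l \<union> (!) b ` I)"
    using flat_word_flat[OF assms(1) indep_E[OF i]] word_flat_sub[OF assms(1) indep_E[OF i]] j by auto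
qed

text \<open>The induction hypothesis enters twice: in full for the interval above \<open>a\<close>,
  and in the weak form that the count of words is at least \<open>beta\<close> for intervals above
  flats that contain a line through \<open>a\<close>.\<close>

theorem flag_words_lower_bound:
  assumes "flat x"
  shows "int (beta (rk E - rk x) S) + (int (card (upper_covers x E)) - int (rk E - rk x)) * int (beta_inv 1 0 (rk E - rk x) S)
    \<le> int (card (good_words x E S))"
  using assms
proof (induction "rk E - rk x" arbitrary: x S rule: less_induct)
  case less
  note x = less.prems
  show ?case
  proof (cases "x = E")
    case True
    have "perm_words {..<0} S \<subseteq> good_words x E S" using True flat_top
      by (auto simp: perm_words_def good_words_def good_def indep_def)
    then have "beta 0 S \<le> card (good_words x E S)" unfolding beta_def by (intro card_mono) auto
    then show ?thesis using True cover_refl[OF flat_top] by simp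
  next
    case False
    have xE: "x \<subseteq> E" using flat_E[OF x] .
    have "rk x < rk E" using rk_mono[OF x flat_top xE] rk_eq[OF x flat_top xE] False by linarith
    then obtain d where dE: "rk E = rk x + Suc d" by (metis add_Suc_right less_imp_Suc_add)
    define a where "a = Min (E - x)"
    have "E - x \<noteq> {}" using xE False by blast
    then have a: "a \<in> E - x" "\<And>e. e \<in> E - x \<Longrightarrow> a \<le> e"
      unfolding a_def using finE Min_in[of "E - x"] by auto
    have ax: "a \<in> E" "a \<notin> x" using a by auto
    define c where "c = cl (insert a x)"
    have cA: "c \<in> upper_covers x E" unfolding c_def using cover_insert[OF x flat_top xE ax] .
    have cD: "flat c" "x \<subseteq> c" "c \<subseteq> E" "rk c = rk x + 1" "a \<in> c"
      using upper_coversD[OF cA] in_cl_insert[OF x ax(1)] by (auto simp: c_def)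
    have rkE: "rk E = rk c + d" using dE cD by auto
    define k where "k y = rk y - rk x - 1" for y
    define FL where "FL = {y. flat y \<and> c \<subseteq> y \<and> des_split S (k y)}"
    have finFL: "finite FL" unfolding FL_def by (rule finite_subset[OF _ finite_flats]) auto
    define h where "h y = card (good_words y E (des_suf S (k y)))" for y
    \<comment> \<open>The share of the line \<open>l\<close> in the surplus D: its atoms beyond
      \<open>a\<close> and one more.\<close>
    define mm where "mm l = int (card (upper_covers x l)) - 2" for l
    have FLD: "flat y" "c \<subseteq> y" "y \<subseteq> E" "x \<subseteq> y" "a \<in> y" "rk y = rk x + k y + 1" "k y \<le> d" if "y \<in> FL" for y
    proof -
      show y: "flat y" "c \<subseteq> y" using that by (auto simp: FL_def)
      show "y \<subseteq> E" "x \<subseteq> y" "a \<in> y" using y flat_E cD by auto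
      then show "rk y = rk x + k y + 1" "k y \<le> d"
        using rk_mono[OF cD(1) y] rk_mono[OF y(1) flat_top] cD(4) dE by (auto simp: k_def)
    qed
    have part: "int (card (upper_covers x y)) - 1 - int (card (upper_covers c y)) = (\<Sum>l\<in>upper_covers c y. mm l)" if y: "flat y" "c \<subseteq> y" for y
    proof -
      have sx: "upper_covers x c = {c}" using cover_self[OF x cA] .
      have cx: "c \<in> upper_covers x v" if "c \<subseteq> v" for v using cA that by (simp add: upper_covers_def)
      have one: "(\<Sum>t\<in>upper_covers x v - upper_covers x c. 1) = int (card (upper_covers x v)) - 1" if "c \<subseteq> v" for v
        using sx cx[OF that] card.remove[OF finite_upper_covers cx[OF that]] by simp
      have "int (card (upper_covers x y)) - 1 = (\<Sum>v\<in>upper_covers c y. \<Sum>t\<in>upper_covers x v - upper_covers x c. 1)"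
        using cover_partition[OF x cD(1) y(1) cD(2) y(2), of "\<lambda>_. 1::int"] one[OF y(2)] by simp
      also have "\<dots> = (\<Sum>v\<in>upper_covers c y. mm v + 1)" using one upper_coversD(2) by (intro sum.cong) (auto simp: mm_def)
      finally show ?thesis by (simp add: sum.distrib)
    qed
    have mm0: "0 \<le> mm l" if l: "l \<in> upper_covers c E" for l
    proof -
      obtain e where e: "e \<in> l" "e \<notin> c" using cover_obtain[OF cD(1) l] by blast
      have eE: "e \<in> E" "e \<notin> x" using e upper_coversD(1,3)[OF l] flat_E cD(2) by auto
      have xl: "x \<subseteq> l" using cD(2) upper_coversD(2)[OF l] by blast
      have t: "cl (insert e x) \<in> upper_covers x l" using cover_insert[OF x upper_coversD(1)[OF l] xl e(1) eE(2)] .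
      have "c \<in> upper_covers x l" using cA upper_coversD(2)[OF l] by (simp add: upper_covers_def)
      moreover have "cl (insert e x) \<noteq> c" using in_cl_insert[OF x eE(1)] e by auto
      ultimately have "card {c, cl (insert e x)} \<le> card (upper_covers x l)" using t by (intro card_mono) auto
      then show ?thesis using \<open>cl (insert e x) \<noteq> c\<close> by (simp add: mm_def)
    qed
    have "(\<Sum>y\<in>FL. (\<Sum>z\<in>complements x y a. card (good_words x z (des_pre S (k y)))) * h y) \<le> card (good_words x E S)"
      using insert_words_le[OF x a, of S] unfolding FL_def k_def h_def c_def by simp
    then have L: "(\<Sum>y\<in>FL. (\<Sum>z\<in>complements x y a. int (card (good_words x z (des_pre S (k y))))) * int (h y)) \<le> int (card (good_words x E S))"
      by (simp only: of_nat_mult[symmetric] of_nat_sum[symmetric] of_nat_le_iff)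
    have "(\<Sum>y\<in>FL. (int (card (good_words c y (des_pre S (k y)))) + (\<Sum>l\<in>upper_covers c y. mm l) * int (beta (k y) (des_pre S (k y)))) * int (h y))
      \<le> (\<Sum>y\<in>FL. (\<Sum>z\<in>complements x y a. int (card (good_words x z (des_pre S (k y))))) * int (h y))"
    proof (rule sum_mono, rule mult_right_mono)
      fix y assume y: "y \<in> FL"
      note yD = FLD[OF y]
      show "int (card (good_words c y (des_pre S (k y)))) + (\<Sum>l\<in>upper_covers c y. mm l) * int (beta (k y) (des_pre S (k y)))
          \<le> (\<Sum>z\<in>complements x y a. int (card (good_words x z (des_pre S (k y)))))"
        using complement_inequality[OF x yD(1,4,5) ax(2) yD(6), of "des_pre S (k y)"] part[OF yD(1,2)]
        by (simp add: c_def)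
    qed simp
    then have L2: "(\<Sum>y\<in>FL. int (card (good_words c y (des_pre S (k y)))) * int (h y)) +
        (\<Sum>y\<in>FL. (\<Sum>l\<in>upper_covers c y. mm l) * (int (beta (k y) (des_pre S (k y))) * int (h y))) \<le> int (card (good_words x E S))"
      using L by (simp add: distrib_right sum.distrib mult.assoc)
    \<comment> \<open>Contraction part. Cutting at the index of the inserted letter leads to the
      same sums over descent sets for the words of [c, E] and for permutations; raising all letters
      by one turns the pair 1, 0 into 2, 1.\<close>
    have P1: "int (beta (Suc d) S) + (int (card (upper_covers c E)) - int d) * int (beta_inv 2 1 (Suc d) S)
        \<le> (\<Sum>y\<in>FL. int (card (good_words c y (des_pre S (k y)))) * int (h y))"
    proof -
      let ?K = "{j. j \<le> d \<and> des_split S j}"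
      let ?\<D> = "\<lambda>j. {D. D \<subseteq> {1..<d} \<and> {s \<in> D. s < j} = des_pre S j \<and> {s. 0 < s \<and> s + j \<in> D} = des_suf S j}"
      let ?W = "{w. good c w \<and> word_flat c w = E}"
      have finW: "finite ?W" using finite_good_to[of c E "\<lambda>_. True"] by simp
      have lenW: "length w = d" if "w \<in> ?W" for w
        using that indep_length[of c w E] rkE by (auto simp: good_def)
      have "FL = (\<Union>j\<in>?K. {y. flat y \<and> c \<subseteq> y \<and> rk y = rk c + j})"
      proof (intro equalityI subsetI)
        fix y assume y: "y \<in> FL"
        then have "k y \<in> ?K" "rk y = rk c + k y" using FLD[OF y] cD(4) by (auto simp: FL_def)
        then show "y \<in> (\<Union>j\<in>?K. {y. flat y \<and> c \<subseteq> y \<and> rk y = rk c + j})" using FLD[OF y] by auto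
      qed (use cD(4) in \<open>auto simp: FL_def k_def\<close>)
      then have "(\<Sum>y\<in>FL. card (good_words c y (des_pre S (k y))) * h y) =
          (\<Sum>j\<in>?K. \<Sum>y | flat y \<and> c \<subseteq> y \<and> rk y = rk c + j. card (good_words c y (des_pre S (k y))) * h y)"
        by (simp only:) (rule sum.UNION_disjoint, auto intro: finite_subset[OF _ finite_flats])
      also have "\<dots> = (\<Sum>j\<in>?K. \<Sum>y | flat y \<and> c \<subseteq> y \<and> rk y = rk c + j. card (good_words c y (des_pre S j)) * card (good_words y E (des_suf S j)))"
        by (intro sum.cong) (auto simp: k_def h_def cD(4))
      also have "\<dots> \<ge> (\<Sum>j\<in>?K. card {w. good c w \<and> word_flat c w = E \<and> Des (take j w) = des_pre S j \<and> Des (drop j w) = des_suf S j})"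
        using rkE by (intro sum_mono split_words_le[OF cD(1)]) auto
      also have "(\<Sum>j\<in>?K. card {w. good c w \<and> word_flat c w = E \<and> Des (take j w) = des_pre S j \<and> Des (drop j w) = des_suf S j}) =
          (\<Sum>j\<in>?K. \<Sum>D\<in>?\<D> j. card (good_words c E D))"
      proof (rule sum.cong[OF refl])
        fix j
        have "Des w \<subseteq> {1..<d}" if "w \<in> ?W" for w using lenW[OF that] by (auto simp: Des_def)
        from card_by_Des[OF finW this, of j "des_pre S j" "des_suf S j"]
        show "card {w. good c w \<and> word_flat c w = E \<and> Des (take j w) = des_pre S j \<and> Des (drop j w) = des_suf S j} =
            (\<Sum>D\<in>?\<D> j. card (good_words c E D))" by (simp add: good_words_def conj_assoc)
      qed
      finally have A: "(\<Sum>j\<in>?K. \<Sum>D\<in>?\<D> j. int (card (good_words c E D))) \<le> (\<Sum>y\<in>FL. int (card (good_words c y (des_pre S (k y)))) * int (h y))"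
        by (simp only: of_nat_mult[symmetric] of_nat_sum[symmetric] of_nat_le_iff)
      have B: "(\<Sum>j\<in>?K. \<Sum>D\<in>?\<D> j. int (beta d D) + (int (card (upper_covers c E)) - int d) * int (beta_inv 1 0 d D))
          \<le> (\<Sum>j\<in>?K. \<Sum>D\<in>?\<D> j. int (card (good_words c E D)))"
        using less.hyps[OF _ cD(1)] rkE dE by (intro sum_mono) simp
      let ?V = "\<lambda>P. {w. distinct w \<and> set w = {..<d} \<and> P w}"
      have V: "card {w. distinct w \<and> set w = {..<d} \<and> P w \<and> Des (take j w) = des_pre S j \<and> Des (drop j w) = des_suf S j} =
          (\<Sum>D\<in>?\<D> j. card {w \<in> perm_words {..<d} D. P w})" for j P
      proof -
        have fV: "finite (?V P)"
          by (rule finite_subset[OF _ finite_lists_length_eq[of "{..<d}" d]]) (use distinct_card in fastforce)+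
        have "Des w \<subseteq> {1..<d}" if "w \<in> ?V P" for w
        proof -
          have "length w = d" using that distinct_card[of w] by simp
          then show ?thesis by (auto simp: Des_def)
        qed
        from card_by_Des[OF fV this, of j "des_pre S j" "des_suf S j"]
        show ?thesis by (simp add: perm_words_def conj_ac)
      qed
      have b: "beta (Suc d) S = (\<Sum>j\<in>?K. \<Sum>D\<in>?\<D> j. beta d D)"
        using card_insert_zero[of d "\<lambda>_. True" "\<lambda>_. True" S] V[of "\<lambda>_. True"] by (simp add: beta_def)
      have "before 2 1 (take j (map Suc w) @ 0 # drop j (map Suc w)) \<longleftrightarrow> before 1 0 w" for j w
      proof -
        have "before 1 0 w \<longleftrightarrow> before 2 1 (map Suc w)"
          using before_map[of Suc 1 0 w] by (simp add: numeral_2_eq_2)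
        also have "\<dots> \<longleftrightarrow> before 2 1 (take j (map Suc w) @ drop j (map Suc w))" by simp
        finally show ?thesis by (simp only: before_append before_Cons) auto
      qed
      then have cc: "beta_inv 2 1 (Suc d) S = (\<Sum>j\<in>?K. \<Sum>D\<in>?\<D> j. beta_inv 1 0 d D)"
        using card_insert_zero[of d "before 2 1" "before 1 0" S] V[of "before 1 0"] by (simp add: beta_inv_def)
      show ?thesis using A B unfolding b cc
        by (simp add: sum.distrib sum_distrib_left[symmetric])
    qed
    \<comment> \<open>Surplus part. After the sums are exchanged, it remains that for each line
      \<open>l\<close> the flats above \<open>l\<close> contribute at least
      \<open>beta_inv 1 0 (Suc d) S\<close>.\<close>
    have P2: "(\<Sum>l\<in>upper_covers c E. mm l) * int (beta_inv 1 0 (Suc d) S)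
        \<le> (\<Sum>y\<in>FL. (\<Sum>l\<in>upper_covers c y. mm l) * (int (beta (k y) (des_pre S (k y))) * int (h y)))"
    proof -
      define g where "g y = beta (k y) (des_pre S (k y)) * h y" for y
      have Q: "beta_inv 1 0 (Suc d) S \<le> (\<Sum>y\<in>{y \<in> FL. l \<subseteq> y}. g y)" if l: "l \<in> upper_covers c E" for l
      proof -
        note lD = upper_coversD[OF l]
        have rl: "rk l = rk x + 2" using lD(4) cD(4) by simp
        obtain b where b: "indep l b" "word_flat l b = E" "length b = rk E - rk l"
          using indep_exists[OF lD(1) flat_top lD(3)] by blast
        have lb: "Suc d = length b + 2" using b(3) dE rl rk_mono[OF lD(1) flat_top lD(3)] by simp
        let ?I = "{I. I \<subseteq> {2..<Suc d} \<and> des_split S (card I + 1)}"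
        \<comment> \<open>The letters from 2 to \<open>d\<close> index the elements of a basis over
          \<open>l\<close>; the letters 0 and 1 stand for the two ranks between \<open>x\<close> and
          \<open>l\<close>.\<close>
        define s where "s I = (\<lambda>i::nat. i - 2) ` I" for I
        define Y where "Y I = cl (l \<union> (!) b ` s I)" for I
        have s: "s I \<subseteq> {..<length b}" "card (s I) = card I" "I = (\<lambda>i. i + 2) ` s I" if "I \<subseteq> {2..<Suc d}" for I
        proof -
          show "s I \<subseteq> {..<length b}" using that lb by (force simp: s_def)
          have ge2: "i - 2 + 2 = i" if "i \<in> I" for i
          proof -
            have "2 \<le> i" using that \<open>I \<subseteq> {2..<Suc d}\<close> by auto
            then show ?thesis by simp
          qed
          then have "inj_on (\<lambda>i::nat. i - 2) I" by (intro inj_on_inverseI[of _ "\<lambda>i. i + 2"])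
          then show "card (s I) = card I" by (simp add: s_def card_image)
          have "(\<lambda>i. i + 2) ` s I = (\<lambda>i. i - 2 + 2) ` I" unfolding s_def image_image ..
          also have "\<dots> = (\<lambda>i. i) ` I" by (rule image_cong[OF refl]) (rule ge2)
          finally show "I = (\<lambda>i. i + 2) ` s I" by simp
        qed
        have YD: "rk (Y I) = rk l + card I" "flat (Y I)" "l \<subseteq> Y I" if "I \<subseteq> {2..<Suc d}" for I
          using rk_cl_indep[OF lD(1) b(1) s(1)[OF that]] s(2)[OF that] by (auto simp: Y_def)
        have kY: "k (Y I) = card I + 1" if "I \<subseteq> {2..<Suc d}" for I using YD[OF that] rl by (simp add: k_def)
        have inj: "inj_on Y ?I"
        proof (rule inj_onI)
          fix I J assume A: "I \<in> ?I" "J \<in> ?I" "Y I = Y J"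
          then have IJ: "I \<subseteq> {2..<Suc d}" "J \<subseteq> {2..<Suc d}" by auto
          have "s I = s J"
            using indep_cl_subset[OF b(1) lD(1) s(1)[OF IJ(1)] s(1)[OF IJ(2)]]
              indep_cl_subset[OF b(1) lD(1) s(1)[OF IJ(2)] s(1)[OF IJ(1)]] A(3) by (auto simp: Y_def)
          then show "I = J" using s(3)[OF IJ(1)] s(3)[OF IJ(2)] by simp
        qed
        have "beta_inv 1 0 (Suc d) S \<le> (\<Sum>I\<in>?I. beta (card I + 1) (des_pre S (card I + 1)) * beta (Suc d - 2 - card I) (des_suf S (card I + 1)))"
          by (rule beta_inv_le)
        also have "\<dots> \<le> (\<Sum>I\<in>?I. g (Y I))"
        proof (rule sum_mono)
          fix I assume I: "I \<in> ?I"
          then have I2: "I \<subseteq> {2..<Suc d}" by simp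
          have rY: "rk E - rk (Y I) = Suc d - 2 - card I" using YD(1)[OF I2] rl dE by simp
          have "rk E - rk (Y I) < rk E - rk x" using YD(1)[OF I2] rl dE by simp
          from less.hyps[OF this YD(2)[OF I2], of "des_suf S (card I + 1)"]
          have "int (beta (Suc d - 2 - card I) (des_suf S (card I + 1))) \<le> int (h (Y I))"
            unfolding h_def kY[OF I2] rY using cover_card_ge[OF YD(2)[OF I2]] rY
            by (smt (verit, best) mult_nonneg_nonneg of_nat_0_le_iff of_nat_mono)
          then show "beta (card I + 1) (des_pre S (card I + 1)) * beta (Suc d - 2 - card I) (des_suf S (card I + 1)) \<le> g (Y I)"
            unfolding g_def kY[OF I2] by simp
        qed
        also have "\<dots> = (\<Sum>y\<in>Y ` ?I. g y)"
          using sum.reindex[OF inj, of g] by (simp only: comp_def)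
        also have "\<dots> \<le> (\<Sum>y\<in>{y \<in> FL. l \<subseteq> y}. g y)"
        proof (rule sum_mono2)
          show "finite {y \<in> FL. l \<subseteq> y}" using finFL by simp
          show "Y ` ?I \<subseteq> {y \<in> FL. l \<subseteq> y}"
          proof (rule image_subsetI)
            fix I assume "I \<in> ?I"
            then show "Y I \<in> {y \<in> FL. l \<subseteq> y}"
              using YD[of I] kY[of I] subset_trans[OF lD(2), of "Y I"] by (simp add: FL_def)
          qed
        qed simp
        finally show ?thesis .
      qed
      have "(\<Sum>y\<in>FL. (\<Sum>l\<in>upper_covers c y. mm l) * int (g y)) = (\<Sum>y\<in>FL. \<Sum>l\<in>{l \<in> upper_covers c E. l \<subseteq> y}. mm l * int (g y))"
      proof (rule sum.cong[OF refl])
        fix y assume y: "y \<in> FL"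
        have "upper_covers c y = {l \<in> upper_covers c E. l \<subseteq> y}" using FLD(3)[OF y] by (auto simp: upper_covers_def)
        then show "(\<Sum>l\<in>upper_covers c y. mm l) * int (g y) = (\<Sum>l\<in>{l \<in> upper_covers c E. l \<subseteq> y}. mm l * int (g y))"
          by (simp add: sum_distrib_right)
      qed
      also have "\<dots> = (\<Sum>l\<in>upper_covers c E. \<Sum>y\<in>{y \<in> FL. l \<subseteq> y}. mm l * int (g y))"
        using finFL by (intro sum.swap_restrict) auto
      also have "\<dots> = (\<Sum>l\<in>upper_covers c E. mm l * (\<Sum>y\<in>{y \<in> FL. l \<subseteq> y}. int (g y)))"
        by (simp add: sum_distrib_left)
      also have "\<dots> \<ge> (\<Sum>l\<in>upper_covers c E. mm l * int (beta_inv 1 0 (Suc d) S))"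
        using Q mm0 by (intro sum_mono mult_left_mono) (auto simp flip: of_nat_sum)
      finally show ?thesis by (simp add: g_def sum_distrib_right)
    qed
    have n: "(\<Sum>l\<in>upper_covers c E. mm l) = int (card (upper_covers x E)) - 1 - int (card (upper_covers c E))"
      using part[OF flat_top cD(3)] by simp
    \<comment> \<open>For \<open>d \<le> 1\<close> there is no letter 2, but then the interval above
      \<open>c\<close> has exactly \<open>d\<close> atoms and the factor is 0.\<close>
    have eq: "(int (card (upper_covers c E)) - int d) * int (beta_inv 2 1 (Suc d) S) = (int (card (upper_covers c E)) - int d) * int (beta_inv 1 0 (Suc d) S)"
    proof -
      consider "d = 0" | "d = 1" | "2 \<le> d" by linarith
      then show ?thesis
      proof cases
        case 1
        then have "c = E" using rk_eq[OF cD(1) flat_top cD(3)] rkE by simp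
        then show ?thesis using 1 cover_refl[OF flat_top] by simp
      next
        case 2
        have "upper_covers c E = {E}"
        proof (intro equalityI subsetI)
          fix u assume "u \<in> upper_covers c E"
          then show "u \<in> {E}" using rk_eq[of u E] flat_top rkE 2 by (simp add: upper_covers_def)
        next
          fix u assume "u \<in> {E}"
          then show "u \<in> upper_covers c E" using flat_top cD(3) rkE 2 by (simp add: upper_covers_def)
        qed
        then show ?thesis using 2 by simp
      next
        case 3
        then show ?thesis using beta_inv_shift[of 1 "Suc d" S] by (simp add: numeral_2_eq_2)
      qed
    qed
    have "rk E - rk x = Suc d" using dE by simp
    then show ?thesis using L2 P1 P2 unfolding n eq by (simp add: algebra_simps)
  qed
qed


section \<open>Flag numbers and good words\<close>

text \<open>Comparable flats of equal rank coincide, so a chain with rank set \<open>T\<close> has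
  one member for each rank and amounts to a function on \<open>T\<close>. The abstract poset
  \<open>P\<close> covers both the given lattice and the near pencil.\<close>

lemma card_chains:
  assumes bij: "bij_betw \<phi> P {F. flat F}"
    and ord: "\<And>p q. p \<in> P \<Longrightarrow> q \<in> P \<Longrightarrow> le p q \<longleftrightarrow> \<phi> p \<subseteq> \<phi> q"
    and ht: "\<And>p. p \<in> P \<Longrightarrow> height P le p = rk (\<phi> p)"
  shows "flag_f P le T = card (flag_chains (cl {}) E T)"
proof -
  let ?C = "{C. is_chain P le C \<and> height P le ` C = T}" and ?B = "flag_chains (cl {}) E T"
  define \<psi> where "\<psi> = inv_into P \<phi>"
  have \<psi>: "\<psi> F \<in> P" "\<phi> (\<psi> F) = F" if "flat F" for F
    using that bij by (auto simp: \<psi>_def bij_betw_def inv_into_into f_inv_into_f)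
  have \<phi>: "flat (\<phi> p)" "\<psi> (\<phi> p) = p" if "p \<in> P" for p
    using that bij by (auto simp: \<psi>_def bij_betw_def)
  define G where "G u = \<psi> ` u ` T" for u :: "nat \<Rightarrow> nat set"
  have BD: "\<And>t. t \<in> T \<Longrightarrow> flat (u t) \<and> rk (u t) = t"
    "\<And>s t. s \<in> T \<Longrightarrow> t \<in> T \<Longrightarrow> s \<le> t \<Longrightarrow> u s \<subseteq> u t" "u \<in> extensional T" if "u \<in> ?B" for u
    using that rk_bot by (auto simp: flag_chains_def PiE_def)
  have "bij_betw G ?B ?C"
    unfolding bij_betw_def
  proof
    show "inj_on G ?B"
    proof (rule inj_onI)
      fix u u' assume u: "u \<in> ?B" "u' \<in> ?B" "G u = G u'"
      have im: "\<phi> ` G u = u ` T" if "u \<in> ?B" for u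
        unfolding G_def image_image using \<psi>(2) BD(1)[OF that] by (intro image_cong) auto
      have e: "u ` T = u' ` T" using im[OF u(1)] im[OF u(2)] u(3) by simp
      show "u = u'"
      proof (rule extensionalityI[OF BD(3)[OF u(1)] BD(3)[OF u(2)]])
        fix t assume t: "t \<in> T"
        then obtain s where s: "s \<in> T" "u t = u' s" using e by blast
        have "s = t" using BD(1)[OF u(1) t] BD(1)[OF u(2) s(1)] s(2) by simp
        then show "u t = u' t" using s by simp
      qed
    qed
    show "G ` ?B = ?C"
    proof (intro equalityI subsetI)
      fix C assume "C \<in> G ` ?B"
      then obtain u where u: "u \<in> ?B" "C = G u" by blast
      have GP: "\<psi> (u t) \<in> P" "\<phi> (\<psi> (u t)) = u t" "height P le (\<psi> (u t)) = t" if "t \<in> T" for t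
        using BD(1)[OF u(1) that] \<psi> ht by auto
      have "is_chain P le C" unfolding is_chain_def
      proof (intro conjI ballI)
        show "C \<subseteq> P" using u(2) GP(1) by (auto simp: G_def)
        fix p q assume "p \<in> C" "q \<in> C"
        then obtain s t where st: "s \<in> T" "t \<in> T" "p = \<psi> (u s)" "q = \<psi> (u t)" using u(2) by (auto simp: G_def)
        then show "le p q \<or> le q p"
          using ord[OF GP(1)[OF st(1)] GP(1)[OF st(2)]] ord[OF GP(1)[OF st(2)] GP(1)[OF st(1)]]
            GP(2) BD(2)[OF u(1)] by (metis nat_le_linear)
      qed
      moreover have "height P le ` C = T"
        unfolding u(2) G_def image_image using GP(3) by force
      ultimately show "C \<in> ?C" by simp
    next
      fix C assume C: "C \<in> ?C"
      then have CP: "C \<subseteq> P" and tot: "\<And>p q. p \<in> C \<Longrightarrow> q \<in> C \<Longrightarrow> le p q \<or> le q p" and hT: "height P le ` C = T"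
        by (auto simp: is_chain_def)
      have uniq: "p = q" if "p \<in> C" "q \<in> C" "height P le p = height P le q" for p q
      proof -
        have P: "p \<in> P" "q \<in> P" using that CP by auto
        have "\<phi> p = \<phi> q"
          using tot[OF that(1,2)] ord[OF P] ord[OF P(2,1)] ht[OF P(1)] ht[OF P(2)] that(3)
            rk_eq[OF \<phi>(1)[OF P(1)] \<phi>(1)[OF P(2)]] rk_eq[OF \<phi>(1)[OF P(2)] \<phi>(1)[OF P(1)]] by auto
        then show ?thesis using \<phi>(2)[OF P(1)] \<phi>(2)[OF P(2)] by metis
      qed
      have "\<forall>t\<in>T. \<exists>p. p \<in> C \<and> height P le p = t" using hT by blast
      then obtain f where f: "\<And>t. t \<in> T \<Longrightarrow> f t \<in> C \<and> height P le (f t) = t" by metis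
      define u where "u = (\<lambda>t\<in>T. \<phi> (f t))"
      have ut: "flat (u t)" "rk (u t) = t" "u t = \<phi> (f t)" "f t \<in> P" if "t \<in> T" for t
        using f[OF that] CP \<phi>(1) ht that by (auto simp: u_def)
      have "u s \<subseteq> u t" if st: "s \<in> T" "t \<in> T" "s \<le> t" for s t
      proof -
        have "u s \<subseteq> u t \<or> u t \<subseteq> u s"
          using tot[of "f s" "f t"] f st ord[OF ut(4)[OF st(1)] ut(4)[OF st(2)]] ord[OF ut(4)[OF st(2)] ut(4)[OF st(1)]]
            ut(3)[OF st(1)] ut(3)[OF st(2)] by auto
        then show ?thesis
          using rk_mono[OF ut(1)[OF st(2)] ut(1)[OF st(1)]] rk_eq[OF ut(1)[OF st(2)] ut(1)[OF st(1)]] ut(2) st by fastforce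
      qed
      moreover have "cl {} \<subseteq> F" if "flat F" for F using cl_least[OF _ that] by simp
      ultimately have "u \<in> ?B"
        using ut(1,2) flat_E rk_bot by (auto simp: flag_chains_def u_def)
      moreover have "G u = C"
      proof (intro equalityI subsetI)
        fix p assume "p \<in> G u"
        then show "p \<in> C" using ut(3,4) \<phi>(2) f by (auto simp: G_def)
      next
        fix p assume p: "p \<in> C"
        then have t: "height P le p \<in> T" using hT by blast
        have "f (height P le p) = p" using f[OF t] uniq[of "f (height P le p)" p] p by simp
        then have "\<psi> (u (height P le p)) = p" using ut(3)[OF t] \<phi>(2) p CP by auto
        then show "p \<in> G u" using t unfolding G_def by (metis imageI)
      qed
      ultimately show "C \<in> G ` ?B" by blast
    qed
  qed
  then show ?thesis by (simp add: flag_f_def bij_betw_same_card)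
qed

text \<open>Sorting words by their exact descent set writes each flag number as a sum over subsets;
  the signed sum in \<open>flag_h\<close> inverts this.\<close>

lemma flag_h_eq_card_words:
  assumes "bij_betw \<phi> P {F. flat F}"
    and "\<And>p q. p \<in> P \<Longrightarrow> q \<in> P \<Longrightarrow> le p q \<longleftrightarrow> \<phi> p \<subseteq> \<phi> q"
    and "\<And>p. p \<in> P \<Longrightarrow> height P le p = rk (\<phi> p)"
    and S: "S \<subseteq> {1..<rk E}"
  shows "flag_h P le S = int (card (good_words (cl {}) E S))"
proof -
  let ?x = "cl {}"
  have x: "flat ?x" "?x \<subseteq> E" using flat_cl[of "{}"] flat_E by auto
  have finS: "finite S" using S finite_subset by blast
  define f where "f U = int (card (good_words ?x E U))" for U
  have ff: "int (flag_f P le T) = sum f (Pow T)" if T: "T \<subseteq> S" for T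
  proof -
    have T': "T \<subseteq> {1..<rk E - rk ?x}" using T S rk_bot by auto
    have fT: "finite T" using T finS finite_subset by blast
    have "card (flag_chains ?x E T) = card {w. good ?x w \<and> word_flat ?x w = E \<and> Des w \<subseteq> T}"
      using bij_betw_same_card[OF bij_chain_of[OF x(1) flat_top x(2) T']] by simp
    also have "{w. good ?x w \<and> word_flat ?x w = E \<and> Des w \<subseteq> T} = (\<Union>U\<in>Pow T. good_words ?x E U)" by (auto simp: good_words_def)
    also have "card \<dots> = (\<Sum>U\<in>Pow T. card (good_words ?x E U))"
      by (rule card_UN_disjoint) (use fT in \<open>auto simp: good_words_def intro: finite_good_words[unfolded good_words_def]\<close>)
    finally show ?thesis using card_chains[OF assms(1-3), of T] by (simp add: f_def)
  qed
  have "flag_h P le S = (\<Sum>T\<in>Pow S. (- 1) ^ (card S - card T) * sum f (Pow T))"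
    unfolding flag_h_def using ff by (intro sum.cong) auto
  also have "\<dots> = f S"
    using inclusion_exclusion_mobius[of "\<lambda>T. sum f (Pow T)" f S] finS by simp
  finally show ?thesis by (simp add: f_def)
qed

text \<open>Flats of a chain strictly below \<open>X\<close> have distinct ranks less than
  \<open>rk X\<close>, and the proper prefixes of a basis attain this bound.\<close>

lemma height_flats:
  assumes X: "flat X"
  shows "height {F. flat F} (\<subseteq>) X = rk X"
  unfolding height_def
proof (rule Max_eqI)
  have ub: "card C \<le> rk X" if C: "is_chain {F. flat F} (\<subseteq>) C" "\<forall>c\<in>C. c \<subseteq> X \<and> c \<noteq> X" for C
  proof -
    have CF: "\<And>c. c \<in> C \<Longrightarrow> flat c" and tot: "\<And>c d. c \<in> C \<Longrightarrow> d \<in> C \<Longrightarrow> c \<subseteq> d \<or> d \<subseteq> c"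
      using C(1) by (auto simp: is_chain_def)
    have "inj_on rk C"
    proof (rule inj_onI)
      fix c d assume cd: "c \<in> C" "d \<in> C" "rk c = rk d"
      then show "c = d" using tot[OF cd(1,2)] rk_eq[OF CF[OF cd(1)] CF[OF cd(2)]] rk_eq[OF CF[OF cd(2)] CF[OF cd(1)]] by auto
    qed
    moreover have "rk ` C \<subseteq> {..<rk X}"
    proof (rule image_subsetI)
      fix c assume c: "c \<in> C"
      then have "c \<subseteq> X" "c \<noteq> X" using C(2) by auto
      then have "rk c \<le> rk X" "rk c \<noteq> rk X" using rk_mono[OF CF[OF c] X] rk_eq[OF CF[OF c] X] by auto
      then show "rk c \<in> {..<rk X}" by simp
    qed
    ultimately have "card C \<le> card {..<rk X}" by (rule card_inj_on_le) simp
    then show ?thesis by simp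
  qed
  have sub: "{card C |C. is_chain {F. flat F} (\<subseteq>) C \<and> (\<forall>c\<in>C. c \<subseteq> X \<and> c \<noteq> X)} \<subseteq> {..rk X}"
  proof
    fix y assume "y \<in> {card C |C. is_chain {F. flat F} (\<subseteq>) C \<and> (\<forall>c\<in>C. c \<subseteq> X \<and> c \<noteq> X)}"
    then obtain C where C: "is_chain {F. flat F} (\<subseteq>) C" "\<forall>c\<in>C. c \<subseteq> X \<and> c \<noteq> X" "y = card C" by blast
    then show "y \<in> {..rk X}" using ub[OF C(1,2)] by simp
  qed
  show "finite {card C |C. is_chain {F. flat F} (\<subseteq>) C \<and> (\<forall>c\<in>C. c \<subseteq> X \<and> c \<noteq> X)}"
    by (rule finite_subset[OF sub]) simp
  show "\<And>y. y \<in> {card C |C. is_chain {F. flat F} (\<subseteq>) C \<and> (\<forall>c\<in>C. c \<subseteq> X \<and> c \<noteq> X)} \<Longrightarrow> y \<le> rk X"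
    using subsetD[OF sub] by simp
  have x: "flat (cl {})" "cl {} \<subseteq> X" using flat_cl[of "{}"] cl_least[OF _ X, of "{}"] by auto
  obtain w where w: "indep (cl {}) w" "word_flat (cl {}) w = X" "length w = rk X - rk (cl {})"
    using indep_exists[OF x(1) X x(2)] by blast
  have lw: "length w = rk X" using w(3) rk_bot by simp
  define C where "C = (\<lambda>i. word_flat (cl {}) (take i w)) ` {..<length w}"
  have rC: "rk (word_flat (cl {}) (take i w)) = i" if "i < length w" for i
    using rk_take[OF x(1) w(1), of i] that rk_bot by simp
  have fl: "flat (word_flat (cl {}) (take i w))" for i using flat_word_flat[OF x(1) indep_take_E[OF w(1)]] .
  have mono: "word_flat (cl {}) (take i w) \<subseteq> word_flat (cl {}) (take j w)" if "i \<le> j" for i j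
    using x(1) indep_take_E[OF w(1)] set_take_subset_set_take[OF that, of w] by (intro word_flat_mono) auto
  have chain: "is_chain {F. flat F} (\<subseteq>) C"
    unfolding is_chain_def C_def
  proof (intro conjI ballI)
    fix c d assume "c \<in> (\<lambda>i. word_flat (cl {}) (take i w)) ` {..<length w}" "d \<in> (\<lambda>i. word_flat (cl {}) (take i w)) ` {..<length w}"
    then obtain i j where "c = word_flat (cl {}) (take i w)" "d = word_flat (cl {}) (take j w)" by blast
    then show "c \<subseteq> d \<or> d \<subseteq> c" using mono[of i j] mono[of j i] by (metis nat_le_linear)
  qed (use fl in auto)
  have proper: "c \<subseteq> X \<and> c \<noteq> X" if cC: "c \<in> C" for c
  proof -
    obtain i where "c = word_flat (cl {}) (take i w)" "i \<in> {..<length w}" using cC unfolding C_def by blast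
    then have i: "i < length w" "c = word_flat (cl {}) (take i w)" by auto
    have "c \<subseteq> X" using mono[of i "length w"] i w(2) by simp
    moreover have "rk c \<noteq> rk X" using rC[OF i(1)] i lw by simp
    ultimately show ?thesis by auto
  qed
  have "rk X = card C"
  proof -
    have "inj_on (\<lambda>i. word_flat (cl {}) (take i w)) {..<length w}"
      by (rule inj_on_inverseI[of _ rk]) (use rC in simp)
    then show ?thesis unfolding C_def by (simp add: card_image lw)
  qed
  then show "rk X \<in> {card C |C. is_chain {F. flat F} (\<subseteq>) C \<and> (\<forall>c\<in>C. c \<subseteq> X \<and> c \<noteq> X)}"
    using chain proper by (intro CollectI exI[of _ C]) simp
qed

end

section \<open>Geometric lattices\<close>

text \<open>Serves three times: for the bottom, for the top with the order reversed, and for the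
  least element above a given set of atoms.\<close>

lemma finite_directed_least:
  assumes "finite A" "A \<noteq> {}" and dir: "\<And>p q. p \<in> A \<Longrightarrow> q \<in> A \<Longrightarrow> \<exists>m\<in>A. R m p \<and> R m q"
    and tr: "\<And>p q s. p \<in> A \<Longrightarrow> q \<in> A \<Longrightarrow> s \<in> A \<Longrightarrow> R p q \<Longrightarrow> R q s \<Longrightarrow> R p s"
  shows "\<exists>m\<in>A. \<forall>p\<in>A. R m p"
proof -
  have "\<exists>m\<in>A. \<forall>p\<in>B. R m p" if "finite B" "B \<subseteq> A" for B
    using that
  proof (induction B rule: finite_induct)
    case empty
    then show ?case using assms(2) by blast
  next
    case (insert b B)
    then obtain m where m: "m \<in> A" "\<forall>p\<in>B. R m p" by blast
    obtain m' where m': "m' \<in> A" "R m' m" "R m' b" using dir[OF m(1), of b] insert.prems by blast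
    have "R m' p" if "p \<in> B" for p using tr[OF m'(1) m(1) _ m'(2)] m(2) that insert.prems by blast
    then show ?case using m' by blast
  qed
  then show ?thesis using assms(1) by blast
qed

locale geom_lattice =
  fixes L :: "'a set" and le :: "'a \<Rightarrow> 'a \<Rightarrow> bool" and n :: nat
  assumes geo: "geometric_lattice L le" and n: "card (atoms L le) = n"
begin

abbreviation "ht \<equiv> height L le"

lemma finL: "finite L" and neL: "L \<noteq> {}"
  and le_rfl: "p \<in> L \<Longrightarrow> le p p"
  and le_asym: "p \<in> L \<Longrightarrow> q \<in> L \<Longrightarrow> le p q \<Longrightarrow> le q p \<Longrightarrow> p = q"
  and le_tr: "p \<in> L \<Longrightarrow> q \<in> L \<Longrightarrow> s \<in> L \<Longrightarrow> le p q \<Longrightarrow> le q s \<Longrightarrow> le p s"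
  and lub: "p \<in> L \<Longrightarrow> q \<in> L \<Longrightarrow> \<exists>z. is_lub L le {p, q} z"
  and glb: "p \<in> L \<Longrightarrow> q \<in> L \<Longrightarrow> \<exists>z. is_glb L le {p, q} z"
  and graded: "covers L le p q \<Longrightarrow> ht q = ht p + 1"
  and atomic: "p \<in> L \<Longrightarrow> is_lub L le {a \<in> atoms L le. le a p} p"
  and semimod: "p \<in> L \<Longrightarrow> q \<in> L \<Longrightarrow> ht (ljoin L le p q) + ht (lmeet L le p q) \<le> ht p + ht q"
  using geo unfolding geometric_lattice_def finite_lattice_on_def partial_order_on'_def graded_on_def
  by blast+

lemma bot_ex: "\<exists>m\<in>L. \<forall>p\<in>L. le m p"
proof (rule finite_directed_least[OF finL neL])
  fix p q assume "p \<in> L" "q \<in> L"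
  then obtain z where "is_glb L le {p, q} z" using glb by blast
  then show "\<exists>m\<in>L. le m p \<and> le m q" by (intro bexI[of _ z]) (auto simp: is_glb_def)
qed (rule le_tr)

lemma top_ex: "\<exists>m\<in>L. \<forall>p\<in>L. le p m"
proof (rule finite_directed_least[OF finL neL, of "\<lambda>p q. le q p"])
  fix p q assume "p \<in> L" "q \<in> L"
  then obtain z where "is_lub L le {p, q} z" using lub by blast
  then show "\<exists>m\<in>L. le p m \<and> le q m" by (intro bexI[of _ z]) (auto simp: is_lub_def)
next
  fix p q s assume "p \<in> L" "q \<in> L" "s \<in> L" "le q p" "le s q"
  then show "le s p" using le_tr[of s q p] by blast
qed

lemma lbot: "lbot L le \<in> L" "p \<in> L \<Longrightarrow> le (lbot L le) p"
proof -
  obtain m where m: "m \<in> L" "\<forall>p\<in>L. le m p" using bot_ex by blast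
  then have "lbot L le = m" unfolding lbot_def by (intro the_equality) (use le_asym in auto)
  then show "lbot L le \<in> L" "p \<in> L \<Longrightarrow> le (lbot L le) p" using m by auto
qed

lemma ltop: "ltop L le \<in> L" "p \<in> L \<Longrightarrow> le p (ltop L le)"
proof -
  obtain m where m: "m \<in> L" "\<forall>p\<in>L. le p m" using top_ex by blast
  then have "ltop L le = m" unfolding ltop_def by (intro the_equality) (use le_asym in auto)
  then show "ltop L le \<in> L" "p \<in> L \<Longrightarrow> le p (ltop L le)" using m by auto
qed

definition below :: "'a \<Rightarrow> nat set" where
  "below p = {card C | C. is_chain L le C \<and> (\<forall>c\<in>C. le c p \<and> c \<noteq> p)}"

lemma below: "finite (below p)" "0 \<in> below p" "ht p = Max (below p)"
proof -
  have "below p \<subseteq> {..card L}"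
  proof
    fix k assume "k \<in> below p"
    then obtain C where "C \<subseteq> L" "k = card C" by (auto simp: below_def is_chain_def)
    then show "k \<in> {..card L}" using card_mono[OF finL] by simp
  qed
  then show "finite (below p)" using finite_subset by blast
  show "0 \<in> below p" unfolding below_def is_chain_def
    by (rule CollectI, rule exI[of _ "{}"]) simp
  show "ht p = Max (below p)" by (simp add: height_def below_def)
qed

lemma ht_strict:
  assumes "p \<in> L" "q \<in> L" "le p q" "p \<noteq> q" shows "ht p < ht q"
proof -
  have "ht p \<in> below p" unfolding below(3) by (rule Max_in[OF below(1)]) (use below(2) in blast)
  then obtain C where C: "is_chain L le C" "\<And>c. c \<in> C \<Longrightarrow> le c p \<and> c \<noteq> p" "ht p = card C"
    by (auto simp: below_def)
  have CL: "C \<subseteq> L" "finite C" using C(1) finL finite_subset by (auto simp: is_chain_def)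
  have 1: "is_chain L le (insert p C)" using C(1,2) assms(1) le_rfl by (auto simp: is_chain_def)
  have 2: "le c q \<and> c \<noteq> q" if "c \<in> insert p C" for c
  proof (cases "c = p")
    case False
    then have c: "c \<in> C" "c \<in> L" using that CL by auto
    then have "le c q" using le_tr[OF c(2) assms(1,2)] C(2) assms(3) by blast
    moreover have "c \<noteq> q" using C(2)[OF c(1)] le_asym[OF assms(1,2)] assms(3,4) by blast
    ultimately show ?thesis by simp
  qed (use assms in simp)
  have "p \<notin> C" using C(2) by blast
  then have 3: "ht p + 1 = card (insert p C)" using C(3) CL by simp
  have "ht p + 1 \<in> below q" unfolding below_def
    by (rule CollectI, rule exI[of _ "insert p C"]) (intro conjI ballI 1 3 2)
  then have "ht p + 1 \<le> Max (below q)" by (rule Max_ge[OF below(1)])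
  then show ?thesis using below(3)[of q] by linarith
qed

lemma ht_bot: "ht (lbot L le) = 0"
proof -
  have "below (lbot L le) \<subseteq> {0}"
  proof
    fix k assume "k \<in> below (lbot L le)"
    then obtain C where C: "C \<subseteq> L" "\<And>c. c \<in> C \<Longrightarrow> le c (lbot L le) \<and> c \<noteq> lbot L le" "k = card C"
      by (auto simp: below_def is_chain_def)
    have "C = {}" using C(1,2) lbot le_asym by blast
    then show "k \<in> {0}" using C(3) by simp
  qed
  then have "below (lbot L le) = {0}" using below(2) by blast
  then show ?thesis using below(3) by simp
qed

lemma atoms_eq: "atoms L le = {p \<in> L. ht p = 1}"
proof (intro equalityI subsetI)
  fix p assume "p \<in> atoms L le"
  then have c: "covers L le (lbot L le) p" by (simp add: atoms_def)
  then show "p \<in> {p \<in> L. ht p = 1}" using graded[OF c] ht_bot by (simp add: covers_def)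
next
  fix p assume p: "p \<in> {p \<in> L. ht p = 1}"
  then have pL: "p \<in> L" "ht p = 1" by auto
  have "p \<noteq> lbot L le" using pL ht_bot by auto
  moreover have "\<not> (\<exists>z\<in>L. le (lbot L le) z \<and> le z p \<and> z \<noteq> lbot L le \<and> z \<noteq> p)"
  proof
    assume "\<exists>z\<in>L. le (lbot L le) z \<and> le z p \<and> z \<noteq> lbot L le \<and> z \<noteq> p"
    then obtain z where z: "z \<in> L" "le (lbot L le) z" "le z p" "z \<noteq> lbot L le" "z \<noteq> p" by blast
    then show False using ht_strict[OF lbot(1) z(1,2)] ht_strict[OF z(1) pL(1) z(3)] pL(2) by simp
  qed
  ultimately show "p \<in> atoms L le" using lbot pL by (simp add: atoms_def covers_def)
qed

text \<open>An arbitrary numbering of the atoms; it supplies the linear order that the labelling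
  requires.\<close>

definition atm :: "nat \<Rightarrow> 'a" where "atm = (SOME h. bij_betw h {..<n} (atoms L le))"

lemma atm: "bij_betw atm {..<n} (atoms L le)"
proof -
  have "finite (atoms L le)" unfolding atoms_eq using finL by simp
  then have "\<exists>h. bij_betw h {..<n} (atoms L le)"
    using ex_bij_betw_nat_finite n by (metis atLeast0LessThan)
  then show ?thesis unfolding atm_def by (rule someI_ex)
qed

lemma atm_atom: assumes "i < n" shows "atm i \<in> L" "ht (atm i) = 1"
proof -
  have "atm i \<in> atoms L le" by (rule bij_betw_apply[OF atm]) (use assms in simp)
  then show "atm i \<in> L" "ht (atm i) = 1" unfolding atoms_eq by simp_all
qed

definition \<phi> :: "'a \<Rightarrow> nat set" where "\<phi> p = {i. i < n \<and> le (atm i) p}"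

lemma \<phi>_iff: assumes "p \<in> L" "q \<in> L" shows "le p q \<longleftrightarrow> \<phi> p \<subseteq> \<phi> q"
proof
  assume pq: "le p q"
  show "\<phi> p \<subseteq> \<phi> q"
  proof
    fix i assume "i \<in> \<phi> p"
    then have i: "i < n" "le (atm i) p" by (auto simp: \<phi>_def)
    have "le (atm i) q" by (rule le_tr[OF atm_atom(1)[OF i(1)] assms i(2) pq])
    then show "i \<in> \<phi> q" using i by (simp add: \<phi>_def)
  qed
next
  assume s: "\<phi> p \<subseteq> \<phi> q"
  have "le a q" if a: "a \<in> atoms L le" "le a p" for a
  proof -
    have "a \<in> atm ` {..<n}" using atm a(1) by (simp add: bij_betw_def)
    then obtain i where "i < n" "a = atm i" by blast
    then show ?thesis using s a(2) by (auto simp: \<phi>_def)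
  qed
  then show "le p q" using atomic[OF assms(1)] assms(2) by (auto simp: is_lub_def)
qed

lemma \<phi>_inj: "inj_on \<phi> L"
proof (rule inj_onI)
  fix p q assume pq: "p \<in> L" "q \<in> L" "\<phi> p = \<phi> q"
  show "p = q"
    by (rule le_asym[OF pq(1,2)]) (simp_all add: \<phi>_iff pq)
qed

lemma \<phi>_sub: "\<phi> p \<subseteq> {..<n}" by (auto simp: \<phi>_def)

lemma \<phi>_top: "\<phi> (ltop L le) = {..<n}"
  using ltop(2)[OF atm_atom(1)] by (auto simp: \<phi>_def)

definition cl :: "nat set \<Rightarrow> nat set" where "cl X = \<Inter> {\<phi> p | p. p \<in> L \<and> X \<subseteq> \<phi> p}"

text \<open>Meaningful on the sets \<open>\<phi> p\<close>, which are exactly the flats; elsewhere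
  the value is arbitrary.\<close>

definition rk :: "nat set \<Rightarrow> nat" where "rk X = ht (inv_into L \<phi> X)"

lemma rk_\<phi>: "p \<in> L \<Longrightarrow> rk (\<phi> p) = ht p" by (simp add: rk_def inv_into_f_f[OF \<phi>_inj])

lemma cl_obtain:
  assumes "X \<subseteq> {..<n}"
  obtains m where "m \<in> L" "X \<subseteq> \<phi> m" "cl X = \<phi> m" "\<And>p. p \<in> L \<Longrightarrow> X \<subseteq> \<phi> p \<Longrightarrow> le m p"
proof -
  let ?A = "{p \<in> L. X \<subseteq> \<phi> p}"
  have "\<exists>m\<in>?A. \<forall>p\<in>?A. le m p"
  proof (rule finite_directed_least)
    show "finite ?A" using finL by simp
    show "?A \<noteq> {}" using ltop(1) \<phi>_top assms by blast
    fix p q assume pq: "p \<in> ?A" "q \<in> ?A"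
    then obtain m where m: "is_glb L le {p, q} m" using glb by blast
    have "X \<subseteq> \<phi> m"
    proof
      fix i assume i: "i \<in> X"
      then have "i < n" "le (atm i) p" "le (atm i) q" using pq assms by (auto simp: \<phi>_def)
      then show "i \<in> \<phi> m" using m atm_atom(1)[of i] by (simp add: \<phi>_def is_glb_def)
    qed
    then show "\<exists>m\<in>?A. le m p \<and> le m q" using m by (intro bexI[of _ m]) (auto simp: is_glb_def)
  next
    fix p q s assume "p \<in> ?A" "q \<in> ?A" "s \<in> ?A" "le p q" "le q s"
    then show "le p s" using le_tr by blast
  qed
  then obtain m where m: "m \<in> L" "X \<subseteq> \<phi> m" "\<And>p. p \<in> L \<Longrightarrow> X \<subseteq> \<phi> p \<Longrightarrow> le m p" by blast
  have "\<phi> m \<subseteq> \<phi> p" if "p \<in> L" "X \<subseteq> \<phi> p" for p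
    using m(3)[OF that] \<phi>_iff[OF m(1) that(1)] by simp
  then have "cl X = \<phi> m" unfolding cl_def using m(1,2) by blast
  then show ?thesis using that m by blast
qed

lemma cl_\<phi>: "p \<in> L \<Longrightarrow> cl (\<phi> p) = \<phi> p" unfolding cl_def by blast

lemma cl_bot: "cl {} = \<phi> (lbot L le)"
proof -
  obtain m where m: "m \<in> L" "{} \<subseteq> \<phi> m" "cl {} = \<phi> m" "\<And>p. p \<in> L \<Longrightarrow> {} \<subseteq> \<phi> p \<Longrightarrow> le m p"
    by (rule cl_obtain[of "{}"]) auto
  have "m = lbot L le" using m(4)[OF lbot(1)] lbot(2)[OF m(1)] le_asym[OF m(1) lbot(1)] by simp
  then show ?thesis using m by simp
qed

lemma ranked: "ranked_closure {..<n} cl rk"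
proof
  show "finite {..<n}" by simp
  have ex: "\<exists>m\<in>L. X \<subseteq> \<phi> m \<and> cl X = \<phi> m" if "X \<subseteq> {..<n}" for X
    by (rule cl_obtain[OF that]) blast
  show "X \<subseteq> cl X" if "X \<subseteq> {..<n}" for X using ex[OF that] by auto
  show "cl X \<subseteq> {..<n}" if "X \<subseteq> {..<n}" for X using ex[OF that] \<phi>_sub by auto
  show "cl X \<subseteq> cl Y" if "X \<subseteq> Y" "Y \<subseteq> {..<n}" for X Y unfolding cl_def using that by blast
  show "cl (cl X) = cl X" if "X \<subseteq> {..<n}" for X using ex[OF that] cl_\<phi> by auto
  show "rk (cl {}) = 0" by (simp add: cl_bot rk_\<phi> lbot ht_bot)
  fix X e assume X: "X \<subseteq> {..<n}" "cl X = X" "e \<in> {..<n} - X"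
  obtain p where p: "p \<in> L" "X = \<phi> p" using ex[OF X(1)] X(2) by auto
  have e: "e < n" "atm e \<in> L" "ht (atm e) = 1" using X(3) atm_atom by auto
  have "insert e X \<subseteq> {..<n}" using X by auto
  then obtain q where q: "q \<in> L" "insert e X \<subseteq> \<phi> q" "cl (insert e X) = \<phi> q"
    "\<And>s. s \<in> L \<Longrightarrow> insert e X \<subseteq> \<phi> s \<Longrightarrow> le q s" by (rule cl_obtain) blast
  have pq: "le p q" using \<phi>_iff[OF p(1) q(1)] p(2) q(2) by blast
  have eq: "le (atm e) q" using q(2) by (auto simp: \<phi>_def)
  have "is_lub L le {p, atm e} q" unfolding is_lub_def
  proof (intro conjI ballI impI)
    fix s assume s: "s \<in> L" "\<forall>a\<in>{p, atm e}. le a s"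
    then have "insert e X \<subseteq> \<phi> s" using \<phi>_iff[OF p(1) s(1)] p(2) e(1) by (auto simp: \<phi>_def)
    then show "le q s" using q(4) s by blast
  qed (use q pq eq in auto)
  then have "ljoin L le p (atm e) = q" unfolding ljoin_def
  proof (rule the_equality)
    fix z assume "is_lub L le {p, atm e} z"
    then show "z = q" using \<open>is_lub L le {p, atm e} q\<close> le_asym[of z q] by (auto simp: is_lub_def)
  qed
  \<comment> \<open>An atom has height 1, so semimodularity bounds the rise by one; strict
    monotonicity of the height gives the converse.\<close>
  then have "ht q \<le> ht p + 1" using semimod[OF p(1) e(2)] e(3) by simp
  moreover have "p \<noteq> q" using q(2) p(2) X(3) by blast
  then have "ht p < ht q" using ht_strict[OF p(1) q(1) pq] by blast
  ultimately show "rk (cl (insert e X)) = rk X + 1" using q(3) p rk_\<phi> q(1) by simp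
qed

lemma flats_eq: "{F. ranked_closure.flat {..<n} cl F} = \<phi> ` L"
proof -
  interpret ranked_closure "{..<n}" cl rk by (rule ranked)
  show ?thesis
  proof (intro equalityI subsetI)
    fix F assume "F \<in> {F. flat F}"
    then have F: "F \<subseteq> {..<n}" "cl F = F" by (auto simp: flat_def)
    show "F \<in> \<phi> ` L" by (rule cl_obtain[OF F(1)]) (use F(2) in auto)
  next
    fix F assume "F \<in> \<phi> ` L"
    then show "F \<in> {F. flat F}" using cl_\<phi> \<phi>_sub by (auto simp: flat_def)
  qed
qed

lemma flag_h_lower_bound:
  assumes "lattice_rank L le = d" "S \<subseteq> {1..<d}"
  shows "int (beta d S) + (int n - int d) * int (beta_inv 1 0 d S) \<le> flag_h L le S"
proof -
  interpret ranked_closure "{..<n}" cl rk by (rule ranked)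
  have bij: "bij_betw \<phi> L {F. flat F}" using \<phi>_inj flats_eq by (simp add: bij_betw_def)
  have rE: "rk {..<n} = d" using rk_\<phi>[OF ltop(1)] \<phi>_top assms(1) by (simp add: lattice_rank_def)
  have x: "flat (cl {})" by (rule flat_cl) simp
  have h: "flag_h L le S = int (card (good_words (cl {}) {..<n} S))"
    using assms(2) rE by (intro flag_h_eq_card_words[OF bij]) (auto simp: \<phi>_iff rk_\<phi>)
  have "upper_covers (cl {}) {..<n} = \<phi> ` atoms L le"
  proof (intro equalityI subsetI)
    fix u assume "u \<in> upper_covers (cl {}) {..<n}"
    then have u: "flat u" "rk u = 1" using rk_bot by (auto simp: upper_covers_def)
    then obtain p where "p \<in> L" "u = \<phi> p" using flats_eq by blast
    then show "u \<in> \<phi> ` atoms L le" using u rk_\<phi> atoms_eq by auto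
  next
    fix u assume "u \<in> \<phi> ` atoms L le"
    then obtain p where p: "p \<in> L" "ht p = 1" "u = \<phi> p" using atoms_eq by auto
    then have "flat u" "rk u = 1" using flats_eq rk_\<phi> by auto
    moreover have "cl {} \<subseteq> u" using cl_least[OF _ \<open>flat u\<close>] by simp
    ultimately show "u \<in> upper_covers (cl {}) {..<n}" using rk_bot flat_E by (simp add: upper_covers_def)
  qed
  then have "card (upper_covers (cl {}) {..<n}) = n"
    using card_image[OF inj_on_subset[OF \<phi>_inj, of "atoms L le"]] atoms_eq n by auto
  then show ?thesis using flag_words_lower_bound[OF x, of S] rE rk_bot h by simp
qed

end

section \<open>Near pencils\<close>

locale near_pencil_geometry =
  fixes r n :: nat
  assumes r1: "1 \<le> r" and rn: "r + 1 \<le> n"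
begin

definition N :: "nat set" where "N = {r - 1..<n}"

text \<open>Two points of the line \<open>N\<close> span all of it, and coloops never add anything
  else to a span.\<close>

definition npcl :: "nat set \<Rightarrow> nat set" where
  "npcl X = (if 2 \<le> card (X \<inter> N) then X \<union> N else X)"

lemma N: "finite N" "2 \<le> card N" "N \<subseteq> {..<n}" using r1 rn by (auto simp: N_def)

lemma rank_eq: "near_pencil_rank r n X = card (X \<inter> {..<r - 1}) + min 2 (card (X \<inter> N))"
  by (simp add: near_pencil_rank_def N_def atLeast0LessThan)

lemma disj: "e \<in> N \<Longrightarrow> \<not> e < r - 1" "e < n \<Longrightarrow> e \<in> N \<or> e < r - 1"
  by (auto simp: N_def)

lemma rank_npcl: "near_pencil_rank r n (npcl X) = near_pencil_rank r n X"
proof -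
  have "(X \<union> N) \<inter> {..<r - 1} = X \<inter> {..<r - 1}" using disj by auto
  moreover have "(X \<union> N) \<inter> N = N" by auto
  ultimately show ?thesis using N(2) by (auto simp: rank_eq npcl_def)
qed

lemma ranked: "ranked_closure {..<n} npcl (near_pencil_rank r n)"
proof
  show "finite {..<n}" by simp
  show "X \<subseteq> npcl X" for X by (auto simp: npcl_def)
  show "npcl X \<subseteq> {..<n}" if "X \<subseteq> {..<n}" for X using that N(3) by (auto simp: npcl_def)
  show "npcl X \<subseteq> npcl Y" if "X \<subseteq> Y" for X Y
  proof -
    have "card (X \<inter> N) \<le> card (Y \<inter> N)" using that N(1) by (intro card_mono) auto
    then show ?thesis using that by (auto simp: npcl_def)
  qed
  show "npcl (npcl X) = npcl X" for X by (auto simp: npcl_def)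
  show "near_pencil_rank r n (npcl {}) = 0" by (simp add: npcl_def rank_eq)
  fix X e assume X: "X \<subseteq> {..<n}" "npcl X = X" "e \<in> {..<n} - X"
  have fin: "finite (X \<inter> N)" "finite (X \<inter> {..<r - 1})" using N(1) by auto
  show "near_pencil_rank r n (npcl (insert e X)) = near_pencil_rank r n X + 1"
  proof (cases "e \<in> N")
    case True
    have "\<not> 2 \<le> card (X \<inter> N)"
    proof
      assume "2 \<le> card (X \<inter> N)"
      then have "N \<subseteq> X" using X(2) by (auto simp: npcl_def)
      then show False using True X(3) by blast
    qed
    moreover have "insert e X \<inter> N = insert e (X \<inter> N)" "insert e X \<inter> {..<r - 1} = X \<inter> {..<r - 1}"
      using True disj(1)[OF True] by auto
    ultimately show ?thesis unfolding rank_npcl unfolding rank_eq using X(3) fin by simp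
  next
    case False
    then have "e < r - 1" using disj(2) X(3) by blast
    then have "insert e X \<inter> N = X \<inter> N" "insert e X \<inter> {..<r - 1} = insert e (X \<inter> {..<r - 1})"
      using False by auto
    then show ?thesis unfolding rank_npcl unfolding rank_eq using X(3) fin by simp
  qed
qed

lemma flats_eq: "{F. ranked_closure.flat {..<n} npcl F} = near_pencil r n"
proof -
  interpret ranked_closure "{..<n}" npcl "near_pencil_rank r n" by (rule ranked)
  show ?thesis unfolding near_pencil_def matroid_flats_def
  proof (intro Collect_cong iffI)
    fix F assume F: "flat F"
    then have "F \<subseteq> {..<n}" by (rule flat_E)
    moreover have "near_pencil_rank r n F < near_pencil_rank r n (insert e F)" if "e \<in> {0..<n} - F" for e
      using rk_insert_flat[OF F, of e] that rank_npcl[of "insert e F"] by auto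
    ultimately show "F \<subseteq> {0..<n} \<and> (\<forall>e\<in>{0..<n} - F. near_pencil_rank r n F < near_pencil_rank r n (insert e F))"
      by (auto simp: atLeast0LessThan)
  next
    fix F assume F: "F \<subseteq> {0..<n} \<and> (\<forall>e\<in>{0..<n} - F. near_pencil_rank r n F < near_pencil_rank r n (insert e F))"
    have "npcl F = F"
    proof (rule ccontr)
      assume ne: "npcl F \<noteq> F"
      then have c: "2 \<le> card (F \<inter> N)" by (auto simp: npcl_def split: if_splits)
      then obtain e where e: "e \<in> N" "e \<notin> F" using ne by (auto simp: npcl_def)
      have "near_pencil_rank r n F < near_pencil_rank r n (insert e F)" using F e N(3) by auto
      moreover have "insert e F \<inter> {..<r - 1} = F \<inter> {..<r - 1}" using disj(1)[OF e(1)] by auto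
      ultimately show False using c by (simp add: rank_eq)
    qed
    then show "flat F" using F by (auto simp: flat_def)
  qed
qed

text \<open>A good word uses all coloops and exactly two points of the line. The second of them
  completes the line, so as a label it must be the least point of the line other than the first one,
  \<open>p\<close>.\<close>

lemma good_word_structure:
  assumes w: "w \<in> ranked_closure.good_words {..<n} npcl (near_pencil_rank r n) {} {..<n} S"
  obtains p where "p \<in> N" "before p (Min (N - {p})) w" "set w = {..<r - 1} \<union> {p, Min (N - {p})}" "distinct w" "Des w = S"
proof -
  interpret ranked_closure "{..<n}" npcl "near_pencil_rank r n" by (rule ranked)
  have x: "flat {}" by (simp add: flat_def npcl_def)
  have g: "good {} w" "word_flat {} w = {..<n}" "Des w = S" using w by (auto simp: good_words_def)
  have ind: "indep {} w" using good_indep[OF g(1)] .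
  have d: "distinct w" using indep_distinct[OF x ind] .
  have sw: "set w \<subseteq> {..<n}" using indep_E[OF ind] .
  have word_flat: "word_flat {} v = npcl (set v)" for v by (simp add: word_flat_def)
  have r0: "near_pencil_rank r n {} = 0" by (simp add: rank_eq)
  have "near_pencil_rank r n (set w) = card (set w)"
    using ind rank_npcl[of "set w"] distinct_card[OF d] r0 by (simp add: indep_def word_flat)
  moreover have "card (set w) = card (set w \<inter> {..<r - 1}) + card (set w \<inter> N)"
  proof -
    have "set w = (set w \<inter> {..<r - 1}) \<union> (set w \<inter> N)" using sw disj(2) by auto
    moreover have "(set w \<inter> {..<r - 1}) \<inter> (set w \<inter> N) = {}" using disj(1) by auto
    ultimately show ?thesis using card_Un_disjoint[of "set w \<inter> {..<r - 1}" "set w \<inter> N"] by simp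
  qed
  ultimately have "card (set w \<inter> N) \<le> 2" by (simp add: rank_eq)
  moreover have cl: "npcl (set w) = {..<n}" using g(2) word_flat by simp
  have "2 \<le> card (set w \<inter> N)"
  proof (rule ccontr)
    assume c: "\<not> 2 \<le> card (set w \<inter> N)"
    then have "set w = {..<n}" using cl by (simp add: npcl_def)
    then have "set w \<inter> N = N" using N(3) by auto
    then show False using c N(2) by simp
  qed
  ultimately have c2: "card (set w \<inter> N) = 2" by simp
  have low: "set w \<inter> {..<r - 1} = {..<r - 1}"
  proof -
    have "{..<r - 1} \<subseteq> npcl (set w)" unfolding cl using r1 rn by auto
    then show ?thesis using disj(1) by (auto simp: npcl_def split: if_splits)
  qed
  obtain p' q' where pq': "set w \<inter> N = {p', q'}" "p' \<noteq> q'" using c2 by (auto simp: card_2_iff)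
  have "\<exists>i j. i < j \<and> j < length w \<and> {w ! i, w ! j} = {p', q'}"
  proof -
    have "p' \<in> set w" "q' \<in> set w" using pq' by auto
    then obtain i j where ij: "i < length w" "w ! i = p'" "j < length w" "w ! j = q'" by (auto simp: in_set_conv_nth)
    then have "i \<noteq> j" using pq'(2) by auto
    then consider "i < j" | "j < i" by linarith
    then show ?thesis
    proof cases
      case 1
      then show ?thesis using ij by blast
    next
      case 2
      then show ?thesis using ij by (intro exI[of _ j] exI[of _ i]) auto
    qed
  qed
  then obtain i j where ij: "i < j" "j < length w" "{w ! i, w ! j} = {p', q'}" by blast
  define p q where "p = w ! i" and "q = w ! j"
  have wN: "set w \<inter> N = {p, q}" using pq' ij by (simp add: p_def q_def)
  have ne: "p \<noteq> q" using d ij by (simp add: p_def q_def nth_eq_iff_index_eq)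
  have tj: "set (take j w) \<inter> N = {p}"
  proof -
    have "p \<in> set (take j w)" unfolding p_def using ij by (auto simp: in_set_conv_nth intro!: exI[of _ i])
    moreover have "q \<notin> set (take j w)" unfolding q_def using d ij by (auto simp: in_set_conv_nth nth_eq_iff_index_eq)
    ultimately show ?thesis using wN set_take_subset[of j w] by blast
  qed
  have tS: "set (take (Suc j) w) = insert q (set (take j w))"
    using ij by (auto simp: take_Suc_conv_app_nth q_def)
  have qN: "q \<in> N" "p \<in> N" using wN by auto
  have "set (take (Suc j) w) \<inter> N = {p, q}" using tS tj qN by auto
  then have "npcl (set (take (Suc j) w)) = set (take j w) \<union> N" using ne tS qN by (auto simp: npcl_def)
  moreover have "npcl (set (take j w)) = set (take j w)" using tj by (simp add: npcl_def)
  moreover have "q = Min (npcl (set (take (Suc j) w)) - npcl (set (take j w)))"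
    using g(1) ij by (simp add: good_def word_flat q_def)
  moreover have "set (take j w) \<union> N - set (take j w) = N - {p}" using tj by blast
  ultimately have q: "q = Min (N - {p})" by simp
  have "set w = (set w \<inter> {..<r - 1}) \<union> (set w \<inter> N)" using sw disj(2) by auto
  then have "set w = {..<r - 1} \<union> {p, q}" using low wN by simp
  moreover have "before p q w" unfolding before_def p_def q_def using ij by blast
  ultimately show ?thesis using that[of p] qN q d g(3) by simp
qed

lemma Min_N: "Min (N - {p}) = (if p = r - 1 then r else r - 1)"
proof (rule Min_eqI)
  show "finite (N - {p})" using N(1) by simp
  show "(if p = r - 1 then r else r - 1) \<in> N - {p}" using r1 rn by (auto simp: N_def)
  show "(if p = r - 1 then r else r - 1) \<le> y" if "y \<in> N - {p}" for y using that r1 by (auto simp: N_def)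
qed

text \<open>If \<open>p \<le> r\<close>, the letters are exactly \<open>{..<r + 1}\<close>.
  Otherwise the second point is \<open>r - 1\<close>, and renaming \<open>p\<close> to
  \<open>r\<close> keeps the order of the letters, so each \<open>p\<close> from
  \<open>r + 1\<close> to \<open>n - 1\<close> gives at most one word for every permutation with
  \<open>r\<close> before \<open>r - 1\<close>.\<close>

lemma card_words_le:
  "card (ranked_closure.good_words {..<n} npcl (near_pencil_rank r n) {} {..<n} S)
    \<le> beta (r + 1) S + (n - (r + 1)) * beta_inv r (r - 1) (r + 1) S"
proof -
  interpret ranked_closure "{..<n}" npcl "near_pencil_rank r n" by (rule ranked)
  let ?G = "good_words {} {..<n} S"
  define W where "W p = {w \<in> ?G. p \<in> set w}" for p
  have low: "{..<r + 1} = {..<r - 1} \<union> {r - 1, r}" using r1 by auto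
  have "?G \<subseteq> perm_words {..<r + 1} S \<union> (\<Union>p\<in>{r + 1..<n}. W p)"
  proof
    fix w assume w: "w \<in> ?G"
    obtain p where p: "p \<in> N" "set w = {..<r - 1} \<union> {p, Min (N - {p})}" "distinct w" "Des w = S"
      using good_word_structure[OF w] by metis
    show "w \<in> perm_words {..<r + 1} S \<union> (\<Union>p\<in>{r + 1..<n}. W p)"
    proof (cases "p \<le> r")
      case True
      then have "p = r - 1 \<or> p = r" using p(1) by (auto simp: N_def)
      then have "{p, Min (N - {p})} = {r - 1, r}" using r1 by (auto simp: Min_N)
      then have "set w = {..<r + 1}" using p(2) low by simp
      then show ?thesis using p by (simp add: perm_words_def)
    next
      case False
      then have "p \<in> {r + 1..<n}" using p(1) by (auto simp: N_def)
      then show ?thesis using w p(2) by (auto simp: W_def)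
    qed
  qed
  then have "card ?G \<le> card (perm_words {..<r + 1} S \<union> (\<Union>p\<in>{r + 1..<n}. W p))"
    by (intro card_mono) (auto simp: W_def)
  also have "\<dots> \<le> card (perm_words {..<r + 1} S) + card (\<Union>p\<in>{r + 1..<n}. W p)" by (rule card_Un_le)
  also have "card (\<Union>p\<in>{r + 1..<n}. W p) \<le> (\<Sum>p\<in>{r + 1..<n}. card (W p))" by (rule card_UN_le) simp
  also have "\<dots> \<le> (\<Sum>p\<in>{r + 1..<n}. beta_inv r (r - 1) (r + 1) S)"
  proof (rule sum_mono)
    fix p assume p: "p \<in> {r + 1..<n}"
    let ?f = "\<lambda>e. if e = p then r else e"
    have Wp: "distinct w \<and> set w = {..<r - 1} \<union> {p, r - 1} \<and> Des w = S \<and> before p (r - 1) w" if "w \<in> W p" for w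
    proof -
      have w: "w \<in> ?G" "p \<in> set w" using that by (auto simp: W_def)
      obtain p' where p': "p' \<in> N" "before p' (Min (N - {p'})) w" "set w = {..<r - 1} \<union> {p', Min (N - {p'})}" "distinct w" "Des w = S"
        using good_word_structure[OF w(1)] by metis
      have "p \<noteq> Min (N - {p'})" using p by (auto simp: Min_N split: if_splits)
      moreover have "\<not> p < r - 1" using p by auto
      ultimately have "p = p'" using w(2) p'(3) by auto
      moreover have "Min (N - {p}) = r - 1" using p by (auto simp: Min_N)
      ultimately show ?thesis using p' by simp
    qed
    have A: "r \<notin> {..<r - 1} \<union> {p, r - 1}" using p r1 by auto
    have inj: "inj_on ?f ({..<r - 1} \<union> {p, r - 1})" using A by (auto simp: inj_on_def)
    show "card (W p) \<le> beta_inv r (r - 1) (r + 1) S"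
      unfolding beta_inv_def
    proof (rule card_inj_on_le[of "map ?f"])
      show "inj_on (map ?f) (W p)"
      proof (rule inj_onI)
        fix w w' assume ww: "w \<in> W p" "w' \<in> W p" "map ?f w = map ?f w'"
        have "inj_on ?f (set w \<union> set w')" using inj Wp[OF ww(1)] Wp[OF ww(2)] by simp
        then show "w = w'" using ww(3) by (rule map_inj_on[rotated])
      qed
      show "finite {w \<in> perm_words {..<r + 1} S. before r (r - 1) w}" by simp
      show "map ?f ` W p \<subseteq> {w \<in> perm_words {..<r + 1} S. before r (r - 1) w}"
      proof (rule image_subsetI)
        fix w assume "w \<in> W p"
        then have w: "distinct w" "set w = {..<r - 1} \<union> {p, r - 1}" "Des w = S" "before p (r - 1) w" using Wp by auto
        have "Des (map ?f w) = Des w"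
          by (rule Des_map_strict) (use w(2) p r1 in auto)
        moreover have "distinct (map ?f w)" using w(1,2) inj by (simp add: distinct_map)
        moreover have "set (map ?f w) = {..<r + 1}"
        proof -
          have "?f ` ({..<r - 1} \<union> {p, r - 1}) = {..<r - 1} \<union> {r, r - 1}" using p r1 by auto
          then show ?thesis using w(2) low by (simp add: insert_commute)
        qed
        moreover have "before r (r - 1) (map ?f w)"
        proof -
          obtain i j where ij: "i < j" "j < length w" "w ! i = p" "w ! j = r - 1" using w(4) by (auto simp: before_def)
          then show ?thesis unfolding before_def using p by (intro exI[of _ i] exI[of _ j]) auto
        qed
        ultimately show "map ?f w \<in> {w \<in> perm_words {..<r + 1} S. before r (r - 1) w}" using w(3) by (simp add: perm_words_def)
      qed
    qed
  qed
  finally show ?thesis by (simp add: beta_def)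
qed

lemma flag_h_upper_bound:
  assumes "S \<subseteq> {1..r}"
  shows "flag_h (near_pencil r n) (\<subseteq>) S \<le> int (beta (r + 1) S) + (int n - int (r + 1)) * int (beta_inv 1 0 (r + 1) S)"
proof -
  interpret ranked_closure "{..<n}" npcl "near_pencil_rank r n" by (rule ranked)
  have "near_pencil_rank r n {..<n} = r + 1"
  proof -
    have "{..<n} \<inter> {..<r - 1} = {..<r - 1}" using rn by auto
    moreover have "{..<n} \<inter> N = N" using N(3) by auto
    ultimately show ?thesis using N(2) r1 by (simp add: rank_eq)
  qed
  then have S: "S \<subseteq> {1..<near_pencil_rank r n {..<n}}" using assms by auto
  have e: "npcl {} = {}" by (simp add: npcl_def)
  have "flag_h (near_pencil r n) (\<subseteq>) S = int (card (good_words (npcl {}) {..<n} S))"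
  proof (rule flag_h_eq_card_words[of id, OF _ _ _ S])
    show "bij_betw id (near_pencil r n) {F. flat F}" using flats_eq by (simp add: bij_betw_def)
    show "height (near_pencil r n) (\<subseteq>) F = near_pencil_rank r n (id F)" if "F \<in> near_pencil r n" for F
      using height_flats[of F] that flats_eq by auto
  qed simp
  also have "\<dots> \<le> int (beta (r + 1) S + (n - (r + 1)) * beta_inv r (r - 1) (r + 1) S)"
    unfolding e using card_words_le[of S] by (simp only: of_nat_le_iff)
  also have "beta_inv r (r - 1) (r + 1) S = beta_inv 1 0 (r + 1) S"
    using beta_inv_shift[of "r - 1" "r + 1" S] r1 by simp
  finally show ?thesis using rn by (simp add: of_nat_diff)
qed

end

theorem theorem3p5:
  fixes L :: "'a set" and le :: "'a \<Rightarrow> 'a \<Rightarrow> bool" and r n :: nat and S :: "nat set"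
  assumes "geometric_lattice L le"
    and "lattice_rank L le = r + 1"
    and "card (atoms L le) = n"
    and "1 \<le> r" and "r + 1 \<le> n"
    and "S \<subseteq> {1..r}"
  shows "flag_h L le S \<ge> flag_h (near_pencil r n) (\<subseteq>) S"
proof -
  interpret G: geom_lattice L le n by unfold_locales (rule assms)+
  interpret P: near_pencil_geometry r n by unfold_locales (rule assms)+
  have "S \<subseteq> {1..<r + 1}" using assms(6) by auto
  then show ?thesis
    using G.flag_h_lower_bound[OF assms(2)] P.flag_h_upper_bound[OF assms(6)] by (meson order_trans)
qed

end
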